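(* Let $A,P\in\mathrm{GL}(d,\mathbb R)$ and let $\pi$ be the quasi-regular representation of $G=\mathbb R^d\rtimes\langle A\rangle$ on $L^2(\mathbb R^d)$. Suppose $\psi\in\mathcal B_\pi$ and that the system $\{\pi(A^jPk,A^j)\psi\}_{j\in\mathbb Z,k\in\mathbb Z^d}=\{|\det A|^{-j/2}\psi(A^{-j}\cdot-Pk)\}_{j\in\mathbb Z,k\in\mathbb Z^d}$ is a frame for $L^2(\mathbb R^d)$ with frame bounds $0<C_1\le C_2<\infty$. Then $\{\pi(x,A^j)\psi\}_{x\in\mathbb R^d,j\in\mathbb Z}$ is a continuous frame for $L^2(\mathbb R^d)$ with frame bounds $C_1|\det P|$ and $C_2|\det P|$, i.e. $$C_1|\det P|\,\|f\|^2\le\sum_{j\in\mathbb Z}\int_{\mathbb R^d}|\langle f,\pi(x,A^j)\psi\rangle|^2\,|\det A|^{-j}\,dx\le C_2|\det P|\,\|f\|^2\quad\forall f\in L^2(\mathbb R^d),$$ and $$C_1\le\frac{1}{|\det P|}\sum_{j\in\mathbb Z}|\widehat\psi((A^t)^j\xi)|^2\le C_2\quad\text{for a.e. }\xi\in\mathbb R^d.$$ In particular, if the discrete system is a Parseval frame ($C_1=C_2=1$), then the continuous system is a tight frame and $\sum_{j\in\mathbb Z}|\widehat\psi((A^t)^j\xi)|^2=|\det P|$ for a.e. $\xi$.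
   Context: For $A\in\mathrm{GL}(d,\mathbb R)$, $G=\mathbb R^d\rtimes\langle A\rangle$ is the group of pairs $(x,A^j)$, $x\in\mathbb R^d$, $j\in\mathbb Z$ (indexed by $(x,j)\in\mathbb R^d\times\mathbb Z$), with product $(x,A^j)(y,A^k)=(x+A^jy,A^{j+k})$; left Haar measure $d\mu_G(x,A^j)=|\det A|^{-j}dx\,d\mu_c(j)$ ($\mu_c$ counting measure), and $L^2(G)$ is with respect to $\mu_G$. The quasi-regular representation is $\pi(x,A^j)f(t)=|\det A|^{-j/2}f(A^{-j}(t-x))$, $t\in\mathbb R^d$, a unitary representation on $L^2(\mathbb R^d)$. For $\psi,f\in L^2(\mathbb R^d)$, $C_\psi f(g)=\langle f,\pi(g)\psi\rangle$, $g\in G$. For a fixed compact neighborhood $Q$ of the identity of $G$, $MF(g)=\sup_{q\in Q}|F(gq)|$, $W(L^2)=\{F\in L^\infty_{loc}(G): MF\in L^2(G)\}$ (independent of $Q$), and $\mathcal B_\pi=\{\psi\in L^2(\mathbb R^d): C_\psi f\in W(L^2)\ \forall f\in L^2(\mathbb R^d)\}$; equivalently, $\psi\in\mathcal B_\pi$ iff $\{\pi(\lambda)\psi\}_{\lambda\in\Lambda}$ is a Bessel sequence for every relatively separated $\Lambda\subseteq G$. Fourier transform: $\widehat f(\xi)=\int_{\mathbb R^d}f(x)e^{-2\pi i x\cdot\xi}dx$; $A^t$ is the transpose of $A$. *)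

theory Defs
  imports "HOL-Analysis.Analysis"
begin

text \<open>Integer powers of a (real, square) matrix, acting on vectors:
  A^j x for j \<ge> 0, and (A^{-1})^{-j} x for j < 0.\<close>
definition mat_ipow_app :: "real^'d^'d \<Rightarrow> int \<Rightarrow> real^'d \<Rightarrow> real^'d" where
  "mat_ipow_app A j x =
     (if 0 \<le> j then (((*v) A) ^^ nat j) x else (((*v) (matrix_inv A)) ^^ nat (- j)) x)"

text \<open>L^2(R^d) (as a set of representatives) and its inner product / norm.\<close>
definition L2 :: "(real^'d \<Rightarrow> complex) set" where
  "L2 = {f. f \<in> borel_measurable lebesgue \<and> integrable lebesgue (\<lambda>t. (cmod (f t))\<^sup>2)}"

definition L2_inner :: "(real^'d \<Rightarrow> complex) \<Rightarrow> (real^'d \<Rightarrow> complex) \<Rightarrow> complex" where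
  "L2_inner f g = integral\<^sup>L lebesgue (\<lambda>t. f t * cnj (g t))"

definition L2_norm :: "(real^'d \<Rightarrow> complex) \<Rightarrow> real" where
  "L2_norm f = sqrt (integral\<^sup>L lebesgue (\<lambda>t. (cmod (f t))\<^sup>2))"

text \<open>Quasi-regular representation of G = R^d \<rtimes> <A>; the element (x, A^j) is indexed by (x, j).\<close>
definition qreg :: "real^'d^'d \<Rightarrow> (real^'d) \<times> int \<Rightarrow> (real^'d \<Rightarrow> complex) \<Rightarrow> real^'d \<Rightarrow> complex" where
  "qreg A g f t = complex_of_real (\<bar>det A\<bar> powr (- real_of_int (snd g) / 2))
                   * f (mat_ipow_app A (- snd g) (t - fst g))"

text \<open>Voice transform C_psi f (g) = < f, pi(g) psi >.\<close>
definition voice :: "real^'d^'d \<Rightarrow> (real^'d \<Rightarrow> complex) \<Rightarrow> (real^'d \<Rightarrow> complex) \<Rightarrow> (real^'d) \<times> int \<Rightarrow> complex" where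
  "voice A psi f g = L2_inner f (qreg A g psi)"

text \<open>Local maximal function with the compact identity neighbourhood
  Q = cball 0 1 \<times> {A^0}; note (x,A^j)(y,A^0) = (x + A^j y, A^j).\<close>
definition locmax :: "real^'d^'d \<Rightarrow> ((real^'d) \<times> int \<Rightarrow> complex) \<Rightarrow> (real^'d) \<times> int \<Rightarrow> ennreal" where
  "locmax A F g = (SUP y \<in> cball 0 1. ennreal (cmod (F (fst g + mat_ipow_app A (snd g) y, snd g))))"

text \<open>Wiener amalgam space W(L^2) on G with left Haar measure |det A|^{-j} dx d(counting)(j).\<close>
definition wiener_L2 :: "real^'d^'d \<Rightarrow> ((real^'d) \<times> int \<Rightarrow> complex) \<Rightarrow> bool" where
  "wiener_L2 A F \<longleftrightarrow>
     (\<forall>j. (\<lambda>x. F (x, j)) \<in> borel_measurable lebesgue) \<and>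
     (\<forall>j. (\<lambda>x. locmax A F (x, j)) \<in> borel_measurable lebesgue) \<and>
     (\<integral>\<^sup>+ j. (\<integral>\<^sup>+ x. (locmax A F (x, j))\<^sup>2 * ennreal (\<bar>det A\<bar> powr (- real_of_int j)) \<partial>lebesgue)
        \<partial>count_space UNIV) < \<infinity>"

text \<open>The space B_pi.\<close>
definition B_pi :: "real^'d^'d \<Rightarrow> (real^'d \<Rightarrow> complex) set" where
  "B_pi A = {psi \<in> L2. \<forall>f \<in> L2. wiener_L2 A (voice A psi f)}"

text \<open>g is the (Plancherel) L^2 Fourier transform of psi: the L^2 limit of the
  Fourier integrals of psi restricted to balls of radius n.\<close>
definition fourier_L2 :: "(real^'d \<Rightarrow> complex) \<Rightarrow> (real^'d \<Rightarrow> complex) \<Rightarrow> bool" where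
  "fourier_L2 psi g \<longleftrightarrow> g \<in> L2 \<and>
     (\<lambda>n::nat. \<integral>\<^sup>+ \<xi>. ennreal ((cmod (g \<xi> -
         integral\<^sup>L lebesgue (\<lambda>x. indicator (ball 0 (real n)) x *\<^sub>R
             (psi x * cis (- 2 * pi * (x \<bullet> \<xi>))))))\<^sup>2) \<partial>lebesgue)
     \<longlonglongrightarrow> 0"

end

theory Submission
  imports Defs "HOL-Probability.Characteristic_Functions"
begin

text \<open>
  Applying the discrete frame inequality to the translates \<open>f (y + \<cdot>)\<close> bounds
  \<open>\<Sum>\<^sub>j \<Sum>\<^sub>k \<bar>F (y + A\<^sup>j P k, j)\<bar>\<^sup>2\<close> for every \<open>y\<close>, where \<open>F\<close> is the voice transform
  of \<open>f\<close>. Averaging over \<open>y\<close> in a ball of radius \<open>n\<close> and letting \<open>n \<rightarrow> \<infinity>\<close> turns the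
  \<open>j\<close>-th lattice sum into \<open>\<integral> \<bar>F (x, j)\<bar>\<^sup>2 dx\<close> divided by the covolume of \<open>A\<^sup>j P\<close>. The limit may be
  taken under the sum over \<open>j\<close> because the \<open>j\<close>-th average is dominated by the local maximal
  function of \<open>F\<close>, whose square is summable as \<open>psi \<in> B_pi A\<close>.

  For the Fourier side, the continuous frame inequality is tested on the inverse transforms of
  indicators of sets \<open>E\<close> of finite measure. By Plancherel it then bounds the integral of
  \<open>\<Sum>\<^sub>j \<bar>g ((A\<^sup>t)\<^sup>j \<xi>)\<bar>\<^sup>2\<close> over \<open>E\<close> by multiples of the measure of \<open>E\<close>.
\<close>

subsection \<open>Linear change of variables\<close>

text \<open>The lattices A^j P Z^d for different j have in general no common bounded fundamental
  domain, so no single averaging domain turns all lattice sums into integrals exactly. Large balls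
  do so asymptotically for every j: the relative error at radius n is of order c_j / n, with c_j the
  size of a cell of the j-th lattice. As c_j need not be bounded in j, there is no uniform rate, and
  the exchange of limit and sum rests on a majorant. It comes from ellipsoids A^j (ball r) placed
  around the lattice points: r depends on P alone, so they are disjoint at every level, and dividing
  by their volumes produces the Haar weight |det A|^(-j). The covolume |det A|^j |det P| in the
  limit is the origin of both the Haar weight and the factor |det P| in the result.

  On the Fourier side all powers of |det A| cancel, so level j contributes the integral of
  |g((A^t)^j \<xi>)|^2 over E with weight one. Plancherel for functions that are both integrable and
  square integrable suffices, because \<open>fourier_L2\<close> describes g through truncations of
  psi, which are of this kind.\<close>

lemma nn_integral_lborel_translate:
  fixes f :: "'a::euclidean_space \<Rightarrow> ennreal"
  assumes [measurable]: "f \<in> borel_measurable borel"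
  shows "(\<integral>\<^sup>+x. f (a + x) \<partial>lborel) = (\<integral>\<^sup>+x. f x \<partial>lborel)"
proof -
  have "(\<integral>\<^sup>+x. f x \<partial>lborel) = (\<integral>\<^sup>+x. f x \<partial>distr lborel borel ((+) a))"
    by (simp add: lborel_distr_plus)
  also have "\<dots> = (\<integral>\<^sup>+x. f (a + x) \<partial>lborel)"
    by (rule nn_integral_distr) auto
  finally show ?thesis ..
qed

lemma linear_borel_measurable:
  fixes T :: "'a::euclidean_space \<Rightarrow> 'b::real_normed_vector"
  assumes "linear T"
  shows "T \<in> borel_measurable borel"
  using assms
  by (intro borel_measurable_continuous_onI linear_continuous_on) (simp add: linear_conv_bounded_linear)

text \<open>Evaluating \<open>\<integral>\<integral> f (x + y) g y\<close> in both orders shows that Haar measure is unique.\<close>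

lemma translation_invariant_nn_integral:
  fixes \<mu> :: "'a::euclidean_space measure"
  assumes sets[measurable_cong]: "sets \<mu> = sets borel" and "sigma_finite_measure \<mu>"
    and inv: "\<And>a h. h \<in> borel_measurable borel \<Longrightarrow> (\<integral>\<^sup>+x. h (a + x) \<partial>\<mu>) = (\<integral>\<^sup>+x. h x \<partial>\<mu>)"
    and [measurable]: "f \<in> borel_measurable borel" "g \<in> borel_measurable borel"
  shows "(\<integral>\<^sup>+x. f x \<partial>\<mu>) * (\<integral>\<^sup>+x. g x \<partial>lborel) = (\<integral>\<^sup>+x. f x \<partial>lborel) * (\<integral>\<^sup>+x. g (- x) \<partial>\<mu>)"
proof -
  interpret \<mu>: sigma_finite_measure \<mu> by fact
  interpret P: pair_sigma_finite \<mu> "lborel :: 'a measure" ..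
  have "(\<integral>\<^sup>+x. f x \<partial>\<mu>) * (\<integral>\<^sup>+x. g x \<partial>lborel) = (\<integral>\<^sup>+y. (\<integral>\<^sup>+x. f x \<partial>\<mu>) * g y \<partial>lborel)"
    by (simp add: nn_integral_cmult)
  also have "\<dots> = (\<integral>\<^sup>+y. (\<integral>\<^sup>+x. f (y + x) \<partial>\<mu>) * g y \<partial>lborel)"
    by (simp add: inv)
  also have "\<dots> = (\<integral>\<^sup>+y. (\<integral>\<^sup>+x. f (y + x) * g y \<partial>\<mu>) \<partial>lborel)"
    by (simp add: nn_integral_multc)
  also have "\<dots> = (\<integral>\<^sup>+x. (\<integral>\<^sup>+y. f (y + x) * g y \<partial>lborel) \<partial>\<mu>)"
    by (rule P.Fubini') measurable
  \<comment> \<open>For fixed x, invariance of \<open>lborel\<close> moves the shift from f onto g;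
    after the next exchange the inner integral of g over \<open>\<mu>\<close> no longer depends on
    y.\<close>
  also have "\<dots> = (\<integral>\<^sup>+x. (\<integral>\<^sup>+y. f y * g (y - x) \<partial>lborel) \<partial>\<mu>)"
  proof (rule nn_integral_cong)
    fix x show "(\<integral>\<^sup>+y. f (y + x) * g y \<partial>lborel) = (\<integral>\<^sup>+y. f y * g (y - x) \<partial>lborel)"
      using nn_integral_lborel_translate[of "\<lambda>y. f y * g (y - x)" x] by (simp add: add.commute)
  qed
  also have "\<dots> = (\<integral>\<^sup>+y. (\<integral>\<^sup>+x. f y * g (y - x) \<partial>\<mu>) \<partial>lborel)"
    by (rule P.Fubini'[symmetric]) measurable
  also have "\<dots> = (\<integral>\<^sup>+y. f y * (\<integral>\<^sup>+x. g (y - x) \<partial>\<mu>) \<partial>lborel)"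
    by (simp add: nn_integral_cmult)
  also have "\<dots> = (\<integral>\<^sup>+y. f y * (\<integral>\<^sup>+x. g (- x) \<partial>\<mu>) \<partial>lborel)"
    using inv[of "\<lambda>x. g (- x)" "- y" for y] by simp
  finally show ?thesis by (simp add: nn_integral_multc)
qed

text \<open>The pushforward of \<open>lborel\<close> under T is again translation invariant, so
  uniqueness makes it a multiple of \<open>lborel\<close>. Testing against the indicator
  \<open>b\<close> of the unit ball, whose volume \<open>v\<close> is positive and finite, allows
  the constant to be isolated by division. Its value is left open here; for an involution it
  determines itself.\<close>

lemma nn_integral_linear_scale:
  fixes T :: "'a::euclidean_space \<Rightarrow> 'a"
  assumes T: "linear T" "inj T"
  shows "\<exists>c. \<forall>h\<in>borel_measurable borel. (\<integral>\<^sup>+x. h (T x) \<partial>lborel) = c * (\<integral>\<^sup>+x. h x \<partial>lborel)"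
proof -
  interpret T: linear T by fact
  have [measurable]: "T \<in> borel_measurable borel"
    by (rule linear_borel_measurable[OF T(1)])
  define \<mu> where "\<mu> = distr lborel borel T"
  have sets\<mu>[simp, measurable_cong]: "sets \<mu> = sets borel" by (simp add: \<mu>_def)
  \<comment> \<open>The lower bound makes preimages of balls bounded. Hence the pushforward is
    finite on balls and sigma-finite, as the exchange of integrals requires.\<close>
  obtain B where B: "B > 0" "\<And>x. B * norm x \<le> norm (T x)"
    using linear_inj_bounded_below_pos[OF T] by metis
  have fin: "emeasure \<mu> (ball 0 r) < \<infinity>" for r
  proof -
    have "emeasure \<mu> (ball 0 r) = emeasure lborel (T -` ball 0 r)"
      by (simp add: \<mu>_def emeasure_distr)
    also have "bounded (T -` ball 0 r)"
    proof (rule boundedI)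
      fix x assume "x \<in> T -` ball 0 r"
      then have "B * norm x \<le> r" using B(2)[of x] by simp
      then show "norm x \<le> r / B" using B(1) by (simp add: field_simps)
    qed
    then have "emeasure lborel (T -` ball 0 r) < \<infinity>"
      by (rule emeasure_bounded_finite)
    finally show ?thesis .
  qed
  have sf: "sigma_finite_measure \<mu>"
  proof
    have "(\<Union>n::nat. ball 0 (real n)) = (UNIV :: 'a set)"
      by (auto simp: reals_Archimedean2)
    with fin show "\<exists>A. countable A \<and> A \<subseteq> sets \<mu> \<and> \<Union> A = space \<mu> \<and> (\<forall>a\<in>A. emeasure \<mu> a \<noteq> \<infinity>)"
      by (intro exI[of _ "range (\<lambda>n::nat. ball 0 (real n))"]) (auto simp: \<mu>_def less_top)
  qed
  have inv: "(\<integral>\<^sup>+x. h (a + x) \<partial>\<mu>) = (\<integral>\<^sup>+x. h x \<partial>\<mu>)" if [measurable]: "h \<in> borel_measurable borel" for a h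
  proof -
    obtain b where b: "a = T b"
      using linear_injective_imp_surjective[OF T] by (metis surjD)
    show ?thesis
      using nn_integral_lborel_translate[of "\<lambda>x. h (T x)" b]
      by (simp add: \<mu>_def nn_integral_distr b T.add)
  qed
  define b where "b = (indicator (ball 0 1) :: 'a \<Rightarrow> ennreal)"
  have [measurable]: "b \<in> borel_measurable borel" unfolding b_def by (intro borel_measurable_indicator) simp
  define v where "v = emeasure lborel (ball (0::'a) 1)"
  have v: "v \<noteq> 0" "v \<noteq> top"
    using content_ball_pos[of 1 "0::'a"] emeasure_bounded_finite[of "ball (0::'a) 1"] bounded_ball
    by (auto simp: v_def measure_def less_top)
  have bv: "(\<integral>\<^sup>+x. b x \<partial>lborel) = v" by (simp add: b_def v_def)
  show ?thesis
  proof (intro exI ballI)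
    fix h :: "'a \<Rightarrow> ennreal" assume [measurable]: "h \<in> borel_measurable borel"
    have "(\<integral>\<^sup>+x. h (T x) \<partial>lborel) * v = (\<integral>\<^sup>+x. h x \<partial>lborel) * (\<integral>\<^sup>+x. b (- x) \<partial>\<mu>)"
      using translation_invariant_nn_integral[OF sets\<mu> sf inv, of h b]
      by (simp add: bv \<mu>_def nn_integral_distr)
    then have "(\<integral>\<^sup>+x. h (T x) \<partial>lborel) * v / v = (\<integral>\<^sup>+x. h x \<partial>lborel) * (\<integral>\<^sup>+x. b (- x) \<partial>\<mu>) / v"
      by simp
    then show "(\<integral>\<^sup>+x. h (T x) \<partial>lborel) = ((\<integral>\<^sup>+x. b (- x) \<partial>\<mu>) / v) * (\<integral>\<^sup>+x. h x \<partial>lborel)"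
      using v by (metis ennreal_mult_divide_eq ennreal_times_divide mult.commute)
  qed
qed

text \<open>Applying T twice multiplies integrals by c * c and is the identity; a nonnegative c with
  c * c = 1 is 1. Coordinate swaps and reflections are handled in this way without computing a
  volume.\<close>

lemma nn_integral_linear_involution:
  fixes T :: "'a::euclidean_space \<Rightarrow> 'a"
  assumes T: "linear T" and inv: "\<And>x. T (T x) = x" and [measurable]: "h \<in> borel_measurable borel"
  shows "(\<integral>\<^sup>+x. h (T x) \<partial>lborel) = (\<integral>\<^sup>+x. h x \<partial>lborel)"
proof -
  have "inj T" by (metis injI inv)
  then obtain c where c: "\<And>h. h\<in>borel_measurable borel \<Longrightarrow> (\<integral>\<^sup>+x. h (T x) \<partial>lborel) = c * (\<integral>\<^sup>+x. h x \<partial>lborel)"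
    using nn_integral_linear_scale[OF T] by blast
  have [measurable]: "T \<in> borel_measurable borel"
    by (rule linear_borel_measurable[OF T])
  define b where "b = (indicator (ball 0 1) :: 'a \<Rightarrow> ennreal)"
  have [measurable]: "b \<in> borel_measurable borel" unfolding b_def by (intro borel_measurable_indicator) simp
  define v where "v = emeasure lborel (ball (0::'a) 1)"
  have v: "v \<noteq> 0" "v \<noteq> top"
    using content_ball_pos[of 1 "0::'a"] emeasure_bounded_finite[of "ball (0::'a) 1"] bounded_ball
    by (auto simp: v_def measure_def less_top)
  have bv: "(\<integral>\<^sup>+x. b x \<partial>lborel) = v" by (simp add: b_def v_def)
  have "v = (\<integral>\<^sup>+x. b (T (T x)) \<partial>lborel)" by (simp add: inv bv)
  also have "\<dots> = c * (c * v)"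
    using c[of b] by (subst c[of "\<lambda>x. b (T x)"]) (auto simp: bv)
  finally have "v / v = (c * c) * v / v" by (simp add: mult.assoc)
  then have "1 = c * c" using v by (simp add: ennreal_mult_divide_eq less_top)
  then have "c = 1"
    by (cases c) (auto simp: ennreal_power power2_eq_1_iff simp flip: power2_eq_square)
  with c show ?thesis by simp
qed

lemma prod_Basis_vec: "(\<Prod>b\<in>(Basis::(real^'n) set). f b) = (\<Prod>i\<in>UNIV. f (axis i 1))"
proof -
  have "(Basis::(real^'n) set) = range (\<lambda>i. axis i 1)"
    by (auto simp: Basis_vec_def)
  then have "(\<Prod>b\<in>(Basis::(real^'n) set). f b) = prod f (range (\<lambda>i. axis i 1))"
    by simp
  also have "\<dots> = (\<Prod>i\<in>UNIV. f (axis i 1))"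
    by (subst prod.reindex) (auto simp: inj_on_def axis_eq_axis)
  finally show ?thesis .
qed

text \<open>\<open>induct_linear_elementary\<close> leaves compositions, maps with a vanishing
  coordinate, diagonal maps, swaps and shears. The condition on the determinant sits inside the
  induction because the induction ranges over singular maps too, and \<open>h\<close> is quantified
  inside because the composition step applies the hypothesis on \<open>g\<close> to \<open>h\<close>
  composed with \<open>f\<close>.\<close>

lemma nn_integral_linear_vec:
  fixes T :: "real^'n \<Rightarrow> real^'n"
  assumes "linear T" "det (matrix T) \<noteq> 0" "h \<in> borel_measurable borel"
  shows "ennreal \<bar>det (matrix T)\<bar> * (\<integral>\<^sup>+x. h (T x) \<partial>lborel) = (\<integral>\<^sup>+x. h x \<partial>lborel)"
proof -
  have "det (matrix T) \<noteq> 0 \<longrightarrow> (\<forall>h\<in>borel_measurable borel. ennreal \<bar>det (matrix T)\<bar> * (\<integral>\<^sup>+x. h (T x) \<partial>lborel) = (\<integral>\<^sup>+x. h x \<partial>lborel))"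
  proof (rule induct_linear_elementary [OF \<open>linear T\<close>]; intro impI ballI)
    fix f g :: "real^'n \<Rightarrow> real^'n" and h :: "real^'n \<Rightarrow> ennreal"
    assume lin: "linear f" "linear g" and [measurable]: "h \<in> borel_measurable borel"
      and f: "det (matrix f) \<noteq> 0 \<longrightarrow> (\<forall>h\<in>borel_measurable borel. ennreal \<bar>det (matrix f)\<bar> * (\<integral>\<^sup>+x. h (f x) \<partial>lborel) = (\<integral>\<^sup>+x. h x \<partial>lborel))"
      and g: "det (matrix g) \<noteq> 0 \<longrightarrow> (\<forall>h\<in>borel_measurable borel. ennreal \<bar>det (matrix g)\<bar> * (\<integral>\<^sup>+x. h (g x) \<partial>lborel) = (\<integral>\<^sup>+x. h x \<partial>lborel))"
      and d: "det (matrix (f \<circ> g)) \<noteq> 0"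
    note [measurable] = linear_borel_measurable[OF lin(1)] linear_borel_measurable[OF lin(2)]
    have d': "det (matrix (f \<circ> g)) = det (matrix f) * det (matrix g)"
      by (simp add: lin det_mul matrix_compose)
    with d have "ennreal \<bar>det (matrix g)\<bar> * (\<integral>\<^sup>+x. h (f (g x)) \<partial>lborel) = (\<integral>\<^sup>+x. h (f x) \<partial>lborel)"
      using g by (auto dest!: bspec[of _ _ "\<lambda>x. h (f x)"])
    then have "ennreal \<bar>det (matrix f)\<bar> * (ennreal \<bar>det (matrix g)\<bar> * (\<integral>\<^sup>+x. h (f (g x)) \<partial>lborel)) = (\<integral>\<^sup>+x. h x \<partial>lborel)"
      using f d d' by auto
    then show "ennreal \<bar>det (matrix (f \<circ> g))\<bar> * (\<integral>\<^sup>+x. h ((f \<circ> g) x) \<partial>lborel) = (\<integral>\<^sup>+x. h x \<partial>lborel)"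
      by (simp add: d' abs_mult ennreal_mult mult.assoc)
  next
    fix f :: "real^'n \<Rightarrow> real^'n" and i and h :: "real^'n \<Rightarrow> ennreal"
    assume f: "linear f" "\<And>x. f x $ i = 0" "det (matrix f) \<noteq> 0"
    then have "row i (matrix f) = 0"
      by (simp add: row_def matrix_def vec_eq_iff)
    with f show "ennreal \<bar>det (matrix f)\<bar> * (\<integral>\<^sup>+x. h (f x) \<partial>lborel) = (\<integral>\<^sup>+x. h x \<partial>lborel)"
      by (simp add: det_zero_row)
  next
    fix c :: "'n \<Rightarrow> real" and h :: "real^'n \<Rightarrow> ennreal"
    let ?f = "\<lambda>x :: real^'n. \<chi> i. c i * x $ i"
    assume d: "det (matrix ?f) \<noteq> 0" and [measurable]: "h \<in> borel_measurable borel"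
    have lin: "linear ?f" by (rule linearI) (simp_all add: vec_eq_iff algebra_simps)
    note [measurable] = linear_borel_measurable[OF lin]
    have det: "det (matrix ?f) = (\<Prod>i\<in>UNIV. c i)"
      by (subst det_diagonal) (auto simp: matrix_def axis_def)
    with d have c0: "c i \<noteq> 0" for i by auto
    \<comment> \<open>\<open>c'\<close> carries the diagonal entries from indices to basis vectors,
      the form in which \<open>lborel_affine_euclidean\<close> takes its scaling factors.\<close>
    define c' where "c' b = (\<chi> i. c i) \<bullet> b" for b :: "real^'n"
    have c': "c' (axis i 1) = c i" for i by (simp add: c'_def inner_axis)
    have eq: "(0 + (\<Sum>j\<in>Basis. (c' j * (x \<bullet> j)) *\<^sub>R j)) = ?f x" for x :: "real^'n"
    proof -
      have "?f x \<bullet> j = c' j * (x \<bullet> j)" if "j \<in> Basis" for j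
        using that by (auto simp: Basis_vec_def c' inner_axis)
      then show ?thesis
        using euclidean_representation[of "?f x"] by simp
    qed
    have "c' j \<noteq> 0" if "j \<in> Basis" for j
      using that by (auto simp: Basis_vec_def c' c0)
    then have "lborel = density (distr lborel borel ?f) (\<lambda>_. (\<Prod>j\<in>Basis. \<bar>c' j\<bar>))"
      using lborel_affine_euclidean[of c' 0] unfolding eq by blast 
    moreover have "(\<Prod>j\<in>Basis. \<bar>c' j\<bar>) = \<bar>det (matrix ?f)\<bar>"
      by (simp add: prod_Basis_vec c' det abs_prod)
    ultimately have "(\<integral>\<^sup>+x. h x \<partial>lborel) = (\<integral>\<^sup>+x. h x \<partial>density (distr lborel borel ?f) (\<lambda>_. \<bar>det (matrix ?f)\<bar>))"
      by simp
    also have "\<dots> = ennreal \<bar>det (matrix ?f)\<bar> * (\<integral>\<^sup>+x. h (?f x) \<partial>lborel)"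
      by (simp add: nn_integral_density nn_integral_distr nn_integral_cmult)
    finally show "ennreal \<bar>det (matrix ?f)\<bar> * (\<integral>\<^sup>+x. h (?f x) \<partial>lborel) = (\<integral>\<^sup>+x. h x \<partial>lborel)" ..
  next
    fix m n :: 'n and h :: "real^'n \<Rightarrow> ennreal"
    let ?f = "\<lambda>x :: real^'n. \<chi> i. x $ Transposition.transpose m n i"
    assume "m \<noteq> n" and [measurable]: "h \<in> borel_measurable borel"
    have lin: "linear ?f" by (rule linearI) (simp_all add: vec_eq_iff)
    have "matrix ?f = (\<chi> i. mat 1 $ Transposition.transpose m n i :: real^'n^'n)"
      by (simp add: matrix_def mat_def axis_def vec_eq_iff)
    then have "\<bar>det (matrix ?f)\<bar> = 1"
      by (simp add: det_permute_rows permutes_swap_id sign_swap_id abs_mult)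
    moreover have "(\<integral>\<^sup>+x. h (?f x) \<partial>lborel) = (\<integral>\<^sup>+x. h x \<partial>lborel)"
      by (rule nn_integral_linear_involution[OF lin]) (auto simp: vec_eq_iff)
    ultimately show "ennreal \<bar>det (matrix ?f)\<bar> * (\<integral>\<^sup>+x. h (?f x) \<partial>lborel) = (\<integral>\<^sup>+x. h x \<partial>lborel)"
      by simp
  next
    fix m n :: 'n and h :: "real^'n \<Rightarrow> ennreal"
    let ?f = "\<lambda>x :: real^'n. \<chi> i. if i = m then x $ m + x $ n else x $ i"
    assume mn: "m \<noteq> n" and [measurable]: "h \<in> borel_measurable borel"
    \<comment> \<open>The shear is a product of the two reflections \<open>R \<circ> ?f\<close> and \<open>R\<close>.\<close>
    define R where "R = (\<lambda>x :: real^'n. \<chi> i. if i = m then - x $ m else x $ i)"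
    have lin: "linear ?f" "linear R" "linear (\<lambda>x. R (?f x))"
      by (auto intro!: linearI simp: vec_eq_iff R_def algebra_simps)
    note [measurable] = linear_borel_measurable[OF lin(1)] linear_borel_measurable[OF lin(2)]
    have "matrix ?f = (\<chi> i. if i = m then row m (mat 1) + 1 *s row n (mat 1) else row i (mat 1 :: real^'n^'n))"
      using mn by (auto simp: matrix_def mat_def axis_def vec_eq_iff row_def)
    then have det: "det (matrix ?f) = 1"
      by (simp only: det_row_operation[OF mn]) simp
    have RR: "R (R x) = x" for x by (auto simp: vec_eq_iff R_def)
    have hR: "(\<lambda>x. h (R x)) \<in> borel_measurable borel" by measurable
    have "(\<integral>\<^sup>+x. h x \<partial>lborel) = (\<integral>\<^sup>+x. h (R x) \<partial>lborel)"
      by (rule nn_integral_linear_involution[symmetric, OF lin(2)]) (auto simp: vec_eq_iff R_def)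
    also have "\<dots> = (\<integral>\<^sup>+x. h (R (R (?f x))) \<partial>lborel)"
      by (rule nn_integral_linear_involution[symmetric, OF lin(3) _ hR]) (use mn in \<open>auto simp: vec_eq_iff R_def\<close>)
    finally show "ennreal \<bar>det (matrix ?f)\<bar> * (\<integral>\<^sup>+x. h (?f x) \<partial>lborel) = (\<integral>\<^sup>+x. h x \<partial>lborel)"
      by (simp add: det RR)
  qed
  with assms show ?thesis by blast
qed

section \<open>Affine substitutions for Borel and Lebesgue measurable functions\<close>

lemma measurable_affine_vec: "(\<lambda>x. a + (M :: real^'n^'m) *v x) \<in> borel \<rightarrow>\<^sub>M borel"
  by (intro borel_measurable_continuous_onI continuous_intros matrix_vector_mult_linear_continuous_on)

lemma nn_integral_affine_vec_borel:
  fixes M :: "real^'n^'n"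
  assumes "invertible M" and [measurable]: "h \<in> borel_measurable borel"
  shows "(\<integral>\<^sup>+x. h x \<partial>lborel) = ennreal \<bar>det M\<bar> * (\<integral>\<^sup>+x. h (a + M *v x) \<partial>lborel)"
  using nn_integral_linear_vec[of "(*v) M" "\<lambda>x. h (a + x)"] assms
  by (simp add: nn_integral_lborel_translate invertible_det_nz matrix_of_matrix_vector_mul)

lemma lborel_affine_vec:
  fixes M :: "real^'n^'n"
  assumes "invertible M"
  shows "lborel = density (distr lborel borel (\<lambda>x. a + M *v x)) (\<lambda>_. \<bar>det M\<bar>)"
proof (rule measure_eqI)
  note [measurable] = measurable_affine_vec[of a M]
  fix S :: "(real^'n) set" assume "S \<in> sets lborel"
  then have [measurable]: "S \<in> sets borel" by simp
  show "emeasure lborel S = emeasure (density (distr lborel borel (\<lambda>x. a + M *v x)) (\<lambda>_. \<bar>det M\<bar>)) S"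
    using nn_integral_affine_vec_borel[OF assms, of "indicator S" a]
    by (simp add: emeasure_density nn_integral_cmult nn_integral_distr del: nn_integral_indicator)
       (simp add: nn_integral_indicator)
qed simp

text \<open>A Borel map need not pull Lebesgue sets back to Lebesgue sets. An invertible affine map
  does, because it preserves null sets in both directions. The same equality \<open>eq\<close> of
  null sets lets completion commute with the pushforward, so the Borel formula passes to
  \<open>lebesgue\<close>.\<close>

lemma
  fixes M :: "real^'n^'n"
  assumes M: "invertible M"
  shows lebesgue_affine_vec: "lebesgue = density (distr lebesgue lebesgue (\<lambda>x. a + M *v x)) (\<lambda>_. \<bar>det M\<bar>)"
    and lebesgue_affine_vec_measurable: "(\<lambda>x. a + M *v x) \<in> lebesgue \<rightarrow>\<^sub>M lebesgue"
proof -
  let ?T = "\<lambda>x. a + M *v x"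
  note T[measurable] = measurable_affine_vec[of a M]
  have pos: "0 < \<bar>det M\<bar>" using M by (simp add: invertible_det_nz)
  { fix A :: "(real^'n) set" assume A: "A \<in> sets borel"
    then have "emeasure lborel A = 0 \<longleftrightarrow> emeasure (density (distr lborel borel ?T) (\<lambda>_. \<bar>det M\<bar>)) A = 0"
      by (subst lborel_affine_vec[OF M, symmetric]) auto
    also have "\<dots> \<longleftrightarrow> emeasure (distr lebesgue lborel ?T) A = 0"
      using A pos by (simp add: distr_completion emeasure_density nn_integral_cmult cong: distr_cong)
    finally have "emeasure lborel A = 0 \<longleftrightarrow> emeasure (distr lebesgue lborel ?T) A = 0" . }
  then have eq: "null_sets lborel = null_sets (distr lebesgue lborel ?T)"
    by (auto simp: null_sets_def)
  show "?T \<in> lebesgue \<rightarrow>\<^sub>M lebesgue"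
    by (simp add: completion.measurable_completion2 eq measurable_completion)
  have "lebesgue = completion (density (distr lborel borel ?T) (\<lambda>_. \<bar>det M\<bar>))"
    by (subst lborel_affine_vec[OF M, of a]) simp
  also have "\<dots> = density (completion (distr lebesgue lborel ?T)) (\<lambda>_. \<bar>det M\<bar>)"
    using pos by (auto intro!: always_eventually completion_density_eq simp: distr_completion cong: distr_cong)
  also have "\<dots> = density (distr lebesgue lebesgue ?T) (\<lambda>_. \<bar>det M\<bar>)"
    by (subst completion.completion_distr_eq) (auto simp: eq measurable_completion)
  finally show "lebesgue = density (distr lebesgue lebesgue ?T) (\<lambda>_. \<bar>det M\<bar>)" .
qed

lemma nn_integral_affine_vec:
  fixes M :: "real^'n^'n"
  assumes M: "invertible M" and [measurable]: "h \<in> borel_measurable lebesgue"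
  shows "(\<integral>\<^sup>+x. h x \<partial>lebesgue) = ennreal \<bar>det M\<bar> * (\<integral>\<^sup>+x. h (a + M *v x) \<partial>lebesgue)"
proof -
  note [measurable] = lebesgue_affine_vec_measurable[OF M, of a]
  show ?thesis
    by (subst lebesgue_affine_vec[OF M, of a])
       (simp add: nn_integral_density nn_integral_distr nn_integral_cmult)
qed

lemma
  fixes M :: "real^'n^'n" and f :: "real^'n \<Rightarrow> 'b::{banach, second_countable_topology}"
  assumes M: "invertible M" and [measurable]: "f \<in> borel_measurable lebesgue"
  shows integral_affine_vec: "(\<integral>x. f x \<partial>lebesgue) = \<bar>det M\<bar> *\<^sub>R (\<integral>x. f (a + M *v x) \<partial>lebesgue)"
    and integrable_affine_vec: "integrable lebesgue (\<lambda>x. f (a + M *v x)) \<longleftrightarrow> integrable lebesgue f"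
proof -
  note [measurable] = lebesgue_affine_vec_measurable[OF M, of a]
  have nz: "\<bar>det M\<bar> \<noteq> 0" using M by (simp add: invertible_det_nz)
  have integrable_scaleR_iff: "integrable lebesgue (\<lambda>x. \<bar>det M\<bar> *\<^sub>R g x) \<longleftrightarrow> integrable lebesgue g"
    for g :: "real^'n \<Rightarrow> 'b"
    using nz integrable_scaleR_right[of "1 / \<bar>det M\<bar>" lebesgue "\<lambda>x. \<bar>det M\<bar> *\<^sub>R g x"] by auto
  show "(\<integral>x. f x \<partial>lebesgue) = \<bar>det M\<bar> *\<^sub>R (\<integral>x. f (a + M *v x) \<partial>lebesgue)"
    by (subst lebesgue_affine_vec[OF M, of a]) (simp add: integral_density integral_distr)
  show "integrable lebesgue (\<lambda>x. f (a + M *v x)) \<longleftrightarrow> integrable lebesgue f"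
    using nz by (subst (2) lebesgue_affine_vec[OF M, of a])
      (simp add: integrable_density integrable_distr_eq integrable_scaleR_iff)
qed

subsection \<open>The Plancherel identity\<close>

text \<open>Based on \<open>lborel\<close> rather than \<open>lebesgue\<close>, so that the Fubini
  arguments take place on the Borel sigma-algebra of the product; \<open>lfint\<close> is the
  counterpart for Lebesgue measurable functions.\<close>

definition fint :: "('a::euclidean_space \<Rightarrow> complex) \<Rightarrow> 'a \<Rightarrow> complex" where
  "fint u \<xi> = (\<integral>x. u x * cis (- 2 * pi * (x \<bullet> \<xi>)) \<partial>lborel)"

lemma cis_measurable [measurable]: "cis \<in> borel_measurable borel"
  by (intro borel_measurable_continuous_onI continuous_intros)

lemma integrable_mult_unimodular:
  fixes u c :: "'a \<Rightarrow> complex"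
  assumes "integrable M u" "c \<in> borel_measurable M" "\<And>x. cmod (c x) \<le> 1"
  shows "integrable M (\<lambda>x. u x * c x)"
proof (rule Bochner_Integration.integrable_bound[OF assms(1)])
  show "(\<lambda>x. u x * c x) \<in> borel_measurable M"
    using assms by (intro borel_measurable_times) auto
  show "AE x in M. cmod (u x * c x) \<le> cmod (u x)"
    using assms(3) by (auto simp: norm_mult mult_left_le)
qed

lemma fint_measurable [measurable]:
  assumes [measurable]: "u \<in> borel_measurable borel"
  shows "fint u \<in> borel_measurable borel"
  unfolding fint_def[abs_def] by measurable

lemma norm_fint_le: "cmod (fint u \<xi>) \<le> (\<integral>x. cmod (u x) \<partial>lborel)"
proof -
  have "cmod (fint u \<xi>) \<le> (\<integral>x. cmod (u x * cis (- 2 * pi * (x \<bullet> \<xi>))) \<partial>lborel)"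
    unfolding fint_def by (rule integral_norm_bound)
  then show ?thesis by (simp add: norm_mult)
qed

lemma integrable_pair_mult:
  fixes u v :: "'a::euclidean_space \<Rightarrow> complex"
  assumes u: "integrable lborel u" and v: "integrable lborel v"
  shows "integrable (lborel \<Otimes>\<^sub>M lborel) (\<lambda>(x, y). u x * v y)"
proof (rule lborel_pair.Fubini_integrable)
  have [measurable]: "u \<in> borel_measurable borel" "v \<in> borel_measurable borel"
    using u v by auto
  show "(\<lambda>(x, y). u x * v y) \<in> borel_measurable (lborel \<Otimes>\<^sub>M lborel)" by measurable
  show "integrable lborel (\<lambda>x. \<integral>y. norm (case (x, y) of (x, y) \<Rightarrow> u x * v y) \<partial>lborel)"
    using u v by (simp add: norm_mult)
  show "AE x in lborel. integrable lborel (\<lambda>y. case (x, y) of (x, y) \<Rightarrow> u x * v y)"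
    using v by simp
qed

text \<open>Fubini for the kernel \<open>cis (- 2 * pi * (x \<bullet> \<xi>))\<close>, which is
  symmetric in its two variables. With v a Gaussian this leads to Plancherel; with v a truncation of
  psi it identifies the L2 transform by duality.\<close>

lemma fint_mult:
  fixes u v :: "'a::euclidean_space \<Rightarrow> complex"
  assumes u: "integrable lborel u" and v: "integrable lborel v"
  shows "(\<integral>\<xi>. fint u \<xi> * v \<xi> \<partial>lborel) = (\<integral>x. u x * fint v x \<partial>lborel)"
proof -
  have [measurable]: "u \<in> borel_measurable borel" "v \<in> borel_measurable borel"
    using u v by auto
  have "integrable (lborel \<Otimes>\<^sub>M lborel) (\<lambda>p. (case p of (x, \<xi>) \<Rightarrow> u x * v \<xi>) * cis (- 2 * pi * (fst p \<bullet> snd p)))"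
    by (intro integrable_mult_unimodular integrable_pair_mult u v) auto
  then have int: "integrable (lborel \<Otimes>\<^sub>M lborel) (\<lambda>(x, \<xi>). u x * v \<xi> * cis (- 2 * pi * (x \<bullet> \<xi>)))"
    by (simp add: case_prod_unfold)
  have "(\<integral>\<xi>. fint u \<xi> * v \<xi> \<partial>lborel) = (\<integral>\<xi>. (\<integral>x. u x * v \<xi> * cis (- 2 * pi * (x \<bullet> \<xi>)) \<partial>lborel) \<partial>lborel)"
    unfolding fint_def by (subst integral_mult_left_zero[symmetric]) (simp add: mult_ac)
  also have "\<dots> = (\<integral>x. (\<integral>\<xi>. u x * v \<xi> * cis (- 2 * pi * (x \<bullet> \<xi>)) \<partial>lborel) \<partial>lborel)"
    by (rule lborel_pair.Fubini_integral[OF int])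
  also have "\<dots> = (\<integral>x. u x * fint v x \<partial>lborel)"
    unfolding fint_def by (subst integral_mult_right_zero[symmetric]) (simp add: mult_ac inner_commute)
  finally show ?thesis .
qed

section \<open>Gaussians and their Fourier integrals\<close>

definition gauss :: "'a::euclidean_space \<Rightarrow> real" where
  "gauss x = exp (- (norm x)\<^sup>2 / 2)"

lemma integral_lborel_prod_Basis:
  fixes f :: "'a::euclidean_space \<Rightarrow> real \<Rightarrow> complex"
  assumes f: "\<And>b. b \<in> Basis \<Longrightarrow> integrable lborel (f b)"
  shows "integrable lborel (\<lambda>x::'a. \<Prod>b\<in>Basis. f b (x \<bullet> b))" (is ?i)
    and "(\<integral>x. (\<Prod>b\<in>Basis. f b ((x::'a) \<bullet> b)) \<partial>lborel) = (\<Prod>b\<in>Basis. \<integral>t. f b t \<partial>lborel)" (is ?e)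
proof -
  interpret product_sigma_finite "\<lambda>_::'a. lborel :: real measure" ..
  have [measurable]: "f b \<in> borel_measurable borel" if "b \<in> Basis" for b
    using f[OF that] by auto
  let ?\<phi> = "\<lambda>f::'a \<Rightarrow> real. \<Sum>b\<in>Basis. f b *\<^sub>R b"
  have [measurable]: "(\<lambda>x::'a. \<Prod>b\<in>Basis. f b (x \<bullet> b)) \<in> borel_measurable borel"
    by (rule borel_measurable_prod) measurable
  have \<phi>: "?\<phi> \<in> measurable (\<Pi>\<^sub>M b\<in>Basis. lborel) borel"
    by measurable
  have eq: "(\<Prod>b\<in>Basis. f b (?\<phi> x \<bullet> b)) = (\<Prod>b\<in>Basis. f b (x b))" for x
    by (intro prod.cong) auto
  show ?i
    by (subst lborel_eq, subst integrable_distr_eq[OF \<phi>])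
       (simp_all only: eq, measurable, intro product_integrable_prod f finite_Basis)
  show ?e
    by (subst lborel_eq, subst integral_distr[OF \<phi>])
       (simp_all only: eq, measurable, intro product_integral_prod f finite_Basis)
qed

text \<open>The left side is the characteristic function of the standard normal distribution. It is
  the one analytic input on Gaussians; every dimension follows by taking products.\<close>

lemma integral_std_normal_cis:
  "(\<integral>x. complex_of_real (std_normal_density x) * cis (t * x) \<partial>lborel) = exp (- t\<^sup>2 / 2)"
proof -
  have "char std_normal_distribution t = (\<integral>x. std_normal_density x *\<^sub>R cis (t * x) \<partial>lborel)"
    unfolding char_def by (subst integral_density) (auto simp: cis_conv_exp)
  then show ?thesis
    by (simp add: char_std_normal_distribution scaleR_conv_of_real)
qed

lemma exp_norm_eq_prod:
  fixes x :: "'a::euclidean_space"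
  shows "exp (- (norm x)\<^sup>2 / 2) = (\<Prod>b\<in>Basis. exp (- (x \<bullet> b)\<^sup>2 / 2))"
proof -
  have "(norm x)\<^sup>2 = (\<Sum>b\<in>Basis. (x \<bullet> b)\<^sup>2)"
    by (subst power2_norm_eq_inner, subst euclidean_inner) (simp add: power2_eq_square)
  then show ?thesis
    by (simp add: exp_sum[symmetric] sum_negf sum_divide_distrib)
qed

lemma gauss_eq_prod:
  fixes x :: "'a::euclidean_space"
  shows "gauss x = sqrt (2 * pi) ^ DIM('a) * (\<Prod>b\<in>Basis. std_normal_density (x \<bullet> b))"
  unfolding gauss_def exp_norm_eq_prod
  by (simp add: std_normal_density_def prod_dividef)

lemma
  fixes t :: "'a::euclidean_space"
  shows integrable_gauss_complex: "integrable lborel (\<lambda>x::'a. complex_of_real (gauss x))"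
    and integral_gauss_cis: "(\<integral>x. complex_of_real (gauss x) * cis (t \<bullet> x) \<partial>lborel) = sqrt (2 * pi) ^ DIM('a) * gauss t"
proof -
  have int1: "integrable lborel (\<lambda>x. complex_of_real (std_normal_density x) * cis (a * x))" for a
    by (intro integrable_mult_unimodular integrable_of_real integrable_normal_density) auto
  have cis_prod: "cis (t \<bullet> x) = (\<Prod>b\<in>Basis. cis ((t \<bullet> b) * (x \<bullet> b)))" for t x :: 'a
    by (simp add: euclidean_inner[of t x] cis_conv_exp sum_distrib_left exp_sum)
  have eq: "complex_of_real (gauss x) * cis (t \<bullet> x) = complex_of_real (sqrt (2 * pi) ^ DIM('a)) *
    (\<Prod>b\<in>Basis. complex_of_real (std_normal_density (x \<bullet> b)) * cis ((t \<bullet> b) * (x \<bullet> b)))" for t x :: 'a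
    by (simp only: gauss_eq_prod cis_prod of_real_mult of_real_prod prod.distrib mult.assoc)
  \<comment> \<open>At frequency 0 the phase is 1, so integrability of the Gaussian is an instance
    of the same product formula.\<close>
  have "integrable lborel (\<lambda>x::'a. complex_of_real (gauss x) * cis (0 \<bullet> x))"
    unfolding eq by (intro integrable_mult_right integral_lborel_prod_Basis int1)
  then show "integrable lborel (\<lambda>x::'a. complex_of_real (gauss x))" by simp
  have "(\<Prod>b\<in>Basis. complex_of_real (exp (- (t \<bullet> b)\<^sup>2 / 2))) = gauss t"
    by (simp only: of_real_prod[symmetric] gauss_def exp_norm_eq_prod)
  then show "(\<integral>x. complex_of_real (gauss x) * cis (t \<bullet> x) \<partial>lborel) = sqrt (2 * pi) ^ DIM('a) * gauss t"
    unfolding eq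
    by (subst integral_mult_right_zero,
        subst integral_lborel_prod_Basis(2)[where f = "\<lambda>b x. complex_of_real (std_normal_density x) * cis ((t \<bullet> b) * x)", OF int1])
       (simp add: integral_std_normal_cis)
qed

lemma gauss_nonneg [simp]: "0 \<le> gauss x"
  and gauss_le_1: "gauss x \<le> 1"
  by (simp_all add: gauss_def)

lemma gauss_measurable [measurable]: "gauss \<in> borel_measurable borel"
  unfolding gauss_def[abs_def] by measurable

lemma integrable_gauss: "integrable lborel (gauss :: 'a::euclidean_space \<Rightarrow> real)"
  using integrable_gauss_complex by (simp add: complex_of_real_integrable_eq)

lemma integral_gauss: "(\<integral>x. gauss (x::'a::euclidean_space) \<partial>lborel) = sqrt (2 * pi) ^ DIM('a)"
proof -
  have "complex_of_real (\<integral>x. gauss (x::'a) \<partial>lborel) = complex_of_real (sqrt (2 * pi) ^ DIM('a))"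
    using integral_gauss_cis[of "0::'a"] by (simp add: gauss_def[of 0])
  then show ?thesis by (simp only: of_real_eq_iff)
qed

lemma
  fixes f :: "'a::euclidean_space \<Rightarrow> 'b::{banach, second_countable_topology}"
  assumes c: "c \<noteq> 0" and [measurable]: "f \<in> borel_measurable borel"
  shows integral_lborel_scale: "(\<integral>x. f x \<partial>lborel) = \<bar>c\<bar> ^ DIM('a) *\<^sub>R (\<integral>x. f (a + c *\<^sub>R x) \<partial>lborel)"
    and integrable_lborel_scale: "integrable lborel f \<Longrightarrow> integrable lborel (\<lambda>x. f (a + c *\<^sub>R x))"
proof -
  have eq: "lborel = density (distr lborel borel (\<lambda>x::'a. a + c *\<^sub>R x)) (\<lambda>_. ennreal (\<bar>c\<bar> ^ DIM('a)))"
    using lborel_affine[OF c, of a] by (simp add: ennreal_power)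
  show "(\<integral>x. f x \<partial>lborel) = \<bar>c\<bar> ^ DIM('a) *\<^sub>R (\<integral>x. f (a + c *\<^sub>R x) \<partial>lborel)"
    by (subst eq) (simp add: integral_density integral_distr)
  assume "integrable lborel f"
  then have "integrable lborel (\<lambda>x. \<bar>c\<bar> ^ DIM('a) *\<^sub>R f (a + c *\<^sub>R x))"
    by (subst (asm) eq) (simp add: integrable_density integrable_distr_eq)
  then have "integrable lborel (\<lambda>x. (1 / \<bar>c\<bar> ^ DIM('a)) *\<^sub>R \<bar>c\<bar> ^ DIM('a) *\<^sub>R f (a + c *\<^sub>R x))"
    by (rule integrable_scaleR_right)
  then show "integrable lborel (\<lambda>x. f (a + c *\<^sub>R x))" using c by simp
qed

text \<open>Scaling the variable by \<open>\<kappa> / (2 * pi)\<close> makes the Gaussian standard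
  and turns the phase into frequency \<open>- \<kappa> *\<^sub>R z\<close>. A Gaussian of width
  proportional to \<kappa> thus has as transform a kernel of width 1 / \<kappa> and total mass 1,
  the approximate identity behind Plancherel.\<close>

lemma fint_gauss:
  fixes z :: "'a::euclidean_space"
  assumes "\<kappa> > 0"
  shows "fint (\<lambda>\<xi>. complex_of_real (gauss ((2 * pi / \<kappa>) *\<^sub>R \<xi>))) z = (\<kappa> / sqrt (2 * pi)) ^ DIM('a) * gauss (\<kappa> *\<^sub>R z)"
proof -
  let ?c = "\<kappa> / (2 * pi)"
  have c: "?c \<noteq> 0" using assms by simp
  have sc: "(2 * pi / \<kappa>) *\<^sub>R ?c *\<^sub>R x = x" "- 2 * pi * (?c *\<^sub>R x \<bullet> z) = (- \<kappa> *\<^sub>R z) \<bullet> x" for x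
    using assms by (simp_all add: inner_commute)
  have "fint (\<lambda>\<xi>. complex_of_real (gauss ((2 * pi / \<kappa>) *\<^sub>R \<xi>))) z
    = \<bar>?c\<bar> ^ DIM('a) *\<^sub>R (\<integral>x. complex_of_real (gauss ((2 * pi / \<kappa>) *\<^sub>R (0 + ?c *\<^sub>R x))) * cis (- 2 * pi * ((0 + ?c *\<^sub>R x) \<bullet> z)) \<partial>lborel)"
    unfolding fint_def by (rule integral_lborel_scale[OF c]) measurable
  also have "\<dots> = \<bar>?c\<bar> ^ DIM('a) *\<^sub>R complex_of_real (sqrt (2 * pi) ^ DIM('a) * gauss (- \<kappa> *\<^sub>R z))"
    unfolding add_0 sc by (subst integral_gauss_cis) simp
  also have "\<dots> = complex_of_real ((\<bar>?c\<bar> * sqrt (2 * pi)) ^ DIM('a) * gauss (\<kappa> *\<^sub>R z))"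
    by (simp add: scaleR_conv_of_real power_mult_distrib[symmetric] gauss_def)
  also have "\<bar>?c\<bar> * sqrt (2 * pi) = \<kappa> / sqrt (2 * pi)"
    using assms by (simp add: field_simps abs_mult real_sqrt_mult_self)
  finally show ?thesis by simp
qed

section \<open>Approximation by continuous functions and continuity of translation in L2\<close>

lemma ennreal_norm_add_square:
  fixes a b :: "'a::real_normed_vector"
  shows "ennreal ((norm (a + b))\<^sup>2) \<le> 2 * ennreal ((norm a)\<^sup>2) + 2 * ennreal ((norm b)\<^sup>2)"
proof -
  have "(norm (a + b))\<^sup>2 \<le> (norm a + norm b)\<^sup>2"
    by (simp add: power_mono norm_triangle_ineq)
  also have "\<dots> \<le> 2 * (norm a)\<^sup>2 + 2 * (norm b)\<^sup>2"
    using sum_squares_bound[of "norm a" "norm b"] by (simp add: power2_sum)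
  finally have "ennreal ((norm (a + b))\<^sup>2) \<le> ennreal (2 * (norm a)\<^sup>2 + 2 * (norm b)\<^sup>2)"
    by (rule ennreal_leI)
  then show ?thesis by (simp add: ennreal_plus ennreal_mult')
qed

text \<open>u is set to 0 where the point or the value is large. The squared error is dominated by
  |u|^2 and vanishes at each point from some index on.\<close>

lemma L2_approx_bounded_support:
  fixes u :: "'a::euclidean_space \<Rightarrow> complex"
  assumes [measurable]: "u \<in> borel_measurable borel"
    and fin: "(\<integral>\<^sup>+x. ennreal ((cmod (u x))\<^sup>2) \<partial>lborel) < \<infinity>" and "(e::real) > 0"
  obtains v N where "v \<in> borel_measurable borel" "\<And>x. norm (v x) \<le> real N"
    "\<And>x. norm x > real N \<Longrightarrow> v x = 0" "(\<integral>\<^sup>+x. ennreal ((cmod (u x - v x))\<^sup>2) \<partial>lborel) < ennreal e"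
proof -
  define v where "v N x = (if norm x \<le> real N \<and> cmod (u x) \<le> real N then u x else 0)" for N :: nat and x
  have [measurable]: "v N \<in> borel_measurable borel" for N unfolding v_def by measurable
  have "(\<lambda>N. \<integral>\<^sup>+x. ennreal ((cmod (u x - v N x))\<^sup>2) \<partial>lborel) \<longlonglongrightarrow> (\<integral>\<^sup>+x. 0 \<partial>(lborel::'a measure))"
  proof (rule nn_integral_dominated_convergence[where w = "\<lambda>x. ennreal ((cmod (u x))\<^sup>2)"])
    show "AE x in lborel. (\<lambda>N. ennreal ((cmod (u x - v N x))\<^sup>2)) \<longlonglongrightarrow> 0"
    proof (intro AE_I2 tendsto_eventually)
      fix x
      obtain m where m: "max (norm x) (cmod (u x)) < real m" using reals_Archimedean2 by blast
      show "\<forall>\<^sub>F N in sequentially. ennreal ((cmod (u x - v N x))\<^sup>2) = 0"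
        using eventually_ge_at_top[of m] by eventually_elim (use m in \<open>auto simp: v_def\<close>)
    qed
    show "AE x in lborel. ennreal ((cmod (u x - v N x))\<^sup>2) \<le> ennreal ((cmod (u x))\<^sup>2)" for N
      by (auto simp: v_def)
  qed (use fin in auto)
  then have "\<forall>\<^sub>F N in sequentially. (\<integral>\<^sup>+x. ennreal ((cmod (u x - v N x))\<^sup>2) \<partial>lborel) < ennreal e"
    using \<open>e > 0\<close> by (simp add: order_tendsto_iff)
  then obtain N where N: "(\<integral>\<^sup>+x. ennreal ((cmod (u x - v N x))\<^sup>2) \<partial>lborel) < ennreal e"
    by (auto simp: eventually_sequentially)
  show ?thesis
    by (rule that[of "v N" N]) (auto simp: v_def[abs_def] N[unfolded v_def[abs_def]])
qed

text \<open>A Lebesgue measurable function is an almost everywhere limit of continuous functions,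
  but these come with no common bound or support. Projecting their values onto a ball and
  multiplying by a cutoff supplies both. Neither operation disturbs the limit, because the
  intermediate function \<open>w\<close> already takes values in that ball and vanishes where the
  cutoff is not 1.\<close>

lemma L2_approx_continuous:
  fixes u :: "'a::euclidean_space \<Rightarrow> complex"
  assumes [measurable]: "u \<in> borel_measurable borel"
    and fin: "(\<integral>\<^sup>+x. ennreal ((cmod (u x))\<^sup>2) \<partial>lborel) < \<infinity>" and "(e::real) > 0"
  obtains v N where "continuous_on UNIV v" "\<And>x. norm (v x) \<le> real N"
    "\<And>x. norm x > real N + 1 \<Longrightarrow> v x = 0" "(\<integral>\<^sup>+x. ennreal ((cmod (u x - v x))\<^sup>2) \<partial>lborel) < ennreal e"
proof -
  \<comment> \<open>Two errors below e / 4, each doubled by \<open>ennreal_norm_add_square\<close>,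
    sum to less than e.\<close>
  obtain w N where w[measurable]: "w \<in> borel_measurable borel" and wN: "\<And>x. norm (w x) \<le> real N"
    and w0: "\<And>x. norm x > real N \<Longrightarrow> w x = 0"
    and we: "(\<integral>\<^sup>+x. ennreal ((cmod (u x - w x))\<^sup>2) \<partial>lborel) < ennreal (e / 4)"
    using L2_approx_bounded_support[OF assms(1) fin, of "e / 4"] \<open>e > 0\<close> by auto
  have "w \<in> borel_measurable lebesgue"
    using measurable_completion[of w lborel borel] by simp
  then have "w measurable_on UNIV"
    by (rule lebesgue_measurable_imp_measurable_on) simp
  then obtain Z g where Z: "negligible Z" and g: "\<And>n. continuous_on UNIV (g n)"
    and lim: "\<And>x. x \<notin> Z \<Longrightarrow> (\<lambda>n. g n x) \<longlonglongrightarrow> w x"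
    by (auto simp: measurable_on_def)
  \<comment> \<open>\<open>cut\<close> is 1 on the ball of radius N and 0 beyond radius N + 1, the
    origin of \<open>real N + 1\<close> in the claim. The projection used in \<open>v\<close> is
    continuous because the ball is convex.\<close>
  define cut where "cut x = max 0 (min 1 (real N + 1 - norm x))" for x :: 'a
  define v where "v n x = cut x *\<^sub>R closest_point (cball 0 (real N)) (g n x)" for n x
  have clip: "continuous_on UNIV (closest_point (cball (0::complex) (real N)))"
    by (rule continuous_on_closest_point) auto
  have cont: "continuous_on UNIV (v n)" for n
    unfolding v_def cut_def
    by (intro continuous_intros continuous_on_compose2[OF clip g]) auto
  then have [measurable]: "v n \<in> borel_measurable borel" for n
    by (rule borel_measurable_continuous_onI)
  have cp: "norm (closest_point (cball 0 (real N)) z) \<le> real N" for z :: complex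
    using closest_point_in_set[of "cball 0 (real N)" z] by auto
  have cut01: "0 \<le> cut x" "cut x \<le> 1" for x by (auto simp: cut_def)
  have vN: "norm (v n x) \<le> real N" for n x
    using mult_mono[OF cut01(2)[of x] cp[of "g n x"]] cut01[of x] by (simp add: v_def)
  have v0: "v n x = 0" if "norm x > real N + 1" for n x
    using that by (simp add: v_def cut_def)
  have lim': "(\<lambda>n. v n x) \<longlonglongrightarrow> w x" if "x \<notin> Z" for x
  proof -
    have "(\<lambda>n. v n x) \<longlonglongrightarrow> cut x *\<^sub>R closest_point (cball 0 (real N)) (w x)"
      unfolding v_def
      by (intro tendsto_intros continuous_on_tendsto_compose[OF clip lim[OF that]]) auto
    also have "closest_point (cball 0 (real N)) (w x) = w x"
      by (rule closest_point_self) (simp add: wN)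
    also have "cut x *\<^sub>R w x = w x"
      using w0[of x] by (cases "norm x > real N") (auto simp: cut_def)
    finally show ?thesis .
  qed
  have "(\<lambda>n. \<integral>\<^sup>+x. ennreal ((cmod (w x - v n x))\<^sup>2) \<partial>lborel) \<longlonglongrightarrow> (\<integral>\<^sup>+x. 0 \<partial>(lborel::'a measure))"
  proof (rule nn_integral_dominated_convergence[where w = "\<lambda>x. ennreal ((2 * real N)\<^sup>2) * indicator (cball 0 (real N + 1)) x"])
    have "AE x in lebesgue. x \<notin> Z"
      using Z by (simp add: negligible_iff_null_sets AE_not_in)
    then have "AE x in lborel. x \<notin> Z" by (simp add: AE_completion_iff)
    then show "AE x in lborel. (\<lambda>n. ennreal ((cmod (w x - v n x))\<^sup>2)) \<longlonglongrightarrow> 0"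
    proof (rule AE_mp, intro AE_I2 impI)
      fix x assume "x \<notin> Z"
      then have "(\<lambda>n. ennreal ((cmod (w x - v n x))\<^sup>2)) \<longlonglongrightarrow> ennreal ((cmod (w x - w x))\<^sup>2)"
        by (intro tendsto_intros lim')
      then show "(\<lambda>n. ennreal ((cmod (w x - v n x))\<^sup>2)) \<longlonglongrightarrow> 0" by simp
    qed
    show "AE x in lborel. ennreal ((cmod (w x - v n x))\<^sup>2) \<le> ennreal ((2 * real N)\<^sup>2) * indicator (cball 0 (real N + 1)) x" for n
    proof (intro AE_I2)
      fix x
      have "cmod (w x - v n x) \<le> 2 * real N"
        using norm_triangle_ineq4[of "w x" "v n x"] wN[of x] vN[of n x] by simp
      then have "(cmod (w x - v n x))\<^sup>2 \<le> (2 * real N)\<^sup>2" by (intro power_mono) auto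
      then show "ennreal ((cmod (w x - v n x))\<^sup>2) \<le> ennreal ((2 * real N)\<^sup>2) * indicator (cball 0 (real N + 1)) x"
        using w0[of x] v0[of x n] by (auto simp: indicator_def ennreal_leI)
    qed
    have "emeasure lborel (cball (0::'a) (real N + 1)) < \<infinity>"
      by (rule emeasure_bounded_finite) simp
    then show "(\<integral>\<^sup>+x. ennreal ((2 * real N)\<^sup>2) * indicator (cball 0 (real N + 1)) (x::'a) \<partial>lborel) < \<infinity>"
      by (simp add: nn_integral_cmult_indicator ennreal_mult_less_top)
  qed (auto intro!: borel_measurable_times_ennreal borel_measurable_indicator)
  then have "\<forall>\<^sub>F n in sequentially. (\<integral>\<^sup>+x. ennreal ((cmod (w x - v n x))\<^sup>2) \<partial>lborel) < ennreal (e / 4)"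
    using \<open>e > 0\<close> by (simp add: order_tendsto_iff)
  then obtain n where n: "(\<integral>\<^sup>+x. ennreal ((cmod (w x - v n x))\<^sup>2) \<partial>lborel) < ennreal (e / 4)"
    by (auto simp: eventually_sequentially)
  have "(\<integral>\<^sup>+x. ennreal ((cmod (u x - v n x))\<^sup>2) \<partial>lborel)
      \<le> (\<integral>\<^sup>+x. 2 * ennreal ((cmod (u x - w x))\<^sup>2) + 2 * ennreal ((cmod (w x - v n x))\<^sup>2) \<partial>lborel)"
    using ennreal_norm_add_square[of "u x - w x" "w x - v n x" for x] by (intro nn_integral_mono) simp
  also have "\<dots> = 2 * (\<integral>\<^sup>+x. ennreal ((cmod (u x - w x))\<^sup>2) \<partial>lborel) + 2 * (\<integral>\<^sup>+x. ennreal ((cmod (w x - v n x))\<^sup>2) \<partial>lborel)"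
    by (simp add: nn_integral_add nn_integral_cmult)
  also have "\<dots> < ennreal e"
  proof -
    have "2 * a + 2 * b < ennreal e" if "a < ennreal (e / 4)" "b < ennreal (e / 4)" for a b
      using that by (cases a; cases b)
        (auto simp: ennreal_less_iff ennreal_plus[symmetric] ennreal_mult'[symmetric] simp del: ennreal_plus simp flip: ennreal_numeral)
    then show ?thesis using we n by blast
  qed
  finally have "(\<integral>\<^sup>+x. ennreal ((cmod (u x - v n x))\<^sup>2) \<partial>lborel) < ennreal e" .
  with cont vN v0 show ?thesis by (rule that[of "v n" N])
qed

definition L2_shift_dist :: "('a::euclidean_space \<Rightarrow> complex) \<Rightarrow> 'a \<Rightarrow> ennreal" where
  "L2_shift_dist u z = (\<integral>\<^sup>+y. ennreal ((cmod (u (z + y) - u y))\<^sup>2) \<partial>lborel)"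

lemma L2_shift_dist_measurable [measurable]:
  assumes [measurable]: "u \<in> borel_measurable borel"
  shows "L2_shift_dist u \<in> borel_measurable borel"
  unfolding L2_shift_dist_def[abs_def] by measurable

text \<open>A convergent sequence of shifts is bounded by some K, so all the differences vanish
  outside the ball of radius R + K and a constant on that ball dominates them.\<close>

lemma L2_shift_dist_tendsto_continuous:
  fixes v :: "'a::euclidean_space \<Rightarrow> complex" and z :: "nat \<Rightarrow> 'a"
  assumes cont: "continuous_on UNIV v" and vN: "\<And>x. norm (v x) \<le> M"
    and v0: "\<And>x. norm x > R \<Longrightarrow> v x = 0" and z: "z \<longlonglongrightarrow> 0"
  shows "(\<lambda>n. L2_shift_dist v (z n)) \<longlonglongrightarrow> 0"
proof -
  have [measurable]: "v \<in> borel_measurable borel"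
    by (rule borel_measurable_continuous_onI[OF cont])
  from z have "Bseq z" by (intro convergent_imp_Bseq convergentI)
  then obtain K where K: "\<And>n. norm (z n) \<le> K" by (auto simp: Bseq_def)
  have "(\<lambda>n. L2_shift_dist v (z n)) \<longlonglongrightarrow> (\<integral>\<^sup>+y. 0 \<partial>(lborel :: 'a measure))"
    unfolding L2_shift_dist_def
  proof (rule nn_integral_dominated_convergence[where w = "\<lambda>x. ennreal ((2 * M)\<^sup>2) * indicator (cball 0 (R + K)) x"])
    show "AE y in lborel. (\<lambda>n. ennreal ((cmod (v (z n + y) - v y))\<^sup>2)) \<longlonglongrightarrow> 0"
    proof (intro AE_I2)
      fix y
      have "(\<lambda>n. z n + y) \<longlonglongrightarrow> 0 + y" by (intro tendsto_intros z)
      then have "(\<lambda>n. v (z n + y)) \<longlonglongrightarrow> v y"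
        using continuous_on_tendsto_compose[OF cont, of "\<lambda>n. z n + y" y] by simp
      then have "(\<lambda>n. ennreal ((cmod (v (z n + y) - v y))\<^sup>2)) \<longlonglongrightarrow> ennreal ((cmod (v y - v y))\<^sup>2)"
        by (intro tendsto_intros)
      then show "(\<lambda>n. ennreal ((cmod (v (z n + y) - v y))\<^sup>2)) \<longlonglongrightarrow> 0" by simp
    qed
    show "AE y in lborel. ennreal ((cmod (v (z n + y) - v y))\<^sup>2) \<le> ennreal ((2 * M)\<^sup>2) * indicator (cball 0 (R + K)) y" for n
    proof (intro AE_I2)
      fix y
      have "cmod (v (z n + y) - v y) \<le> 2 * M"
        using norm_triangle_ineq4[of "v (z n + y)" "v y"] vN[of y] vN[of "z n + y"] by simp
      then have le: "(cmod (v (z n + y) - v y))\<^sup>2 \<le> (2 * M)\<^sup>2" by (intro power_mono) auto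
      show "ennreal ((cmod (v (z n + y) - v y))\<^sup>2) \<le> ennreal ((2 * M)\<^sup>2) * indicator (cball 0 (R + K)) y"
      proof (cases "norm y \<le> R + K")
        case False
        moreover have "norm y \<le> norm (z n + y) + norm (z n)"
          using norm_triangle_ineq4[of "z n + y" "z n"] by simp
        moreover have "0 \<le> K" using K[of n] norm_ge_zero[of "z n"] by linarith
        ultimately have "norm y > R" "norm (z n + y) > R" using K[of n] by linarith+
        then show ?thesis by (simp add: v0)
      qed (use le in \<open>auto simp: ennreal_leI\<close>)
    qed
    have "emeasure lborel (cball (0::'a) (R + K)) < \<infinity>"
      by (rule emeasure_bounded_finite) simp
    then show "(\<integral>\<^sup>+x. ennreal ((2 * M)\<^sup>2) * indicator (cball 0 (R + K)) (x::'a) \<partial>lborel) < \<infinity>"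
      by (simp add: nn_integral_cmult_indicator ennreal_mult_less_top)
  qed (auto intro!: borel_measurable_times_ennreal borel_measurable_indicator)
  then show ?thesis by simp
qed

text \<open>With u = v + d, the difference of u and its translate splits into the one for v and two
  terms in d, whose integrals agree by translation invariance. Using the bound for the square of a
  sum twice gives the factor 2 on v and 4 + 4 = 8 on d.\<close>

lemma L2_shift_dist_le:
  fixes u v :: "'a::euclidean_space \<Rightarrow> complex"
  assumes [measurable]: "u \<in> borel_measurable borel" "v \<in> borel_measurable borel"
  shows "L2_shift_dist u z \<le> 2 * L2_shift_dist v z + 8 * (\<integral>\<^sup>+y. ennreal ((cmod (u y - v y))\<^sup>2) \<partial>lborel)"
proof -
  define d where "d y = u y - v y" for y
  have [measurable]: "d \<in> borel_measurable borel" unfolding d_def by measurable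
  have "L2_shift_dist u z \<le> (\<integral>\<^sup>+y. 2 * ennreal ((cmod (v (z + y) - v y))\<^sup>2)
      + (4 * ennreal ((cmod (d (z + y)))\<^sup>2) + 4 * ennreal ((cmod (d y))\<^sup>2)) \<partial>lborel)"
    unfolding L2_shift_dist_def
  proof (intro nn_integral_mono)
    fix y
    have "ennreal ((cmod (u (z + y) - u y))\<^sup>2)
        \<le> 2 * ennreal ((cmod (v (z + y) - v y))\<^sup>2) + 2 * ennreal ((cmod (d (z + y) + - d y))\<^sup>2)"
      using ennreal_norm_add_square[of "v (z + y) - v y" "d (z + y) + - d y"] by (simp add: d_def algebra_simps)
    also have "\<dots> \<le> 2 * ennreal ((cmod (v (z + y) - v y))\<^sup>2)
        + 2 * (2 * ennreal ((cmod (d (z + y)))\<^sup>2) + 2 * ennreal ((cmod (- d y))\<^sup>2))"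
      by (intro add_left_mono mult_left_mono ennreal_norm_add_square) auto
    finally show "ennreal ((cmod (u (z + y) - u y))\<^sup>2) \<le> 2 * ennreal ((cmod (v (z + y) - v y))\<^sup>2)
      + (4 * ennreal ((cmod (d (z + y)))\<^sup>2) + 4 * ennreal ((cmod (d y))\<^sup>2))"
      by (simp add: distrib_left mult.assoc[symmetric])
  qed
  also have "\<dots> = 2 * L2_shift_dist v z + (4 * (\<integral>\<^sup>+y. ennreal ((cmod (d (z + y)))\<^sup>2) \<partial>lborel)
      + 4 * (\<integral>\<^sup>+y. ennreal ((cmod (d y))\<^sup>2) \<partial>lborel))"
    unfolding L2_shift_dist_def by (simp add: nn_integral_add nn_integral_cmult)
  also have "(\<integral>\<^sup>+y. ennreal ((cmod (d (z + y)))\<^sup>2) \<partial>lborel) = (\<integral>\<^sup>+y. ennreal ((cmod (d y))\<^sup>2) \<partial>lborel)"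
    using nn_integral_lborel_translate[of "\<lambda>y. ennreal ((cmod (d y))\<^sup>2)" z] by simp
  finally show ?thesis
    by (simp add: d_def distrib_right[symmetric])
qed

text \<open>The case v = 0. The bound does not depend on z and so provides the dominating function
  in the Plancherel limit.\<close>

lemma L2_shift_dist_bound:
  fixes u :: "'a::euclidean_space \<Rightarrow> complex"
  assumes "u \<in> borel_measurable borel"
  shows "L2_shift_dist u z \<le> 8 * (\<integral>\<^sup>+y. ennreal ((cmod (u y))\<^sup>2) \<partial>lborel)"
  using L2_shift_dist_le[OF assms, of "\<lambda>_. 0" z] by (simp add: L2_shift_dist_def)

lemma L2_shift_dist_tendsto:
  fixes u :: "'a::euclidean_space \<Rightarrow> complex"
  assumes u[measurable]: "u \<in> borel_measurable borel"
    and fin: "(\<integral>\<^sup>+x. ennreal ((cmod (u x))\<^sup>2) \<partial>lborel) < \<infinity>" and z: "z \<longlonglongrightarrow> 0"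
  shows "(\<lambda>n. L2_shift_dist u (z n)) \<longlonglongrightarrow> 0"
proof (rule order_tendstoI)
  fix e :: ennreal assume "0 < e"
  then obtain r where r: "0 < r" "ennreal r < e"
    by (metis dense ennreal_cases ennreal_less_zero_iff infinity_ennreal_def not_less top_greatest)
  \<comment> \<open>The tolerances are adapted to \<open>L2_shift_dist_le\<close>: 2 * (r / 4) + 8 *
    (r / 16) = r.\<close>
  then obtain v N where v: "continuous_on UNIV v" "\<And>x. norm (v x) \<le> real N"
    "\<And>x. norm x > real N + 1 \<Longrightarrow> v x = 0" and uv: "(\<integral>\<^sup>+x. ennreal ((cmod (u x - v x))\<^sup>2) \<partial>lborel) < ennreal (r / 16)"
    using L2_approx_continuous[OF u fin, of "r / 16"] by auto
  have [measurable]: "v \<in> borel_measurable borel"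
    by (rule borel_measurable_continuous_onI[OF v(1)])
  have "\<forall>\<^sub>F n in sequentially. L2_shift_dist v (z n) < ennreal (r / 4)"
    using L2_shift_dist_tendsto_continuous[OF v z] r(1) by (simp add: order_tendsto_iff)
  then show "\<forall>\<^sub>F n in sequentially. L2_shift_dist u (z n) < e"
  proof eventually_elim
    fix n assume n: "L2_shift_dist v (z n) < ennreal (r / 4)"
    have *: "2 * a + 8 * b < ennreal r" if "a < ennreal (r / 4)" "b < ennreal (r / 16)" for a b
      using that by (cases a; cases b)
        (auto simp: ennreal_less_iff ennreal_plus[symmetric] ennreal_mult'[symmetric] simp del: ennreal_plus simp flip: ennreal_numeral)
    have "L2_shift_dist u (z n) \<le> 2 * L2_shift_dist v (z n) + 8 * (\<integral>\<^sup>+y. ennreal ((cmod (u y - v y))\<^sup>2) \<partial>lborel)"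
      by (rule L2_shift_dist_le) measurable
    also have "\<dots> < ennreal r" by (intro * n uv)
    finally show "L2_shift_dist u (z n) < e" using r(2) by simp
  qed
qed simp

lemma
  fixes f :: "'a::euclidean_space \<Rightarrow> 'b::{banach, second_countable_topology}"
  assumes "f \<in> borel_measurable borel"
  shows integral_lborel_translate: "(\<integral>x. f (a + x) \<partial>lborel) = (\<integral>x. f x \<partial>lborel)"
    and integrable_lborel_translate: "integrable lborel f \<Longrightarrow> integrable lborel (\<lambda>x. f (a + x))"
  using integral_lborel_scale[OF _ assms, of 1 a] integrable_lborel_scale[OF _ assms, of 1 a] by simp_all

section \<open>Autocorrelation and the proof of Plancherel\<close>

lemma Re_mult_cnj: "Re (a * cnj b) = ((cmod a)\<^sup>2 + (cmod b)\<^sup>2 - (cmod (a - b))\<^sup>2) / 2"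
proof -
  have "2 * Re (a * cnj b) = (cmod a)\<^sup>2 + (cmod b)\<^sup>2 - (cmod (a - b))\<^sup>2"
    unfolding cmod_power2 by (simp add: power2_eq_square algebra_simps)
  then show ?thesis by simp
qed

lemma cnj_measurable [measurable]: "cnj \<in> borel_measurable borel"
  by (intro borel_measurable_continuous_onI continuous_intros)

text \<open>The convolution of u with its reflected conjugate. Its value at 0 is the squared L2 norm
  of u and its transform is the squared modulus of \<open>fint u\<close>, so Plancherel amounts to
  Fourier inversion of this function at the single point 0.\<close>

definition autocorr :: "('a::euclidean_space \<Rightarrow> complex) \<Rightarrow> 'a \<Rightarrow> complex" where
  "autocorr u z = (\<integral>y. u (z + y) * cnj (u y) \<partial>lborel)"

text \<open>The double integral converges absolutely because u is integrable. For the transform, the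
  phase at z is the phase at y + z times the conjugate phase at y, and translation invariance then
  separates the two factors.\<close>

lemma
  fixes u :: "'a::euclidean_space \<Rightarrow> complex"
  assumes u: "integrable lborel u"
  shows integrable_autocorr: "integrable lborel (autocorr u)"
    and fint_autocorr: "fint (autocorr u) \<xi> = complex_of_real ((cmod (fint u \<xi>))\<^sup>2)"
proof -
  have [measurable]: "u \<in> borel_measurable borel" using u by auto
  have int: "integrable (lborel \<Otimes>\<^sub>M lborel) (\<lambda>(y, z). u (z + y) * cnj (u y))"
  proof (rule lborel_pair.Fubini_integrable)
    show "(\<lambda>(y, z). u (z + y) * cnj (u y)) \<in> borel_measurable (lborel \<Otimes>\<^sub>M lborel)" by measurable
    have "(\<integral>z. norm (u (z + y)) \<partial>lborel) = (\<integral>z. norm (u z) \<partial>lborel)" for y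
      using integral_lborel_translate[of "\<lambda>z. norm (u z)" y] by (simp add: add.commute)
    then show "integrable lborel (\<lambda>y. \<integral>z. norm (case (y, z) of (y, z) \<Rightarrow> u (z + y) * cnj (u y)) \<partial>lborel)"
      using u by (simp add: norm_mult)
    show "AE y in lborel. integrable lborel (\<lambda>z. case (y, z) of (y, z) \<Rightarrow> u (z + y) * cnj (u y))"
      using integrable_lborel_translate[of u, OF _ u] by (simp add: add.commute)
  qed
  show "integrable lborel (autocorr u)"
    using lborel_pair.integrable_snd[OF int] by (simp add: autocorr_def[abs_def])
  have "integrable (lborel \<Otimes>\<^sub>M lborel) (\<lambda>p. (case p of (y, z) \<Rightarrow> u (z + y) * cnj (u y)) * cis (- 2 * pi * (snd p \<bullet> \<xi>)))"
    by (intro integrable_mult_unimodular int) auto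
  then have int': "integrable (lborel \<Otimes>\<^sub>M lborel) (\<lambda>(y, z). u (z + y) * cnj (u y) * cis (- 2 * pi * (z \<bullet> \<xi>)))"
    by (simp add: case_prod_unfold)
  have inner: "(\<integral>z. u (z + y) * cnj (u y) * cis (- 2 * pi * (z \<bullet> \<xi>)) \<partial>lborel)
      = cnj (u y * cis (- 2 * pi * (y \<bullet> \<xi>))) * fint u \<xi>" for y
  proof -
    have eq: "u (z + y) * cnj (u y) * cis (- 2 * pi * (z \<bullet> \<xi>))
        = cnj (u y * cis (- 2 * pi * (y \<bullet> \<xi>))) * (u (y + z) * cis (- 2 * pi * ((y + z) \<bullet> \<xi>)))" for z
      by (simp add: cis_cnj cis_mult inner_add_left algebra_simps)
    then have "(\<integral>z. u (z + y) * cnj (u y) * cis (- 2 * pi * (z \<bullet> \<xi>)) \<partial>lborel)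
        = cnj (u y * cis (- 2 * pi * (y \<bullet> \<xi>))) * (\<integral>z. u (y + z) * cis (- 2 * pi * ((y + z) \<bullet> \<xi>)) \<partial>lborel)"
      by (subst Bochner_Integration.integral_cong[OF refl eq]) (rule integral_mult_right_zero)
    also have "(\<integral>z. u (y + z) * cis (- 2 * pi * ((y + z) \<bullet> \<xi>)) \<partial>lborel) = fint u \<xi>"
      unfolding fint_def by (rule integral_lborel_translate) measurable
    finally show ?thesis .
  qed
  have "fint (autocorr u) \<xi> = (\<integral>z. (\<integral>y. u (z + y) * cnj (u y) * cis (- 2 * pi * (z \<bullet> \<xi>)) \<partial>lborel) \<partial>lborel)"
    by (simp add: fint_def autocorr_def)
  also have "\<dots> = (\<integral>y. (\<integral>z. u (z + y) * cnj (u y) * cis (- 2 * pi * (z \<bullet> \<xi>)) \<partial>lborel) \<partial>lborel)"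
    by (rule lborel_pair.Fubini_integral[OF int'])
  also have "\<dots> = (\<integral>y. cnj (u y * cis (- 2 * pi * (y \<bullet> \<xi>))) * fint u \<xi> \<partial>lborel)"
    by (simp only: inner)
  also have "\<dots> = cnj (fint u \<xi>) * fint u \<xi>"
    by (simp only: integral_mult_left_zero Bochner_Integration.integral_cnj fint_def)
  also have "\<dots> = complex_of_real ((cmod (fint u \<xi>))\<^sup>2)"
    by (simp only: complex_norm_square mult.commute)
  finally show "fint (autocorr u) \<xi> = complex_of_real ((cmod (fint u \<xi>))\<^sup>2)" .
qed

text \<open>Polarisation, integrated over y. Continuity of the real part of the autocorrelation at 0
  thereby becomes continuity of translation in L2.\<close>

lemma Re_autocorr:
  fixes u :: "'a::euclidean_space \<Rightarrow> complex"
  assumes [measurable]: "u \<in> borel_measurable borel" and u2: "integrable lborel (\<lambda>x. (cmod (u x))\<^sup>2)"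
  shows "Re (autocorr u z) = (\<integral>x. (cmod (u x))\<^sup>2 \<partial>lborel) - enn2real (L2_shift_dist u z) / 2"
proof -
  have u2': "integrable lborel (\<lambda>x. (cmod (u (z + x)))\<^sup>2)"
    using u2 by (intro integrable_lborel_translate[of "\<lambda>x. (cmod (u x))\<^sup>2"]) auto
  have int: "integrable lborel (\<lambda>y. u (z + y) * cnj (u y))"
  proof (rule Bochner_Integration.integrable_bound[OF Bochner_Integration.integrable_add[OF u2' u2]])
    show "AE y in lborel. norm (u (z + y) * cnj (u y)) \<le> norm ((cmod (u (z + y)))\<^sup>2 + (cmod (u y))\<^sup>2)"
    proof (intro AE_I2)
      fix y
      have "0 \<le> cmod (u (z + y)) * cmod (u y)" by simp
      then have "cmod (u (z + y)) * cmod (u y) \<le> (cmod (u (z + y)))\<^sup>2 + (cmod (u y))\<^sup>2"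
        using sum_squares_bound[of "cmod (u (z + y))" "cmod (u y)"] by linarith
      then show "norm (u (z + y) * cnj (u y)) \<le> norm ((cmod (u (z + y)))\<^sup>2 + (cmod (u y))\<^sup>2)"
        by (simp add: norm_mult)
    qed
  qed measurable
  have d: "integrable lborel (\<lambda>y. (cmod (u (z + y) - u y))\<^sup>2)"
  proof (rule Bochner_Integration.integrable_bound[OF
      integrable_mult_right[of 2, OF Bochner_Integration.integrable_add[OF u2' u2]]])
    show "AE y in lborel. norm ((cmod (u (z + y) - u y))\<^sup>2) \<le> norm (2 * ((cmod (u (z + y)))\<^sup>2 + (cmod (u y))\<^sup>2))"
    proof (intro AE_I2)
      fix y
      have "(cmod (u (z + y) - u y))\<^sup>2 \<le> (cmod (u (z + y)) + cmod (u y))\<^sup>2"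
        by (intro power_mono norm_triangle_ineq4) auto
      also have "\<dots> \<le> 2 * ((cmod (u (z + y)))\<^sup>2 + (cmod (u y))\<^sup>2)"
        using sum_squares_bound[of "cmod (u (z + y))" "cmod (u y)"] by (simp add: power2_sum)
      finally show "norm ((cmod (u (z + y) - u y))\<^sup>2) \<le> norm (2 * ((cmod (u (z + y)))\<^sup>2 + (cmod (u y))\<^sup>2))"
        by simp
    qed
  qed measurable
  have "Re (autocorr u z) = (\<integral>y. Re (u (z + y) * cnj (u y)) \<partial>lborel)"
    unfolding autocorr_def by (rule integral_Re[OF int, symmetric])
  also have "\<dots> = ((\<integral>y. (cmod (u (z + y)))\<^sup>2 \<partial>lborel) + (\<integral>y. (cmod (u y))\<^sup>2 \<partial>lborel)
      - (\<integral>y. (cmod (u (z + y) - u y))\<^sup>2 \<partial>lborel)) / 2"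
    unfolding Re_mult_cnj using u2 u2' d by simp
  also have "(\<integral>y. (cmod (u (z + y)))\<^sup>2 \<partial>lborel) = (\<integral>y. (cmod (u y))\<^sup>2 \<partial>lborel)"
    by (rule integral_lborel_translate[of "\<lambda>y. (cmod (u y))\<^sup>2"]) measurable
  also have "(\<integral>y. (cmod (u (z + y) - u y))\<^sup>2 \<partial>lborel) = enn2real (L2_shift_dist u z)"
    unfolding L2_shift_dist_def using d by (simp add: nn_integral_eq_integral)
  finally show ?thesis by simp
qed

text \<open>\<open>fint_mult\<close>, applied to \<open>autocorr u\<close> and a wide Gaussian,
  converts the test of |\<open>fint u\<close>|^2 against that Gaussian into an average of the
  autocorrelation at scale 1 / \<kappa> around 0. After rescaling to w the weight is fixed and only
  the shift depends on \<kappa>, as dominated convergence needs.\<close>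

lemma integral_fint_gauss:
  fixes u :: "'a::euclidean_space \<Rightarrow> complex"
  assumes u: "integrable lborel u" and u2: "integrable lborel (\<lambda>x. (cmod (u x))\<^sup>2)" and \<kappa>: "\<kappa> > 0"
  shows "(\<integral>\<xi>. (cmod (fint u \<xi>))\<^sup>2 * gauss ((2 * pi / \<kappa>) *\<^sub>R \<xi>) \<partial>lborel)
    = (\<integral>w. gauss w / sqrt (2 * pi) ^ DIM('a) *
        ((\<integral>x. (cmod (u x))\<^sup>2 \<partial>lborel) - enn2real (L2_shift_dist u ((1 / \<kappa>) *\<^sub>R w)) / 2) \<partial>lborel)"
proof -
  have [measurable]: "u \<in> borel_measurable borel" using u by auto
  have r: "integrable lborel (autocorr u)" by (rule integrable_autocorr[OF u])
  then have [measurable]: "autocorr u \<in> borel_measurable borel" by auto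
  let ?G = "\<lambda>\<xi>::'a. complex_of_real (gauss ((2 * pi / \<kappa>) *\<^sub>R \<xi>))"
  have G: "integrable lborel ?G"
    using integrable_lborel_scale[of "2 * pi / \<kappa>" "\<lambda>x::'a. complex_of_real (gauss x)" 0] \<kappa>
    by (simp add: integrable_gauss_complex)
  have "complex_of_real (\<integral>\<xi>. (cmod (fint u \<xi>))\<^sup>2 * gauss ((2 * pi / \<kappa>) *\<^sub>R \<xi>) \<partial>lborel)
      = (\<integral>\<xi>. fint (autocorr u) \<xi> * ?G \<xi> \<partial>lborel)"
    by (simp only: fint_autocorr[OF u] of_real_mult[symmetric] integral_complex_of_real)
  also have "\<dots> = (\<integral>x. autocorr u x * fint ?G x \<partial>lborel)"
    by (rule fint_mult[OF r G])
  also have "\<dots> = (\<integral>x. complex_of_real ((\<kappa> / sqrt (2 * pi)) ^ DIM('a) * gauss (\<kappa> *\<^sub>R x)) * autocorr u x \<partial>lborel)"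
    unfolding fint_gauss[OF \<kappa>] by (simp only: mult.commute)
  also have "\<dots> = \<bar>1 / \<kappa>\<bar> ^ DIM('a) *\<^sub>R (\<integral>w. complex_of_real ((\<kappa> / sqrt (2 * pi)) ^ DIM('a) * gauss (\<kappa> *\<^sub>R (0 + (1 / \<kappa>) *\<^sub>R w)))
      * autocorr u (0 + (1 / \<kappa>) *\<^sub>R w) \<partial>lborel)"
    by (rule integral_lborel_scale) (use \<kappa> in auto)
  also have "\<dots> = (\<integral>w. (gauss w / sqrt (2 * pi) ^ DIM('a)) *\<^sub>R autocorr u ((1 / \<kappa>) *\<^sub>R w) \<partial>lborel)"
  proof -
    have 1: "\<kappa> *\<^sub>R (0 + (1 / \<kappa>) *\<^sub>R w) = w" for w :: 'a using \<kappa> by simp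
    have 2: "\<bar>1 / \<kappa>\<bar> ^ DIM('a) * ((\<kappa> / sqrt (2 * pi)) ^ DIM('a) * g) = g / sqrt (2 * pi) ^ DIM('a)" for g
      using \<kappa> by (simp add: power_divide)
    have "\<bar>1 / \<kappa>\<bar> ^ DIM('a) *\<^sub>R (complex_of_real ((\<kappa> / sqrt (2 * pi)) ^ DIM('a) * g) * c)
        = (g / sqrt (2 * pi) ^ DIM('a)) *\<^sub>R c" for g c
      by (simp only: scaleR_conv_of_real mult.assoc[symmetric] of_real_mult[symmetric] 2[unfolded mult.assoc[symmetric]])
    then show ?thesis
      unfolding 1 integral_scaleR_right[symmetric] by simp
  qed
  finally have eq: "complex_of_real (\<integral>\<xi>. (cmod (fint u \<xi>))\<^sup>2 * gauss ((2 * pi / \<kappa>) *\<^sub>R \<xi>) \<partial>lborel)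
    = (\<integral>w. (gauss w / sqrt (2 * pi) ^ DIM('a)) *\<^sub>R autocorr u ((1 / \<kappa>) *\<^sub>R w) \<partial>lborel)" .
  have "integrable lborel (\<lambda>w. autocorr u ((1 / \<kappa>) *\<^sub>R w))"
    using integrable_lborel_scale[of "1 / \<kappa>" "autocorr u" 0] \<kappa> r by simp
  then have "integrable lborel (\<lambda>w. (gauss w / sqrt (2 * pi) ^ DIM('a)) *\<^sub>R autocorr u ((1 / \<kappa>) *\<^sub>R w))"
  proof (rule Bochner_Integration.integrable_bound[OF integrable_scaleR_right[of "1 / sqrt (2 * pi) ^ DIM('a)"]])
    show "AE w in lborel. norm ((gauss w / sqrt (2 * pi) ^ DIM('a)) *\<^sub>R autocorr u ((1 / \<kappa>) *\<^sub>R w))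
        \<le> norm ((1 / sqrt (2 * pi) ^ DIM('a)) *\<^sub>R autocorr u ((1 / \<kappa>) *\<^sub>R w))"
    proof (intro AE_I2)
      fix w :: 'a
      have "\<bar>gauss w / sqrt (2 * pi) ^ DIM('a)\<bar> \<le> \<bar>1 / sqrt (2 * pi) ^ DIM('a)\<bar>"
        using gauss_le_1[of w] by (simp add: divide_right_mono)
      then show "norm ((gauss w / sqrt (2 * pi) ^ DIM('a)) *\<^sub>R autocorr u ((1 / \<kappa>) *\<^sub>R w))
        \<le> norm ((1 / sqrt (2 * pi) ^ DIM('a)) *\<^sub>R autocorr u ((1 / \<kappa>) *\<^sub>R w))"
        unfolding norm_scaleR by (rule mult_right_mono) simp
    qed
  qed measurable
  \<comment> \<open>The left side of \<open>eq\<close> is real, so its real part carries the whole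
    identity and \<open>Re_autocorr\<close> applies under the integral.\<close>
  from integral_Re[OF this] show ?thesis
    by (simp add: eq[symmetric] Re_autocorr[OF _ u2])
qed

text \<open>Testing \<open>\<bar>fint u\<bar>\<^sup>2\<close> against wider and wider Gaussians evaluates the autocorrelation of \<open>u\<close> at \<open>0\<close>.\<close>

theorem plancherel:
  fixes u :: "'a::euclidean_space \<Rightarrow> complex"
  assumes u: "integrable lborel u" and u2: "integrable lborel (\<lambda>x. (cmod (u x))\<^sup>2)"
  shows "(\<integral>\<^sup>+\<xi>. ennreal ((cmod (fint u \<xi>))\<^sup>2) \<partial>lborel) = (\<integral>\<^sup>+x. ennreal ((cmod (u x))\<^sup>2) \<partial>lborel)"
proof -
  have [measurable]: "u \<in> borel_measurable borel" using u by auto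
  define A where "A = (\<integral>x. (cmod (u x))\<^sup>2 \<partial>lborel)"
  have A: "(\<integral>\<^sup>+x. ennreal ((cmod (u x))\<^sup>2) \<partial>lborel) = ennreal A"
    unfolding A_def by (rule nn_integral_eq_integral[OF u2]) auto
  have A0: "0 \<le> A" by (simp add: A_def)
  let ?s = "sqrt (2 * pi) ^ DIM('a)"
  let ?k = "\<lambda>n. real (Suc n)"
  let ?F = "\<lambda>n \<xi>::'a. (cmod (fint u \<xi>))\<^sup>2 * gauss ((2 * pi / ?k n) *\<^sub>R \<xi>)"
  let ?D = "\<lambda>n w. enn2real (L2_shift_dist u ((1 / ?k n) *\<^sub>R w))"
  have D_fin: "L2_shift_dist u z \<le> ennreal (8 * A)" for z
    using L2_shift_dist_bound[of u z] by (simp add: A ennreal_mult')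
  have D_le: "enn2real (L2_shift_dist u z) \<le> 8 * A" for z
    using enn2real_mono[OF D_fin, of z] A0 by simp
  have lim: "(\<lambda>n. \<integral>\<xi>. ?F n \<xi> \<partial>lborel) \<longlonglongrightarrow> (\<integral>w. gauss (w::'a) / ?s * A \<partial>lborel)"
    unfolding integral_fint_gauss[OF u u2 of_nat_0_less_iff[THEN iffD2, OF zero_less_Suc]] A_def[symmetric]
  proof (rule integral_dominated_convergence[where w = "\<lambda>w. gauss w / ?s * (5 * A)"])
    show "integrable lborel (\<lambda>w::'a. gauss w / ?s * (5 * A))"
      using integrable_gauss by auto
    show "AE w in lborel. (\<lambda>n. gauss w / ?s * (A - ?D n w / 2)) \<longlonglongrightarrow> gauss w / ?s * A"
    proof (intro AE_I2)
      fix w :: 'a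
      have "(\<lambda>n. (1 / ?k n) *\<^sub>R w) \<longlonglongrightarrow> 0 *\<^sub>R w"
        by (intro tendsto_intros lim_1_over_n[THEN LIMSEQ_Suc])
      then have "(\<lambda>n. L2_shift_dist u ((1 / ?k n) *\<^sub>R w)) \<longlonglongrightarrow> 0"
        by (intro L2_shift_dist_tendsto) (auto simp: A)
      then have "(\<lambda>n. ?D n w) \<longlonglongrightarrow> 0"
        by (intro tendsto_enn2real) simp_all
      then have "(\<lambda>n. gauss w / ?s * (A - ?D n w / 2)) \<longlonglongrightarrow> gauss w / ?s * (A - 0 / 2)"
        by (rule tendsto_mult[OF tendsto_const tendsto_diff[OF tendsto_const tendsto_divide[OF _ tendsto_const]]]) simp
      then show "(\<lambda>n. gauss w / ?s * (A - ?D n w / 2)) \<longlonglongrightarrow> gauss w / ?s * A" by simp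
    qed
    show "AE w in lborel. norm (gauss w / ?s * (A - ?D n w / 2)) \<le> gauss w / ?s * (5 * A)" for n
    proof (intro AE_I2)
      fix w :: 'a
      \<comment> \<open>The constant is A + (8 * A) / 2, from \<open>D_le\<close>.\<close>
      have "\<bar>A - ?D n w / 2\<bar> \<le> 5 * A"
        using D_le[of "(1 / ?k n) *\<^sub>R w"] enn2real_nonneg[of "L2_shift_dist u ((1 / ?k n) *\<^sub>R w)"] A0 by linarith
      then show "norm (gauss w / ?s * (A - ?D n w / 2)) \<le> gauss w / ?s * (5 * A)"
        by (simp only: real_norm_def abs_mult) (intro mult_mono, auto)
    qed
  qed measurable
  have "(\<integral>w. gauss (w::'a) / ?s * A \<partial>lborel) = A"
    by (simp add: integral_gauss)
  with lim have lim: "(\<lambda>n. \<integral>\<xi>. ?F n \<xi> \<partial>lborel) \<longlonglongrightarrow> A" by simp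
  have intF: "integrable lborel (?F n)" for n
  proof (rule Bochner_Integration.integrable_bound)
    let ?B = "\<integral>x. cmod (u x) \<partial>lborel"
    show "integrable lborel (\<lambda>\<xi>::'a. ?B\<^sup>2 * gauss ((2 * pi / ?k n) *\<^sub>R \<xi>))"
      using integrable_lborel_scale[of "2 * pi / ?k n" "gauss :: 'a \<Rightarrow> real" 0, OF _ gauss_measurable integrable_gauss]
      by simp
    show "AE \<xi> in lborel. norm (?F n \<xi>) \<le> norm (?B\<^sup>2 * gauss ((2 * pi / ?k n) *\<^sub>R \<xi>))"
    proof (intro AE_I2)
      fix \<xi> :: 'a
      have "(cmod (fint u \<xi>))\<^sup>2 * gauss ((2 * pi / ?k n) *\<^sub>R \<xi>) \<le> ?B\<^sup>2 * gauss ((2 * pi / ?k n) *\<^sub>R \<xi>)"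
        by (intro mult_right_mono power_mono norm_fint_le) auto
      moreover have "0 \<le> (cmod (fint u \<xi>))\<^sup>2 * gauss ((2 * pi / ?k n) *\<^sub>R \<xi>)" by (intro mult_nonneg_nonneg) auto
      ultimately show "norm (?F n \<xi>) \<le> norm (?B\<^sup>2 * gauss ((2 * pi / ?k n) *\<^sub>R \<xi>))"
        unfolding real_norm_def by linarith
    qed
  qed measurable
  have nnF: "(\<integral>\<^sup>+\<xi>. ennreal (?F n \<xi>) \<partial>lborel) = ennreal (\<integral>\<xi>. ?F n \<xi> \<partial>lborel)" for n
    by (rule nn_integral_eq_integral[OF intF]) auto
  have gmono: "gauss ((2 * pi / ?k m) *\<^sub>R \<xi>) \<le> gauss ((2 * pi / ?k n) *\<^sub>R \<xi>)" if "m \<le> n" for m n and \<xi> :: 'a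
  proof -
    have "2 * pi / ?k n * norm \<xi> \<le> 2 * pi / ?k m * norm \<xi>"
      using that by (intro mult_right_mono divide_left_mono) auto
    then have "(2 * pi / ?k n * norm \<xi>)\<^sup>2 \<le> (2 * pi / ?k m * norm \<xi>)\<^sup>2"
      by (intro power_mono) auto
    then show ?thesis
      unfolding gauss_def norm_scaleR by simp
  qed
  have incF: "incseq (\<lambda>n. ennreal (?F n \<xi>))" for \<xi>
    by (intro incseq_SucI ennreal_leI mult_left_mono gmono) auto
  have SUP: "ennreal ((cmod (fint u \<xi>))\<^sup>2) = (SUP n. ennreal (?F n \<xi>))" for \<xi>
  proof (rule LIMSEQ_unique)
    have "(\<lambda>n. 2 * pi / ?k n) \<longlonglongrightarrow> 0"
      by (rule LIMSEQ_Suc[OF lim_const_over_n])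
    then have "(\<lambda>n. (2 * pi / ?k n) *\<^sub>R \<xi>) \<longlonglongrightarrow> 0 *\<^sub>R \<xi>"
      by (rule tendsto_scaleR[OF _ tendsto_const])
    then have "(\<lambda>n. ?F n \<xi>) \<longlonglongrightarrow> (cmod (fint u \<xi>))\<^sup>2 * exp (- (norm (0 *\<^sub>R \<xi>))\<^sup>2 / 2)"
      unfolding gauss_def
      by (intro tendsto_mult tendsto_const tendsto_exp tendsto_divide tendsto_minus tendsto_power tendsto_norm) auto
    then show "(\<lambda>n. ennreal (?F n \<xi>)) \<longlonglongrightarrow> ennreal ((cmod (fint u \<xi>))\<^sup>2)"
      by (intro tendsto_intros) simp
    show "(\<lambda>n. ennreal (?F n \<xi>)) \<longlonglongrightarrow> (SUP n. ennreal (?F n \<xi>))"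
      by (intro LIMSEQ_SUP incF)
  qed
  \<comment> \<open>The Gaussians widen with n and increase to 1, so monotone convergence evaluates
    this integral without prior knowledge that it is finite.\<close>
  have "(\<integral>\<^sup>+\<xi>. ennreal ((cmod (fint u \<xi>))\<^sup>2) \<partial>lborel) = (SUP n. \<integral>\<^sup>+\<xi>. ennreal (?F n \<xi>) \<partial>lborel)"
    unfolding SUP
  proof (rule nn_integral_monotone_convergence_SUP)
    show "incseq (\<lambda>n \<xi>. ennreal (?F n \<xi>))"
      using incF unfolding incseq_def le_fun_def by blast
  qed measurable
  also have "\<dots> = ennreal A"
  proof (rule LIMSEQ_unique)
    show "(\<lambda>n. \<integral>\<^sup>+\<xi>. ennreal (?F n \<xi>) \<partial>lborel) \<longlonglongrightarrow> (SUP n. \<integral>\<^sup>+\<xi>. ennreal (?F n \<xi>) \<partial>lborel)"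
      by (intro LIMSEQ_SUP incseq_SucI nn_integral_mono ennreal_leI mult_left_mono gmono) auto
    show "(\<lambda>n. \<integral>\<^sup>+\<xi>. ennreal (?F n \<xi>) \<partial>lborel) \<longlonglongrightarrow> ennreal A"
      unfolding nnF by (intro tendsto_intros lim)
  qed
  finally show ?thesis by (simp add: A)
qed

subsection \<open>Integer powers of a matrix\<close>

lemma
  fixes M :: "real^'n^'m"
  shows matrix_vector_mult_minus_left: "(- M) *v x = - (M *v x)"
    and matrix_vector_mult_minus_right: "M *v (- x) = - (M *v x)"
  by (simp_all add: vec_eq_iff matrix_vector_mult_def sum_negf)

text \<open>\<open>mat_ipow_app\<close> is a function given by cases on the sign of the exponent;
  its matrix gives access to determinants, invertibility and the affine substitution rules.\<close>

definition mpow :: "real^'d^'d \<Rightarrow> int \<Rightarrow> real^'d^'d" where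
  "mpow A j = matrix (mat_ipow_app A j)"

lemma linear_funpow: "linear f \<Longrightarrow> linear (f ^^ n)" for f :: "'a::real_vector \<Rightarrow> 'a"
proof (induction n)
  case 0 then show ?case by (simp add: linear_iff)
next
  case (Suc n) then show ?case unfolding funpow.simps by (rule linear_compose) fact
qed

lemma linear_mat_ipow_app: "linear (mat_ipow_app A j)"
proof -
  have "mat_ipow_app A j = (if 0 \<le> j then ((*v) A) ^^ nat j else ((*v) (matrix_inv A)) ^^ nat (- j))"
    by (auto simp: fun_eq_iff mat_ipow_app_def)
  then show ?thesis by (auto intro!: linear_funpow)
qed

lemma mat_ipow_app_eq: "mat_ipow_app A j x = mpow A j *v x"
  by (simp add: mpow_def matrix_works linear_mat_ipow_app)

lemma matrix_inv_vec:
  fixes A :: "real^'d^'d"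
  assumes "invertible A"
  shows "A *v (matrix_inv A *v x) = x" "matrix_inv A *v (A *v x) = x"
proof -
  have "A ** matrix_inv A = mat 1 \<and> matrix_inv A ** A = mat 1"
    using assms unfolding matrix_inv_def invertible_def by (rule someI_ex)
  then show "A *v (matrix_inv A *v x) = x" "matrix_inv A *v (A *v x) = x"
    by (simp_all add: matrix_vector_mul_assoc)
qed

lemma funpow_inverse:
  fixes f g :: "'a \<Rightarrow> 'a"
  assumes "\<And>x. f (g x) = x"
  shows "(f ^^ n) ((g ^^ n) x) = x"
proof (induction n arbitrary: x)
  case (Suc n)
  have "(f ^^ Suc n) ((g ^^ Suc n) x) = (f ^^ n) (f (g ((g ^^ n) x)))"
    by (simp add: funpow_swap1)
  then show ?case by (simp add: assms Suc)
qed simp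

lemma mat_ipow_app_minus:
  assumes "invertible A"
  shows "mat_ipow_app A (- j) (mat_ipow_app A j x) = x"
  using funpow_inverse[of "(*v) A" "(*v) (matrix_inv A)"] funpow_inverse[of "(*v) (matrix_inv A)" "(*v) A"]
  by (cases "j = 0") (auto simp: mat_ipow_app_def matrix_inv_vec[OF assms])

lemma mpow_minus:
  assumes "invertible A"
  shows "mpow A (- j) *v (mpow A j *v x) = x" "mpow A j *v (mpow A (- j) *v x) = x"
  using mat_ipow_app_minus[OF assms, of j x] mat_ipow_app_minus[OF assms, of "- j" x]
  by (simp_all add: mat_ipow_app_eq)

lemma mpow_mult_minus:
  assumes "invertible A"
  shows "mpow A (- j) ** mpow A j = mat 1" "mpow A j ** mpow A (- j) = mat 1"
  by (simp_all add: matrix_eq matrix_vector_mul_assoc[symmetric] mpow_minus assms)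

lemma invertible_mpow: "invertible A \<Longrightarrow> invertible (mpow A j)"
  using mpow_mult_minus unfolding invertible_def by blast

lemma det_matrix_funpow: "det (matrix (((*v) A) ^^ n)) = det A ^ n" for A :: "real^'d^'d"
proof (induction n)
  case (Suc n)
  have "det (matrix (((*v) A) ^^ Suc n)) = det (matrix ((*v) A \<circ> (((*v) A) ^^ n)))" by simp
  also have "\<dots> = det (A ** matrix (((*v) A) ^^ n))"
    by (subst matrix_compose) (auto intro!: linear_funpow simp: matrix_of_matrix_vector_mul)
  finally show ?case by (simp only: det_mul Suc power_Suc)
qed (simp add: matrix_id_mat_1 id_def[symmetric])

text \<open>Negative exponents reduce to positive ones, since opposite powers have determinants with
  product 1. The form with \<open>powr\<close> is the one in which the Haar weight is
  written.\<close>

lemma det_mpow: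
  assumes A: "invertible A"
  shows "\<bar>det (mpow A j)\<bar> = \<bar>det A\<bar> powr real_of_int j"
proof -
  have pos: "\<bar>det A\<bar> > 0" using A by (simp add: invertible_det_nz)
  have nonneg: "\<bar>det (mpow A j)\<bar> = \<bar>det A\<bar> powr real_of_int j" if "j \<ge> 0" for j
  proof -
    have "mpow A j = matrix (((*v) A) ^^ nat j)"
      using that unfolding mpow_def by (intro arg_cong[where f = matrix] ext) (simp add: mat_ipow_app_def)
    then show ?thesis
      using that pos by (simp add: det_matrix_funpow power_abs powr_real_of_int)
  qed
  show ?thesis
  proof (cases "j \<ge> 0")
    case False
    have "\<bar>det (mpow A j)\<bar> * \<bar>det (mpow A (- j))\<bar> = 1"
      by (simp add: abs_mult[symmetric] det_mul[symmetric] mpow_mult_minus[OF A])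
    moreover have "\<bar>det (mpow A (- j))\<bar> = inverse (\<bar>det A\<bar> powr real_of_int j)"
      using False nonneg[of "- j"] by (simp add: powr_minus)
    ultimately show ?thesis
      using pos by (simp add: field_simps)
  qed (rule nonneg)
qed

lemma adjoint_funpow:
  fixes f g :: "'a::real_inner \<Rightarrow> 'a"
  assumes "\<And>x y. f x \<bullet> y = x \<bullet> g y"
  shows "(f ^^ n) x \<bullet> y = x \<bullet> (g ^^ n) y"
proof (induction n arbitrary: y)
  case (Suc n)
  have "(f ^^ Suc n) x \<bullet> y = (f ^^ n) x \<bullet> g y" by (simp add: assms)
  also have "\<dots> = x \<bullet> (g ^^ n) (g y)" by (rule Suc)
  finally show ?case by (simp only: funpow_Suc_right o_apply)
qed simp

text \<open>A and \<open>transpose A\<close> are adjoint, hence so are their inverses; induction on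
  the number of factors covers both signs of j.\<close>

lemma transpose_mpow:
  assumes A: "invertible A"
  shows "x \<bullet> (mpow (transpose A) j *v y) = (mpow A j *v x) \<bullet> y"
proof -
  have 1: "(A *v x) \<bullet> y = x \<bullet> (transpose A *v y)" for x y
    by (metis dot_lmul_matrix inner_commute transpose_matrix_vector transpose_transpose)
  have tA: "invertible (transpose A)" using A by (simp add: invertible_det_nz)
  have 2: "(matrix_inv A *v x) \<bullet> y = x \<bullet> (matrix_inv (transpose A) *v y)" for x y
    using 1[of "matrix_inv A *v x" "matrix_inv (transpose A) *v y"]
    by (metis matrix_inv_vec(1)[OF A] matrix_inv_vec(1)[OF tA])
  show ?thesis
    unfolding mat_ipow_app_eq[symmetric] mat_ipow_app_def
    using adjoint_funpow[of "(*v) A" "(*v) (transpose A)", OF 1]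
      adjoint_funpow[of "(*v) (matrix_inv A)" "(*v) (matrix_inv (transpose A))", OF 2]
    by simp
qed

subsection \<open>Lattice sums\<close>

lemma borel_measurable_matrix_vector [measurable (raw)]:
  fixes W :: "real^'n^'m"
  assumes "f \<in> borel_measurable N"
  shows "(\<lambda>x. W *v f x) \<in> borel_measurable N"
  by (rule measurable_compose[OF assms])
     (intro borel_measurable_continuous_onI matrix_vector_mult_linear_continuous_on)

definition int_vec :: "int^'d \<Rightarrow> real^'d" where
  "int_vec k = (\<chi> i. real_of_int (k $ i))"

text \<open>Each lattice point carries a cell of volume |det M|, and the cells tile the space. The
  cells of the lattice points in a ball of radius r stay within radius r + c and cover radius r - c,
  where c bounds the norms of the vectors in M applied to the unit cube. The estimates are uniform
  in x, so that they can later be integrated against a function of x.\<close>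

lemma nn_integral_cell:
  fixes M :: "real^'d^'d"
  assumes M: "invertible M"
  obtains c where "c > 0"
    "\<And>x r. ennreal \<bar>det M\<bar> * (\<integral>\<^sup>+k. indicator (ball 0 r) (x + M *v int_vec k) \<partial>count_space UNIV)
       \<le> emeasure lborel (ball (0::real^'d) (r + c))"
    "\<And>x r. emeasure lborel (ball (0::real^'d) (r - c)) \<le>
       ennreal \<bar>det M\<bar> * (\<integral>\<^sup>+k. indicator (ball 0 r) (x + M *v int_vec k) \<partial>count_space UNIV)"
proof -
  let ?W = "matrix_inv M"
  have W: "M *v (?W *v x) = x" "?W *v (M *v x) = x" for x
    using M by (simp_all add: matrix_inv_vec)
  \<comment> \<open>The cube is half-open, so that its integer translates overlap nowhere and leave
    no gap.\<close>
  define Q :: "(real^'d) set" where "Q = {v. \<forall>i. 0 \<le> v $ i \<and> v $ i < 1}"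
  have Q_eq: "Q = (\<Inter>i. {v. 0 \<le> v $ i \<and> v $ i < 1})" by (auto simp: Q_def)
  have Q[measurable]: "Q \<in> sets borel"
    unfolding Q_eq by (intro sets.countable_INT') auto
  have "bounded ((*v) M ` cbox (0::real^'d) 1)"
    by (intro bounded_linear_image bounded_cbox matrix_vector_mul_bounded_linear)
  then obtain c where c: "c > 0" "\<And>x. x \<in> (*v) M ` cbox 0 1 \<Longrightarrow> norm x \<le> c"
    unfolding bounded_pos by blast
  have Qc: "norm (M *v v) \<le> c" if "v \<in> Q" for v
    using that by (intro c(2) imageI) (auto simp: Q_def mem_box_cart less_imp_le)
  have volQ: "(\<integral>\<^sup>+v. indicator Q v \<partial>lborel) = (1::ennreal)"
  proof -
    have "box 0 1 \<subseteq> Q" "Q \<subseteq> cbox (0::real^'d) 1"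
      by (auto simp: Q_def mem_box_cart less_imp_le)
    then have "emeasure lborel (box (0::real^'d) 1) \<le> emeasure lborel Q"
      "emeasure lborel Q \<le> emeasure lborel (cbox (0::real^'d) 1)"
      by (auto intro!: emeasure_mono)
    moreover have "(\<Prod>b\<in>Basis. (1::real^'d) \<bullet> b) = 1" "\<And>b. b \<in> Basis \<Longrightarrow> 0 \<le> (1::real^'d) \<bullet> b"
      by (simp add: prod_Basis_vec inner_axis, auto simp: Basis_vec_def inner_axis)
    then have "emeasure lborel (box (0::real^'d) 1) = 1" "emeasure lborel (cbox (0::real^'d) 1) = 1"
      by (simp_all add: emeasure_lborel_box_eq emeasure_lborel_cbox_eq)
    ultimately show ?thesis by simp
  qed
  \<comment> \<open>Each \<open>u\<close> lies in exactly one translate \<open>x + M *v int_vec k - M *v Q\<close>.\<close>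
  define k0 where "k0 u x = (\<chi> i. - \<lfloor>(?W *v (x - u)) $ i\<rfloor>)" for u x
  have k0: "?W *v (x + M *v int_vec k - u) \<in> Q \<longleftrightarrow> k = k0 u x" for u x k
  proof -
    have eq: "?W *v (x + M *v int_vec k - u) = ?W *v (x - u) + int_vec k"
      using W(2) by (simp add: matrix_vector_mult_diff_distrib matrix_vector_right_distrib)
    have "0 \<le> a + real_of_int n \<and> a + real_of_int n < 1 \<longleftrightarrow> n = - \<lfloor>a\<rfloor>" for a n
      by linarith
    then show ?thesis
      unfolding eq Q_def k0_def by (simp add: int_vec_def vec_eq_iff)
  qed
  have M_Q: "ennreal \<bar>det M\<bar> = (\<integral>\<^sup>+u. indicator Q (?W *v (z - u)) \<partial>lborel)" for z
  proof -
    have "(\<lambda>u. indicator Q (?W *v (z - u))) \<in> borel_measurable (borel :: (real^'d) measure)"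
      by measurable
    note h = this
    \<comment> \<open>The substitution u = z - M v has linear part - M; its determinant is compared
      with that of M through minus the identity matrix.\<close>
    have invM: "invertible (- M)" and det: "\<bar>det (- M)\<bar> = \<bar>det M\<bar>"
    proof -
      let ?N = "- mat 1 :: real^'d^'d"
      have NN: "?N ** ?N = mat 1" "?N ** M = - M"
        by (simp_all add: matrix_eq matrix_vector_mul_assoc[symmetric] matrix_vector_mult_minus_left matrix_vector_mult_minus_right)
      have "(det ?N)\<^sup>2 = 1"
        unfolding power2_eq_square det_mul[symmetric] NN by simp
      then have "\<bar>det ?N\<bar> = 1" by (auto simp only: power2_eq_1_iff abs_1 abs_minus_cancel)
      then show "\<bar>det (- M)\<bar> = \<bar>det M\<bar>"
        using det_mul[of ?N M] unfolding NN by (simp only: abs_mult mult_1)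
      with M show "invertible (- M)" by (auto simp: invertible_det_nz)
    qed
    have "(\<integral>\<^sup>+u. indicator Q (?W *v (z - u)) \<partial>lborel)
      = ennreal \<bar>det (- M)\<bar> * (\<integral>\<^sup>+v. indicator Q (?W *v (z - (z + (- M) *v v))) \<partial>lborel)"
      by (rule nn_integral_affine_vec_borel[OF invM h])
    also have "(\<lambda>v. indicator Q (?W *v (z - (z + (- M) *v v))) :: ennreal) = indicator Q"
      by (simp add: fun_eq_iff W(2) matrix_vector_mult_minus_left)
    finally show ?thesis by (simp add: volQ det)
  qed
  \<comment> \<open>The factor |det M| is written as the volume of the cell at each lattice point.
    After the exchange of sum and integral, each u meets exactly one k.\<close>
  have key: "ennreal \<bar>det M\<bar> * (\<integral>\<^sup>+k. indicator (ball 0 r) (x + M *v int_vec k) \<partial>count_space UNIV)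
     = (\<integral>\<^sup>+u. indicator (ball 0 r) (x + M *v int_vec (k0 u x)) \<partial>lborel)" for x r
  proof -
    have "ennreal \<bar>det M\<bar> * (\<integral>\<^sup>+k. indicator (ball 0 r) (x + M *v int_vec k) \<partial>count_space UNIV)
      = (\<integral>\<^sup>+k. (\<integral>\<^sup>+u. indicator (ball 0 r) (x + M *v int_vec k) * indicator Q (?W *v (x + M *v int_vec k - u)) \<partial>lborel) \<partial>count_space UNIV)"
    proof -
      have "(\<integral>\<^sup>+u. indicator (ball 0 r) (x + M *v int_vec k) * indicator Q (?W *v (x + M *v int_vec k - u)) \<partial>lborel)
          = ennreal \<bar>det M\<bar> * indicator (ball 0 r) (x + M *v int_vec k)" for k
        using M_Q[of "x + M *v int_vec k", symmetric]
        by (simp add: nn_integral_cmult mult.commute)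
      then show ?thesis by (simp add: nn_integral_cmult)
    qed
    also have "\<dots> = (\<integral>\<^sup>+u. (\<integral>\<^sup>+k. indicator (ball 0 r) (x + M *v int_vec k) * indicator Q (?W *v (x + M *v int_vec k - u)) \<partial>count_space UNIV) \<partial>lborel)"
      by (intro nn_integral_count_space_nn_integral[symmetric]) (auto intro: countableI_type)
    also have "\<dots> = (\<integral>\<^sup>+u. indicator (ball 0 r) (x + M *v int_vec (k0 u x)) \<partial>lborel)"
    proof (rule nn_integral_cong)
      fix u
      have "(\<integral>\<^sup>+k. indicator (ball 0 r) (x + M *v int_vec k) * indicator Q (?W *v (x + M *v int_vec k - u)) \<partial>count_space UNIV)
        = (\<Sum>k\<in>{k0 u x}. indicator (ball 0 r) (x + M *v int_vec k) * indicator Q (?W *v (x + M *v int_vec k - u)) :: ennreal)"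
        by (rule nn_integral_count_space') (auto simp: k0 indicator_def)
      then show "(\<integral>\<^sup>+k. indicator (ball 0 r) (x + M *v int_vec k) * indicator Q (?W *v (x + M *v int_vec k - u)) \<partial>count_space UNIV)
        = (indicator (ball 0 r) (x + M *v int_vec (k0 u x)) :: ennreal)"
        by (simp add: k0 indicator_def)
    qed
    finally show ?thesis .
  qed
  have near: "norm (x + M *v int_vec (k0 u x) - u) \<le> c" for u x
    using Qc[of "?W *v (x + M *v int_vec (k0 u x) - u)"] k0[of x "k0 u x" u] W(1) by simp
  show ?thesis
  proof
    show "c > 0" by fact
    fix x r
    have "(\<integral>\<^sup>+u. indicator (ball 0 r) (x + M *v int_vec (k0 u x)) \<partial>lborel) \<le> (\<integral>\<^sup>+u. indicator (ball (0::real^'d) (r + c)) u \<partial>lborel)"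
    proof (intro nn_integral_mono)
      fix u
      show "indicator (ball 0 r) (x + M *v int_vec (k0 u x)) \<le> (indicator (ball 0 (r + c)) u :: ennreal)"
        using near[of x u] norm_triangle_ineq4[of "x + M *v int_vec (k0 u x)" "x + M *v int_vec (k0 u x) - u"]
        by (auto simp: indicator_def)
    qed
    then show "ennreal \<bar>det M\<bar> * (\<integral>\<^sup>+k. indicator (ball 0 r) (x + M *v int_vec k) \<partial>count_space UNIV)
       \<le> emeasure lborel (ball (0::real^'d) (r + c))"
      unfolding key by simp
    have "(\<integral>\<^sup>+u. indicator (ball (0::real^'d) (r - c)) u \<partial>lborel) \<le> (\<integral>\<^sup>+u. indicator (ball 0 r) (x + M *v int_vec (k0 u x)) \<partial>lborel)"
    proof (intro nn_integral_mono)
      fix u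
      show "(indicator (ball 0 (r - c)) u :: ennreal) \<le> indicator (ball 0 r) (x + M *v int_vec (k0 u x))"
        using near[of x u] norm_triangle_ineq[of u "x + M *v int_vec (k0 u x) - u"]
        by (auto simp: indicator_def)
    qed
    then show "emeasure lborel (ball (0::real^'d) (r - c)) \<le>
       ennreal \<bar>det M\<bar> * (\<integral>\<^sup>+k. indicator (ball 0 r) (x + M *v int_vec k) \<partial>count_space UNIV)"
      unfolding key by simp
  qed
qed

text \<open>Exchanging sum and integral turns the averaged lattice sum into the integral of
  \<open>\<phi>\<close> against a count of lattice points. By \<open>nn_integral_cell\<close> that
  count, times |det M|, lies between the volumes of two balls whose ratios to the averaging ball
  tend to 1. The rate is governed by c and so varies with M.\<close>

lemma nn_integral_lattice_average:
  fixes M :: "real^'d^'d" and \<phi> :: "real^'d \<Rightarrow> ennreal"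
  assumes M: "invertible M" and [measurable]: "\<phi> \<in> borel_measurable lebesgue"
    and fin: "(\<integral>\<^sup>+x. \<phi> x \<partial>lebesgue) < \<infinity>"
  shows "(\<lambda>n. (\<integral>\<^sup>+k. (\<integral>\<^sup>+y. \<phi> (y + M *v int_vec k) * indicator (ball 0 (real n)) y \<partial>lebesgue) \<partial>count_space UNIV)
      / emeasure lborel (ball (0::real^'d) (real n))) \<longlonglongrightarrow> ennreal (1 / \<bar>det M\<bar>) * (\<integral>\<^sup>+x. \<phi> x \<partial>lebesgue)"
proof -
  obtain c where c: "c > 0"
    "\<And>x r. ennreal \<bar>det M\<bar> * (\<integral>\<^sup>+k. indicator (ball 0 r) (x + M *v int_vec k) \<partial>count_space UNIV)
       \<le> emeasure lborel (ball (0::real^'d) (r + c))"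
    "\<And>x r. emeasure lborel (ball (0::real^'d) (r - c)) \<le>
       ennreal \<bar>det M\<bar> * (\<integral>\<^sup>+k. indicator (ball 0 r) (x + M *v int_vec k) \<partial>count_space UNIV)"
    using nn_integral_cell[OF M] by blast
  define J where "J = enn2real (\<integral>\<^sup>+x. \<phi> x \<partial>lebesgue)"
  have J: "(\<integral>\<^sup>+x. \<phi> x \<partial>lebesgue) = ennreal J" "0 \<le> J" using fin by (simp_all add: J_def)
  define D where "D = \<bar>det M\<bar>"
  have D: "D > 0" using M by (simp add: D_def invertible_det_nz)
  define v where "v = unit_ball_vol (real CARD('d))"
  have v: "v > 0" by (simp add: v_def)
  have vol: "emeasure lborel (ball (0::real^'d) r) = ennreal (v * r ^ CARD('d))" if "r \<ge> 0" for r
    using emeasure_ball[OF that, of "0::real^'d"] by (simp add: v_def)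
  define I where "I r = (\<integral>\<^sup>+k. (\<integral>\<^sup>+y. \<phi> (y + M *v int_vec k) * indicator (ball 0 r) y \<partial>lebesgue) \<partial>count_space UNIV)" for r
  have N_meas: "(\<lambda>x. indicator (ball 0 r) (- M *v int_vec k + x) :: ennreal) \<in> borel_measurable lebesgue" for k r
  proof -
    have "(\<lambda>x. indicator (ball 0 r) (- M *v int_vec k + x) :: ennreal) = indicator (ball (M *v int_vec k) r)"
      by (auto simp: indicator_def fun_eq_iff dist_norm norm_minus_commute matrix_vector_mult_minus_left)
    then show ?thesis by (simp only:) (intro borel_measurable_indicator sets_completionI_sets, simp)
  qed
  have I_eq: "ennreal D * I r = (\<integral>\<^sup>+x. \<phi> x * (ennreal D * (\<integral>\<^sup>+k. indicator (ball 0 r) (x + M *v int_vec k) \<partial>count_space UNIV)) \<partial>lebesgue)" for r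
  proof -
    have "(\<integral>\<^sup>+y. \<phi> (y + M *v int_vec k) * indicator (ball 0 r) y \<partial>lebesgue)
        = (\<integral>\<^sup>+x. \<phi> x * indicator (ball 0 r) (- M *v int_vec k + x) \<partial>lebesgue)" for k
    proof -
      have "(\<integral>\<^sup>+x. \<phi> x * indicator (ball 0 r) (- M *v int_vec k + x) \<partial>lebesgue)
        = ennreal \<bar>det (mat 1 :: real^'d^'d)\<bar> * (\<integral>\<^sup>+y. \<phi> (M *v int_vec k + mat 1 *v y) *
            indicator (ball 0 r) (- M *v int_vec k + (M *v int_vec k + mat 1 *v y)) \<partial>lebesgue)"
        by (rule nn_integral_affine_vec) (auto intro!: borel_measurable_times_ennreal N_meas simp: invertible_det_nz)
      then show ?thesis by (simp add: matrix_vector_mult_minus_left add.commute)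
    qed
    then have "I r = (\<integral>\<^sup>+k. (\<integral>\<^sup>+x. \<phi> x * indicator (ball 0 r) (- M *v int_vec k + x) \<partial>lebesgue) \<partial>count_space UNIV)"
      by (simp add: I_def)
    \<comment> \<open>Replacing k by - k turns the count of points x - M k into the count of points
      x + M k from \<open>nn_integral_cell\<close>.\<close>
    also have "\<dots> = (\<integral>\<^sup>+k. (\<integral>\<^sup>+x. \<phi> x * indicator (ball 0 r) (- M *v int_vec (- k) + x) \<partial>lebesgue) \<partial>count_space UNIV)"
      by (rule nn_integral_bij_count_space[symmetric]) (rule bij_uminus)
    finally have "ennreal D * I r = (\<integral>\<^sup>+k. (\<integral>\<^sup>+x. ennreal D * (\<phi> x * indicator (ball 0 r) (- M *v int_vec (- k) + x)) \<partial>lebesgue) \<partial>count_space UNIV)"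
      by (simp add: nn_integral_cmult borel_measurable_times_ennreal N_meas)
    also have "\<dots> = (\<integral>\<^sup>+x. (\<integral>\<^sup>+k. ennreal D * (\<phi> x * indicator (ball 0 r) (- M *v int_vec (- k) + x)) \<partial>count_space UNIV) \<partial>lebesgue)"
      by (intro nn_integral_count_space_nn_integral[symmetric] borel_measurable_times_ennreal N_meas) (auto intro: countableI_type)
    also have "\<dots> = (\<integral>\<^sup>+x. (\<integral>\<^sup>+k. \<phi> x * (ennreal D * indicator (ball 0 r) (x + M *v int_vec k)) \<partial>count_space UNIV) \<partial>lebesgue)"
    proof -
      have eq: "- M *v int_vec (- k) + x = x + M *v int_vec k" for x :: "real^'d" and k
    proof -
      have "int_vec (- k) = - int_vec k" by (simp add: int_vec_def vec_eq_iff)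
      then show ?thesis by (simp add: matrix_vector_mult_minus_left matrix_vector_mult_minus_right add.commute)
    qed
      show ?thesis unfolding eq by (simp only: mult_ac)
    qed
    finally show ?thesis by (simp add: nn_integral_cmult)
  qed
  have upper: "ennreal D * I r \<le> ennreal (v * (r + c) ^ CARD('d)) * ennreal J" if "r \<ge> 0" for r
  proof -
    have "ennreal D * I r \<le> (\<integral>\<^sup>+x. \<phi> x * emeasure lborel (ball (0::real^'d) (r + c)) \<partial>lebesgue)"
      unfolding I_eq unfolding D_def by (intro nn_integral_mono mult_left_mono c(2)) auto
    also have "\<dots> = ennreal (v * (r + c) ^ CARD('d)) * ennreal J"
      using that c(1) by (simp add: nn_integral_multc J vol mult.commute)
    finally show ?thesis .
  qed
  have lower: "ennreal (v * (r - c) ^ CARD('d)) * ennreal J \<le> ennreal D * I r" if "r \<ge> c" for r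
  proof -
    have "(\<integral>\<^sup>+x. \<phi> x * emeasure lborel (ball (0::real^'d) (r - c)) \<partial>lebesgue) \<le> ennreal D * I r"
      unfolding I_eq unfolding D_def by (intro nn_integral_mono mult_left_mono c(3)) auto
    also have "(\<integral>\<^sup>+x. \<phi> x * emeasure lborel (ball (0::real^'d) (r - c)) \<partial>lebesgue) = ennreal (v * (r - c) ^ CARD('d)) * ennreal J"
      using that by (simp add: nn_integral_multc J vol mult.commute)
    finally show ?thesis .
  qed
  \<comment> \<open>Radii above c make the inner radius r - c nonnegative, as the volume formula
    asks, and keep the denominator away from 0.\<close>
  have bounds: "I r / emeasure lborel (ball (0::real^'d) r) \<in>
      {ennreal (((r - c) / r) ^ CARD('d) * (J / D))..ennreal (((r + c) / r) ^ CARD('d) * (J / D))}" if r: "r > c" for r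
  proof -
    have r0: "r > 0" using r c(1) by simp
    have up: "ennreal D * I r \<le> ennreal (v * (r + c) ^ CARD('d) * J)"
      using upper[of r] r0 v c(1) J(2) by (simp add: ennreal_mult')
    then have "I r < top"
      using D by (cases "I r") (auto simp: ennreal_mult_top top_unique)
    then obtain i where i: "I r = ennreal i" "0 \<le> i" by (cases "I r") auto
    have lo: "ennreal (v * (r - c) ^ CARD('d) * J) \<le> ennreal D * I r"
      using lower[of r] r v J(2) by (simp add: ennreal_mult')
    have up': "D * i \<le> v * (r + c) ^ CARD('d) * J"
      using up i D v r0 c(1) J(2) by (simp add: ennreal_mult'[symmetric])
    have lo': "v * (r - c) ^ CARD('d) * J \<le> D * i"
      using lo i D by (simp add: ennreal_mult'[symmetric])
    have "I r / emeasure lborel (ball (0::real^'d) r) = ennreal (i / (v * r ^ CARD('d)))"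
      using r0 v i(2) unfolding i(1) vol[OF less_imp_le[OF r0]] by (intro divide_ennreal) auto
    moreover have "i / (v * r ^ CARD('d)) \<le> ((r + c) / r) ^ CARD('d) * (J / D)"
      using up' D v r0 by (simp add: power_divide field_simps)
    moreover have "((r - c) / r) ^ CARD('d) * (J / D) \<le> i / (v * r ^ CARD('d))"
      using lo' D v r0 by (simp add: power_divide field_simps)
    ultimately show ?thesis by (auto intro: ennreal_leI)
  qed
  have ratio: "(\<lambda>n. ennreal (((real n + a) / real n) ^ CARD('d) * (J / D))) \<longlonglongrightarrow> ennreal (1 ^ CARD('d) * (J / D))" for a
  proof (intro tendsto_intros)
    have "(\<lambda>n. 1 + a / real n) \<longlonglongrightarrow> 1"
      using tendsto_add[OF tendsto_const lim_const_over_n[of a], of 1] by simp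
    then show "(\<lambda>n. (real n + a) / real n) \<longlonglongrightarrow> 1"
    proof (rule Lim_transform_eventually)
      show "\<forall>\<^sub>F n in sequentially. 1 + a / real n = (real n + a) / real n"
        using eventually_gt_at_top[of 0] by eventually_elim (simp add: field_simps)
    qed
  qed
  have ev: "\<forall>\<^sub>F n in sequentially. real n > c"
    using filterlim_real_sequentially by (simp add: filterlim_at_top_dense)
  have "(\<lambda>n. I (real n) / emeasure lborel (ball (0::real^'d) (real n))) \<longlonglongrightarrow> ennreal (1 ^ CARD('d) * (J / D))"
  proof (rule tendsto_sandwich[OF _ _ ratio[of "- c"] ratio[of c]])
    show "\<forall>\<^sub>F n in sequentially. ennreal (((real n + - c) / real n) ^ CARD('d) * (J / D)) \<le> I (real n) / emeasure lborel (ball (0::real^'d) (real n))"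
      using ev by eventually_elim (use bounds in auto)
    show "\<forall>\<^sub>F n in sequentially. I (real n) / emeasure lborel (ball (0::real^'d) (real n)) \<le> ennreal (((real n + c) / real n) ^ CARD('d) * (J / D))"
      using ev by eventually_elim (use bounds in auto)
  qed
  also have "ennreal (1 ^ CARD('d) * (J / D)) = ennreal (1 / \<bar>det M\<bar>) * (\<integral>\<^sup>+x. \<phi> x \<partial>lebesgue)"
    using D by (simp add: J D_def ennreal_mult'[symmetric])
  finally show ?thesis unfolding I_def .
qed

section \<open>A sampling bound uniform in the dilation\<close>

lemma norm_int_vec_ge_1:
  assumes "k \<noteq> l"
  shows "1 \<le> norm (int_vec k - int_vec l)"
proof -
  obtain i where "k $ i \<noteq> l $ i" using assms by (auto simp: vec_eq_iff)
  then have "1 \<le> \<bar>(int_vec k - int_vec l) $ i\<bar>" by (simp add: int_vec_def)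
  also have "\<dots> \<le> norm (int_vec k - int_vec l)" by (rule component_le_norm_cart)
  finally show ?thesis .
qed

text \<open>The ellipsoids A (ball r) around the sampling points y + A P k are pairwise disjoint,
  and on each of them m is at least the value of \<phi> at its centre. Separation is measured after
  applying the inverse of A, so r and v depend on P only; this is what makes one majorant serve all
  levels j.\<close>

lemma lattice_sum_le_nn_integral:
  fixes P :: "real^'d^'d"
  assumes P: "invertible P"
  obtains v where "v > 0"
    "\<And>A \<phi> m y. invertible A \<Longrightarrow> m \<in> borel_measurable lebesgue \<Longrightarrow>
       (\<And>p q. norm q \<le> 1 \<Longrightarrow> \<phi> p \<le> (m (p + A *v q) :: ennreal)) \<Longrightarrow>
       ennreal (v * \<bar>det A\<bar>) * (\<integral>\<^sup>+k. \<phi> (y + A *v (P *v int_vec k)) \<partial>count_space UNIV) \<le> (\<integral>\<^sup>+x. m x \<partial>lebesgue)"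
proof -
  have "inj ((*v) P)" using matrix_inv_vec(2)[OF P] by (metis injI)
  then obtain B where B: "B > 0" "\<And>x. B * norm x \<le> norm (P *v x)"
    using linear_inj_bounded_below_pos[OF matrix_vector_mul_linear] by metis
  \<comment> \<open>r \<le> 1 keeps the ellipsoids inside the region where m majorises \<phi>; 2 * r
    \<le> B keeps them disjoint, since distinct points of the lattice P Z^d are at least B
    apart.\<close>
  define r where "r = min 1 (B / 2)"
  have r: "r > 0" "r \<le> 1" "2 * r \<le> B" using B(1) by (auto simp: r_def)
  define v where "v = measure lborel (ball (0::real^'d) r)"
  have v: "v > 0" unfolding v_def using r by (simp add: content_ball_pos)
  have vol: "emeasure lborel (ball (0::real^'d) r) = ennreal v"
    unfolding v_def by (rule emeasure_eq_ennreal_measure) (use emeasure_bounded_finite[OF bounded_ball] in \<open>auto simp: less_top\<close>)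
  have main: "ennreal (v * \<bar>det A\<bar>) * (\<integral>\<^sup>+k. \<phi> (y + A *v (P *v int_vec k)) \<partial>count_space UNIV) \<le> (\<integral>\<^sup>+x. m x \<partial>lebesgue)"
    if A: "invertible A" and [measurable]: "m \<in> borel_measurable lebesgue"
      and le: "\<And>p q. norm q \<le> 1 \<Longrightarrow> \<phi> p \<le> (m (p + A *v q) :: ennreal)"
    for A :: "real^'d^'d" and \<phi> m y
  proof -
    let ?W = "matrix_inv A"
    define p where "p k = y + A *v (P *v int_vec k)" for k
    have B_meas: "indicator (ball 0 r) \<in> borel_measurable (borel :: (real^'d) measure)"
      by (intro borel_measurable_indicator) simp
    have h: "(\<lambda>x. indicator (ball 0 r) (?W *v (x - z)) :: ennreal) \<in> borel_measurable lebesgue" for z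
    proof -
      have "(\<lambda>x. indicator (ball 0 r) (?W *v (x - z)) :: ennreal) \<in> borel_measurable borel"
        by (rule measurable_compose[OF _ B_meas]) measurable
      then have "(\<lambda>x. indicator (ball 0 r) (?W *v (x - z)) :: ennreal) \<in> borel_measurable lborel" by simp
      then show ?thesis by (rule measurable_completion)
    qed
    have "(\<integral>\<^sup>+x. indicator (ball 0 r) (?W *v (x - z)) \<partial>lebesgue)
        = ennreal \<bar>det A\<bar> * (\<integral>\<^sup>+x. indicator (ball 0 r) (?W *v (z + A *v x - z)) \<partial>lebesgue)" for z
      by (rule nn_integral_affine_vec[OF A h])
    then have one: "(\<integral>\<^sup>+x. indicator (ball 0 r) (?W *v (x - z)) \<partial>lebesgue) = ennreal (v * \<bar>det A\<bar>)" for z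
      using v by (simp add: matrix_inv_vec[OF A] nn_integral_completion vol ennreal_mult' mult.commute)
    have "ennreal (v * \<bar>det A\<bar>) * (\<integral>\<^sup>+k. \<phi> (p k) \<partial>count_space UNIV)
        = (\<integral>\<^sup>+k. (\<integral>\<^sup>+x. \<phi> (p k) * indicator (ball 0 r) (?W *v (x - p k)) \<partial>lebesgue) \<partial>count_space UNIV)"
      by (simp add: nn_integral_cmult[OF h] one nn_integral_multc mult.commute)
    also have "\<dots> = (\<integral>\<^sup>+x. (\<integral>\<^sup>+k. \<phi> (p k) * indicator (ball 0 r) (?W *v (x - p k)) \<partial>count_space UNIV) \<partial>lebesgue)"
      by (intro nn_integral_count_space_nn_integral[symmetric] borel_measurable_times_ennreal h)
         (auto intro: countableI_type)
    also have "\<dots> \<le> (\<integral>\<^sup>+x. m x \<partial>lebesgue)"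
    proof (intro nn_integral_mono)
      fix x
      let ?g = "\<lambda>k. \<phi> (p k) * indicator (ball 0 r) (?W *v (x - p k))"
      have W_p: "?W *v (x - p k) = ?W *v (x - y) - P *v int_vec k" for k
      proof -
        have "?W *v (x - p k) = ?W *v ((x - y) - A *v (P *v int_vec k))" by (simp add: p_def algebra_simps)
        then show ?thesis by (simp add: matrix_vector_mult_diff_distrib matrix_inv_vec[OF A])
      qed
      \<comment> \<open>At most one k contributes at a given x: two of them would put points of P
        Z^d closer together than B.\<close>
      show "(\<integral>\<^sup>+k. ?g k \<partial>count_space UNIV) \<le> m x"
      proof (cases "\<exists>k. norm (?W *v (x - p k)) < r")
        case False
        then have zero: "?g k = 0" for k by (auto simp: indicator_def)
        have "(\<integral>\<^sup>+k. ?g k \<partial>count_space UNIV) = (\<Sum>k\<in>{}. ?g k)"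
          by (rule nn_integral_count_space') (use zero in auto)
        then show ?thesis by simp
      next
        case True
        then obtain k where k: "norm (?W *v (x - p k)) < r" by blast
        have "?g l = 0" if "l \<noteq> k" for l
        proof (rule ccontr)
          assume "?g l \<noteq> 0"
          then have l: "norm (?W *v (x - p l)) < r" by (auto simp: indicator_def split: if_splits)
          have "B * 1 \<le> B * norm (int_vec l - int_vec k)"
            using norm_int_vec_ge_1[OF that] B(1) by (intro mult_left_mono) auto
          also have "\<dots> \<le> norm (P *v (int_vec l - int_vec k))" by (rule B(2))
          also have "P *v (int_vec l - int_vec k) = ?W *v (x - p k) - ?W *v (x - p l)"
            unfolding W_p by (simp add: matrix_vector_mult_diff_distrib[of P])
          also have "norm \<dots> \<le> norm (?W *v (x - p k)) + norm (?W *v (x - p l))"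
            by (rule norm_triangle_ineq4)
          finally show False using k l r(3) by simp
        qed
        then have "(\<integral>\<^sup>+k. ?g k \<partial>count_space UNIV) = (\<Sum>k\<in>{k}. ?g k)"
          by (intro nn_integral_count_space') auto
        also have "\<dots> \<le> \<phi> (p k)" using k by simp
        also have "\<dots> \<le> m (p k + A *v (?W *v (x - p k)))"
          using k r(2) by (intro le) auto
        also have "p k + A *v (?W *v (x - p k)) = x" by (simp add: matrix_inv_vec[OF A])
        finally show ?thesis .
      qed
    qed
    finally show ?thesis unfolding p_def .
  qed
  show ?thesis by (rule that[OF v main])
qed

subsection \<open>From the discrete to the continuous frame\<close>

lemma qreg_measurable:
  assumes "invertible A" and "psi \<in> borel_measurable lebesgue"
  shows "qreg A g psi \<in> borel_measurable lebesgue"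
proof -
  let ?W = "mpow A (- snd g)"
  have "(\<lambda>t. - (?W *v fst g) + ?W *v t) \<in> lebesgue \<rightarrow>\<^sub>M lebesgue"
    by (rule lebesgue_affine_vec_measurable[OF invertible_mpow[OF assms(1)]])
  from measurable_compose[OF this assms(2)]
  have "(\<lambda>t. complex_of_real (\<bar>det A\<bar> powr (- real_of_int (snd g) / 2)) * psi (- (?W *v fst g) + ?W *v t)) \<in> borel_measurable lebesgue"
    by (intro borel_measurable_times borel_measurable_const)
  moreover have "qreg A g psi = (\<lambda>t. complex_of_real (\<bar>det A\<bar> powr (- real_of_int (snd g) / 2))
      * psi (- (?W *v fst g) + ?W *v t))"
    by (simp add: fun_eq_iff qreg_def mat_ipow_app_eq matrix_vector_mult_diff_distrib)
  ultimately show ?thesis by (simp only:)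
qed

lemma
  fixes f :: "real^'d \<Rightarrow> complex"
  assumes f: "f \<in> L2"
  shows L2_translate: "(\<lambda>t. f (y + t)) \<in> L2"
    and L2_norm_translate: "L2_norm (\<lambda>t. f (y + t)) = L2_norm f"
proof -
  have one: "invertible (mat 1 :: real^'d^'d)" by (simp add: invertible_det_nz)
  have [measurable]: "f \<in> borel_measurable lebesgue" using f by (simp add: L2_def)
  have T: "(\<lambda>t. f (y + t)) \<in> borel_measurable lebesgue"
    using measurable_compose[OF lebesgue_affine_vec_measurable[OF one, of y], of f borel] by simp
  have "integrable lebesgue (\<lambda>t. (cmod (f (y + t)))\<^sup>2)"
    using integrable_affine_vec[OF one, of "\<lambda>t. (cmod (f t))\<^sup>2" y] f by (simp add: L2_def)
  with T show "(\<lambda>t. f (y + t)) \<in> L2" by (simp add: L2_def)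
  show "L2_norm (\<lambda>t. f (y + t)) = L2_norm f"
    using integral_affine_vec[OF one, of "\<lambda>t. (cmod (f t))\<^sup>2" y] by (simp add: L2_norm_def)
qed

text \<open>Covariance of the voice transform: translating f by y is a left translation of the
  sampling point by (y, identity). It gives access to the frame inequality on every shifted sampling
  set.\<close>

lemma L2_inner_translate:
  fixes f :: "real^'d \<Rightarrow> complex"
  assumes A: "invertible A" and f: "f \<in> L2" and psi: "psi \<in> L2"
  shows "L2_inner (\<lambda>t. f (y + t)) (qreg A (p, j) psi) = L2_inner f (qreg A (y + p, j) psi)"
proof -
  have one: "invertible (mat 1 :: real^'d^'d)" by (simp add: invertible_det_nz)
  have [measurable]: "f \<in> borel_measurable lebesgue" using f by (simp add: L2_def)
  have [measurable]: "qreg A (y + p, j) psi \<in> borel_measurable lebesgue"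
    using psi by (intro qreg_measurable A) (simp add: L2_def)
  have "(\<lambda>t. f t * cnj (qreg A (y + p, j) psi t)) \<in> borel_measurable lebesgue" by measurable
  from integral_affine_vec[OF one this, of y] show ?thesis
    by (simp add: L2_inner_def qreg_def add.commute)
qed

theorem continuous_frame_bounds:
  fixes A P :: "real^'d^'d"
  assumes A: "invertible A" and P: "invertible P" and psi: "psi \<in> B_pi A" and f: "f \<in> L2"
    and C: "0 < C1" "C1 \<le> C2"
    and frame: "\<forall>f \<in> L2.
        ennreal (C1 * (L2_norm f)\<^sup>2)
          \<le> (\<integral>\<^sup>+ jk. ennreal ((cmod (L2_inner f
                 (qreg A (mat_ipow_app A (fst jk) (P *v (\<chi> i. real_of_int (snd jk $ i))), fst jk) psi)))\<^sup>2)
              \<partial>count_space (UNIV :: (int \<times> (int^'d)) set))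
        \<and> (\<integral>\<^sup>+ jk. ennreal ((cmod (L2_inner f
                 (qreg A (mat_ipow_app A (fst jk) (P *v (\<chi> i. real_of_int (snd jk $ i))), fst jk) psi)))\<^sup>2)
              \<partial>count_space (UNIV :: (int \<times> (int^'d)) set))
          \<le> ennreal (C2 * (L2_norm f)\<^sup>2)"
  shows "ennreal (C1 * \<bar>det P\<bar> * (L2_norm f)\<^sup>2)
          \<le> (\<integral>\<^sup>+ j. (\<integral>\<^sup>+ x. ennreal ((cmod (L2_inner f (qreg A (x, j) psi)))\<^sup>2
                 * \<bar>det A\<bar> powr (- real_of_int j)) \<partial>lebesgue) \<partial>count_space UNIV)
        \<and> (\<integral>\<^sup>+ j. (\<integral>\<^sup>+ x. ennreal ((cmod (L2_inner f (qreg A (x, j) psi)))\<^sup>2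
                 * \<bar>det A\<bar> powr (- real_of_int j)) \<partial>lebesgue) \<partial>count_space UNIV)
          \<le> ennreal (C2 * \<bar>det P\<bar> * (L2_norm f)\<^sup>2)"
proof -
  have psiL2: "psi \<in> L2" and W: "wiener_L2 A (voice A psi f)"
    using psi f by (auto simp: B_pi_def)
  define F where "F x j = voice A psi f (x, j)" for x j
  have F: "L2_inner f (qreg A (x, j) psi) = F x j" for x j
    by (simp add: F_def voice_def)
  define \<phi> where "\<phi> j x = ennreal ((cmod (F x j))\<^sup>2)" for j x
  define m where "m j x = (locmax A (voice A psi f) (x, j))\<^sup>2" for j x
  define w where "w j = (\<integral>\<^sup>+x. m j x \<partial>lebesgue) * ennreal (\<bar>det A\<bar> powr - real_of_int j)" for j
  define d where "d j = \<bar>det A\<bar> powr real_of_int j" for j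
  have detA: "\<bar>det A\<bar> > 0" and detP: "\<bar>det P\<bar> > 0"
    using A P by (simp_all add: invertible_det_nz)
  have d_pos: "d j > 0" and d_minus: "\<bar>det A\<bar> powr - real_of_int j = 1 / d j" for j
    using detA by (simp_all add: d_def powr_minus_divide)
  have [measurable]: "(\<lambda>x. F x j) \<in> borel_measurable lebesgue" for j
    using W by (simp add: wiener_L2_def F_def)
  have m_meas[measurable]: "m j \<in> borel_measurable lebesgue" for j
    using W unfolding wiener_L2_def m_def[abs_def] power2_eq_square
    by (intro borel_measurable_times_ennreal) blast+
  have \<phi>_meas[measurable]: "\<phi> j \<in> borel_measurable lebesgue" for j
    unfolding \<phi>_def[abs_def] by measurable
  \<comment> \<open>\<open>w j\<close> is the part at level j of the squared L2(G) norm of the local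
    maximal function; membership in \<open>B_pi\<close> says that the parts have a finite
    sum.\<close>
  have w_sum: "(\<integral>\<^sup>+j. w j \<partial>count_space UNIV) < \<infinity>"
  proof -
    have "w j = (\<integral>\<^sup>+x. (locmax A (voice A psi f) (x, j))\<^sup>2 * ennreal (\<bar>det A\<bar> powr (- real_of_int j)) \<partial>lebesgue)" for j
      unfolding w_def using nn_integral_multc[OF m_meas] by (simp add: m_def)
    then show ?thesis using W by (simp add: wiener_L2_def)
  qed
  \<comment> \<open>The unit ball is symmetric: p is reached from p + A^j q by the step - q, so the
    local maximal function at every such point dominates the value at p.\<close>
  have \<phi>_m: "\<phi> j p \<le> m j (p + mpow A j *v q)" if "norm q \<le> 1" for j p q
  proof -
    have "ennreal (cmod (voice A psi f (p, j))) \<le> locmax A (voice A psi f) (p + mpow A j *v q, j)"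
      unfolding locmax_def using that
      by (intro SUP_upper2[of "- q"]) (auto simp: mat_ipow_app_eq matrix_vector_mult_minus_right)
    from power_mono[OF this, of 2] show ?thesis
      by (simp add: \<phi>_def m_def F_def ennreal_power)
  qed
  have fin: "(\<integral>\<^sup>+x. \<phi> j x \<partial>lebesgue) < \<infinity>" for j
  proof -
    have "w j \<le> (\<integral>\<^sup>+j. w j \<partial>count_space UNIV)" by (rule nn_integral_ge_point) simp
    then have "w j < \<infinity>" using w_sum by simp
    moreover have "ennreal (1 / d j) \<noteq> 0" using d_pos[of j] by (simp add: ennreal_eq_0_iff not_le)
    ultimately have "(\<integral>\<^sup>+x. m j x \<partial>lebesgue) < \<infinity>"
      by (auto simp: w_def ennreal_mult_less_top d_minus)
    moreover have "\<phi> j x \<le> m j x" for x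
      using \<phi>_m[of 0 j x] by simp
    then have "(\<integral>\<^sup>+x. \<phi> j x \<partial>lebesgue) \<le> (\<integral>\<^sup>+x. m j x \<partial>lebesgue)"
      by (intro nn_integral_mono)
    ultimately show ?thesis by simp
  qed
  define M where "M j = mpow A j ** P" for j
  have M: "invertible (M j)" for j
    unfolding M_def by (intro invertible_mult invertible_mpow A P)
  have detM: "\<bar>det (M j)\<bar> = d j * \<bar>det P\<bar>" for j
    by (simp add: M_def det_mul abs_mult det_mpow[OF A] d_def)
  define N where "N = (L2_norm f)\<^sup>2"
  define S where "S y = (\<integral>\<^sup>+jk. \<phi> (fst jk) (y + M (fst jk) *v int_vec (snd jk)) \<partial>count_space UNIV)" for y
  \<comment> \<open>This is the frame inequality for the translate of f by y. Its norm is that of f,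
    so the bounds hold at every y with the same constants.\<close>
  have S: "ennreal (C1 * N) \<le> S y" "S y \<le> ennreal (C2 * N)" for y
    using bspec[OF frame L2_translate[OF f, of y]]
    unfolding L2_norm_translate[OF f] L2_inner_translate[OF A f psiL2] F mat_ipow_app_eq int_vec_def[symmetric]
      \<phi>_def[symmetric] N_def[symmetric]
    by (simp_all add: S_def M_def matrix_vector_mul_assoc)
  \<comment> \<open>Radius n + 1 instead of n: the ball of radius 0 is empty and cannot be averaged
    over.\<close>
  let ?B = "\<lambda>n. ball (0::real^'d) (real (Suc n))"
  let ?V = "\<lambda>n. emeasure lborel (?B n)"
  have V: "?V n \<noteq> 0" "?V n \<noteq> top" for n
    using content_ball_pos[of "real (Suc n)" "0::real^'d"] emeasure_bounded_finite[OF bounded_ball, of "0::real^'d" "real (Suc n)"]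
    by (auto simp: measure_def)
  have ind[measurable]: "indicator (?B n) \<in> borel_measurable lebesgue" for n
    by (intro borel_measurable_indicator sets_completionI_sets) simp
  define a where "a n j = (\<integral>\<^sup>+k. (\<integral>\<^sup>+y. \<phi> j (y + M j *v int_vec k) * indicator (?B n) y \<partial>lebesgue) \<partial>count_space UNIV) / ?V n" for n j
  have lim: "(\<lambda>n. a n j) \<longlonglongrightarrow> ennreal (1 / \<bar>det (M j)\<bar>) * (\<integral>\<^sup>+x. \<phi> j x \<partial>lebesgue)" for j
    unfolding a_def by (rule LIMSEQ_Suc[OF nn_integral_lattice_average[OF M \<phi>_meas fin]])
  have shift: "(\<lambda>y. \<phi> j (y + z)) \<in> borel_measurable lebesgue" for j z
  proof -
    have "(\<lambda>y. z + mat 1 *v y) \<in> lebesgue \<rightarrow>\<^sub>M (lebesgue :: (real^'d) measure)"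
      by (rule lebesgue_affine_vec_measurable) (simp add: invertible_det_nz)
    from measurable_compose[OF this \<phi>_meas] show ?thesis by (simp add: add.commute)
  qed
  have avg: "(\<integral>\<^sup>+j. a n j \<partial>count_space UNIV) = (\<integral>\<^sup>+y. S y * indicator (?B n) y \<partial>lebesgue) / ?V n" for n
  proof -
    have "(\<integral>\<^sup>+j. a n j \<partial>count_space UNIV)
      = (\<integral>\<^sup>+j. (\<integral>\<^sup>+k. (\<integral>\<^sup>+y. \<phi> j (y + M j *v int_vec k) * indicator (?B n) y \<partial>lebesgue) \<partial>count_space UNIV) \<partial>count_space UNIV) / ?V n"
      unfolding a_def by (simp add: nn_integral_divide)
    also have "(\<integral>\<^sup>+j. (\<integral>\<^sup>+k. (\<integral>\<^sup>+y. \<phi> j (y + M j *v int_vec k) * indicator (?B n) y \<partial>lebesgue) \<partial>count_space UNIV) \<partial>count_space UNIV)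
      = (\<integral>\<^sup>+jk. (\<integral>\<^sup>+y. \<phi> (fst jk) (y + M (fst jk) *v int_vec (snd jk)) * indicator (?B n) y \<partial>lebesgue) \<partial>count_space UNIV)"
      using nn_integral_fst_count_space[of "\<lambda>jk. \<integral>\<^sup>+y. \<phi> (fst jk) (y + M (fst jk) *v int_vec (snd jk)) * indicator (?B n) y \<partial>lebesgue"]
      by simp
    also have "\<dots> = (\<integral>\<^sup>+y. (\<integral>\<^sup>+jk. \<phi> (fst jk) (y + M (fst jk) *v int_vec (snd jk)) * indicator (?B n) y \<partial>count_space UNIV) \<partial>lebesgue)"
      by (intro nn_integral_count_space_nn_integral[symmetric] borel_measurable_times_ennreal shift ind)
         (auto intro: countableI_type)
    also have "\<dots> = (\<integral>\<^sup>+y. S y * indicator (?B n) y \<partial>lebesgue)"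
      unfolding S_def by (simp add: nn_integral_multc)
    finally show ?thesis .
  qed
  have const: "(\<integral>\<^sup>+y. c * indicator (?B n) y \<partial>lebesgue) / ?V n = c" for c n
    using V[of n] by (simp add: nn_integral_completion nn_integral_cmult_indicator ennreal_mult_divide_eq)
  have avg_bounds: "ennreal (C1 * N) \<le> (\<integral>\<^sup>+j. a n j \<partial>count_space UNIV)" "(\<integral>\<^sup>+j. a n j \<partial>count_space UNIV) \<le> ennreal (C2 * N)" for n
  proof -
    have "(\<integral>\<^sup>+y. ennreal (C1 * N) * indicator (?B n) y \<partial>lebesgue) / ?V n \<le> (\<integral>\<^sup>+y. S y * indicator (?B n) y \<partial>lebesgue) / ?V n"
      by (intro divide_right_mono_ennreal nn_integral_mono mult_right_mono S) simp
    then show "ennreal (C1 * N) \<le> (\<integral>\<^sup>+j. a n j \<partial>count_space UNIV)" unfolding const avg .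
    have "(\<integral>\<^sup>+y. S y * indicator (?B n) y \<partial>lebesgue) / ?V n \<le> (\<integral>\<^sup>+y. ennreal (C2 * N) * indicator (?B n) y \<partial>lebesgue) / ?V n"
      by (intro divide_right_mono_ennreal nn_integral_mono mult_right_mono S) simp
    then show "(\<integral>\<^sup>+j. a n j \<partial>count_space UNIV) \<le> ennreal (C2 * N)" unfolding const avg .
  qed
  obtain v where v: "v > 0"
    "\<And>A \<phi> m y. invertible A \<Longrightarrow> m \<in> borel_measurable lebesgue \<Longrightarrow>
       (\<And>p q. norm q \<le> 1 \<Longrightarrow> \<phi> p \<le> (m (p + A *v q) :: ennreal)) \<Longrightarrow>
       ennreal (v * \<bar>det A\<bar>) * (\<integral>\<^sup>+k. \<phi> (y + A *v (P *v int_vec k)) \<partial>count_space UNIV) \<le> (\<integral>\<^sup>+x. m x \<partial>lebesgue)"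
    using lattice_sum_le_nn_integral[OF P] by blast
  \<comment> \<open>Dividing by the ellipsoid volume \<open>v * d j\<close> produces the Haar weight
    1 / \<open>d j\<close> that \<open>w j\<close> contains. What remains is 1 / v, common to all
    levels, and the bound does not involve n.\<close>
  have a_le: "a n j \<le> ennreal (1 / v) * w j" for n j
  proof -
    have le: "(\<integral>\<^sup>+k. \<phi> j (y + M j *v int_vec k) \<partial>count_space UNIV) \<le> ennreal (1 / v) * w j" for y
    proof -
      let ?s = "\<integral>\<^sup>+k. \<phi> j (y + M j *v int_vec k) \<partial>count_space UNIV"
      have "ennreal (v * d j) * ?s \<le> (\<integral>\<^sup>+x. m j x \<partial>lebesgue)"
        using v(2)[OF invertible_mpow[OF A] m_meas \<phi>_m[where j = j], of y] by (simp add: M_def det_mpow[OF A] d_def matrix_vector_mul_assoc)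
      then have "ennreal (1 / (v * d j)) * (ennreal (v * d j) * ?s) \<le> ennreal (1 / (v * d j)) * (\<integral>\<^sup>+x. m j x \<partial>lebesgue)"
        by (rule mult_left_mono) simp
      moreover have "ennreal (1 / (v * d j)) * ennreal (v * d j) = 1"
        using v(1) d_pos[of j] by (simp add: ennreal_mult'[symmetric])
      moreover have "ennreal (1 / (v * d j)) = ennreal (1 / v) * ennreal (1 / d j)"
        using v(1) d_pos[of j] by (simp add: ennreal_mult'[symmetric])
      ultimately show ?thesis
        by (simp add: w_def d_minus mult.assoc[symmetric]) (simp add: mult_ac)
    qed
    have "a n j = (\<integral>\<^sup>+y. (\<integral>\<^sup>+k. \<phi> j (y + M j *v int_vec k) * indicator (?B n) y \<partial>count_space UNIV) \<partial>lebesgue) / ?V n"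
      unfolding a_def
      by (subst nn_integral_count_space_nn_integral)
        (rule countableI_type, intro borel_measurable_times_ennreal shift ind, rule refl)
    also have "\<dots> \<le> (\<integral>\<^sup>+y. ennreal (1 / v) * w j * indicator (?B n) y \<partial>lebesgue) / ?V n"
      by (intro divide_right_mono_ennreal nn_integral_mono) (simp add: nn_integral_multc mult_right_mono le)
    finally show ?thesis unfolding const .
  qed
  have conv: "(\<lambda>n. \<integral>\<^sup>+j. a n j \<partial>count_space UNIV) \<longlonglongrightarrow>
      (\<integral>\<^sup>+j. ennreal (1 / \<bar>det (M j)\<bar>) * (\<integral>\<^sup>+x. \<phi> j x \<partial>lebesgue) \<partial>count_space UNIV)"
  proof (rule nn_integral_dominated_convergence[where w = "\<lambda>j. ennreal (1 / v) * w j"])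
    show "(\<integral>\<^sup>+j. ennreal (1 / v) * w j \<partial>count_space UNIV) < \<infinity>"
      using w_sum by (simp add: nn_integral_cmult ennreal_mult_less_top)
    show "AE j in count_space UNIV. a n j \<le> ennreal (1 / v) * w j" for n
      by (intro AE_I2 a_le)
    show "AE j in count_space UNIV. (\<lambda>n. a n j) \<longlonglongrightarrow> ennreal (1 / \<bar>det (M j)\<bar>) * (\<integral>\<^sup>+x. \<phi> j x \<partial>lebesgue)"
      by (intro AE_I2 lim)
  qed simp_all
  have res: "ennreal (C1 * N) \<le> (\<integral>\<^sup>+j. ennreal (1 / \<bar>det (M j)\<bar>) * (\<integral>\<^sup>+x. \<phi> j x \<partial>lebesgue) \<partial>count_space UNIV)"
    "(\<integral>\<^sup>+j. ennreal (1 / \<bar>det (M j)\<bar>) * (\<integral>\<^sup>+x. \<phi> j x \<partial>lebesgue) \<partial>count_space UNIV) \<le> ennreal (C2 * N)"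
    by (rule LIMSEQ_le_const[OF conv], use avg_bounds in blast) (rule LIMSEQ_le_const2[OF conv], use avg_bounds in blast)
  \<comment> \<open>The covolume at level j is \<open>d j\<close> times |det P|: the first factor
    becomes the Haar weight, the second moves into the frame bounds.\<close>
  have "(\<integral>\<^sup>+ j. (\<integral>\<^sup>+ x. ennreal ((cmod (F x j))\<^sup>2 * \<bar>det A\<bar> powr (- real_of_int j)) \<partial>lebesgue) \<partial>count_space UNIV)
     = (\<integral>\<^sup>+j. ennreal \<bar>det P\<bar> * (ennreal (1 / \<bar>det (M j)\<bar>) * (\<integral>\<^sup>+x. \<phi> j x \<partial>lebesgue)) \<partial>count_space UNIV)"
  proof (rule nn_integral_cong)
    fix j
    have "ennreal \<bar>det P\<bar> * ennreal (1 / \<bar>det (M j)\<bar>) = ennreal (1 / d j)"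
      using detP d_pos[of j] by (simp add: detM ennreal_mult'[symmetric])
    moreover have "ennreal ((cmod (F x j))\<^sup>2 * \<bar>det A\<bar> powr (- real_of_int j)) = \<phi> j x * ennreal (1 / d j)" for x
      unfolding d_minus \<phi>_def by (rule ennreal_mult') simp
    ultimately show "(\<integral>\<^sup>+ x. ennreal ((cmod (F x j))\<^sup>2 * \<bar>det A\<bar> powr (- real_of_int j)) \<partial>lebesgue)
        = ennreal \<bar>det P\<bar> * (ennreal (1 / \<bar>det (M j)\<bar>) * (\<integral>\<^sup>+x. \<phi> j x \<partial>lebesgue))"
      by (simp only: nn_integral_multc[OF \<phi>_meas] mult.assoc[symmetric]) (rule mult.commute)
  qed
  also have "\<dots> = ennreal \<bar>det P\<bar> * (\<integral>\<^sup>+j. ennreal (1 / \<bar>det (M j)\<bar>) * (\<integral>\<^sup>+x. \<phi> j x \<partial>lebesgue) \<partial>count_space UNIV)"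
    by (simp add: nn_integral_cmult)
  finally have eq: "(\<integral>\<^sup>+ j. (\<integral>\<^sup>+ x. ennreal ((cmod (F x j))\<^sup>2 * \<bar>det A\<bar> powr (- real_of_int j)) \<partial>lebesgue) \<partial>count_space UNIV) = \<dots>" .
  have scale: "ennreal (C * \<bar>det P\<bar> * (L2_norm f)\<^sup>2) = ennreal \<bar>det P\<bar> * ennreal (C * N)" if "0 < C" for C
    by (simp add: N_def ennreal_mult'[symmetric] mult_ac)
  show ?thesis
    unfolding F eq scale[OF C(1)] scale[OF less_le_trans[OF C]]
    by (intro conjI mult_left_mono res) simp_all
qed

subsection \<open>The Fourier side\<close>

lemma lebesgue_borel_representative:
  fixes u :: "'a::euclidean_space \<Rightarrow> complex"
  assumes u: "u \<in> borel_measurable lebesgue"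
  obtains v where "v \<in> borel_measurable borel" "AE x in lebesgue. u x = v x"
proof -
  have "(\<lambda>x. Re (u x)) \<in> borel_measurable lebesgue" "(\<lambda>x. Im (u x)) \<in> borel_measurable lebesgue"
    using u by (auto intro: borel_measurable_Re borel_measurable_Im measurable_compose)
  from this[THEN completion_ex_borel_measurable_real]
  obtain a b where ab: "a \<in> borel_measurable lborel" "AE x in lborel. Re (u x) = a x"
      "b \<in> borel_measurable lborel" "AE x in lborel. Im (u x) = b x"
    by blast
  have [measurable]: "a \<in> borel_measurable borel" "b \<in> borel_measurable borel" using ab by simp_all
  show ?thesis
  proof (rule that)
    show "(\<lambda>x. Complex (a x) (b x)) \<in> borel_measurable borel"
      unfolding Complex_eq by measurable
    have "AE x in lborel. u x = Complex (a x) (b x)"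
      using ab(2,4) by eventually_elim (simp add: complex_eq_iff)
    then show "AE x in lebesgue. u x = Complex (a x) (b x)" by (simp add: AE_completion_iff)
  qed
qed

text \<open>\<open>L2\<close> and \<open>fourier_L2\<close> refer to Lebesgue measurable functions;
  this version lets the Borel results be applied to them through representatives.\<close>

definition lfint :: "('a::euclidean_space \<Rightarrow> complex) \<Rightarrow> 'a \<Rightarrow> complex" where
  "lfint u \<xi> = (\<integral>x. u x * cis (- 2 * pi * (x \<bullet> \<xi>)) \<partial>lebesgue)"

text \<open>A change of u on a null set alters no value of the integral, so the transforms agree at
  every point and not merely almost everywhere.\<close>

lemma lfint_eq_fint:
  fixes u v :: "'a::euclidean_space \<Rightarrow> complex"
  assumes u: "u \<in> borel_measurable lebesgue" and v: "v \<in> borel_measurable borel" and uv: "AE x in lebesgue. u x = v x"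
  shows "lfint u = fint v"
proof
  fix \<xi> :: 'a
  have c: "(\<lambda>x. cis (- 2 * pi * (x \<bullet> \<xi>))) \<in> borel_measurable (borel :: 'a measure)" by measurable
  have v': "(\<lambda>x. v x * cis (- 2 * pi * (x \<bullet> \<xi>))) \<in> borel_measurable lborel"
    using v c by (simp add: borel_measurable_times)
  have c': "(\<lambda>x. cis (- 2 * pi * (x \<bullet> \<xi>))) \<in> borel_measurable (lebesgue :: 'a measure)"
    using c by (intro measurable_completion) simp
  have "lfint u \<xi> = (\<integral>x. v x * cis (- 2 * pi * (x \<bullet> \<xi>)) \<partial>lebesgue)"
    unfolding lfint_def
  proof (rule integral_cong_AE)
    show "(\<lambda>x. u x * cis (- 2 * pi * (x \<bullet> \<xi>))) \<in> borel_measurable lebesgue"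
      by (rule borel_measurable_times[OF u c'])
    show "(\<lambda>x. v x * cis (- 2 * pi * (x \<bullet> \<xi>))) \<in> borel_measurable lebesgue"
      by (rule measurable_completion[OF v'])
    show "AE x in lebesgue. u x * cis (- 2 * pi * (x \<bullet> \<xi>)) = v x * cis (- 2 * pi * (x \<bullet> \<xi>))"
      using uv by eventually_elim simp
  qed
  also have "\<dots> = fint v \<xi>"
    unfolding fint_def by (rule integral_completion[OF v'])
  finally show "lfint u \<xi> = fint v \<xi>" .
qed

lemma integrable_lebesgue_cong:
  fixes f g :: "'a::euclidean_space \<Rightarrow> 'b::{banach, second_countable_topology}"
  assumes f: "f \<in> borel_measurable lebesgue" and g: "g \<in> borel_measurable borel" and fg: "AE x in lebesgue. f x = g x"
  shows "integrable lebesgue f \<longleftrightarrow> integrable lborel g"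
proof -
  have g': "g \<in> borel_measurable lborel" using g by simp
  have "integrable lebesgue f \<longleftrightarrow> integrable lebesgue g"
    by (rule integrable_cong_AE[OF f measurable_completion[OF g'] fg])
  then show ?thesis using integrable_completion[OF g'] by simp
qed

lemma lfint_measurable:
  assumes "u \<in> borel_measurable lebesgue"
  shows "lfint u \<in> borel_measurable lebesgue"
proof -
  obtain v where v: "v \<in> borel_measurable borel" "AE x in lebesgue. u x = v x"
    using lebesgue_borel_representative[OF assms] .
  have "fint v \<in> borel_measurable lborel" using fint_measurable[OF v(1)] by simp
  then show ?thesis
    unfolding lfint_eq_fint[OF assms v] by (rule measurable_completion)
qed

lemma plancherel_lebesgue:
  fixes u :: "'a::euclidean_space \<Rightarrow> complex"
  assumes u: "integrable lebesgue u" and u2: "integrable lebesgue (\<lambda>x. (cmod (u x))\<^sup>2)"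
  shows "(\<integral>\<^sup>+\<xi>. ennreal ((cmod (lfint u \<xi>))\<^sup>2) \<partial>lebesgue) = (\<integral>\<^sup>+x. ennreal ((cmod (u x))\<^sup>2) \<partial>lebesgue)"
proof -
  have um: "u \<in> borel_measurable lebesgue" using u by auto
  obtain v where v: "v \<in> borel_measurable borel" "AE x in lebesgue. u x = v x"
    using lebesgue_borel_representative[OF um] .
  have v1: "integrable lborel v" using integrable_lebesgue_cong[OF um v] u by simp
  have v2: "integrable lborel (\<lambda>x. (cmod (v x))\<^sup>2)"
  proof -
    have "(\<lambda>x. (cmod (v x))\<^sup>2) \<in> borel_measurable borel" using v(1) by measurable
    moreover have "AE x in lebesgue. (cmod (u x))\<^sup>2 = (cmod (v x))\<^sup>2" using v(2) by eventually_elim simp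
    ultimately show ?thesis using integrable_lebesgue_cong[OF borel_measurable_integrable[OF u2]] u2 by blast
  qed
  have "(\<integral>\<^sup>+\<xi>. ennreal ((cmod (lfint u \<xi>))\<^sup>2) \<partial>lebesgue) = (\<integral>\<^sup>+x. ennreal ((cmod (v x))\<^sup>2) \<partial>lborel)"
    unfolding nn_integral_completion lfint_eq_fint[OF um v] by (rule plancherel[OF v1 v2])
  also have "\<dots> = (\<integral>\<^sup>+x. ennreal ((cmod (u x))\<^sup>2) \<partial>lebesgue)"
    unfolding nn_integral_completion
    by (rule nn_integral_cong_AE) (use v(2) in \<open>auto simp: AE_completion_iff\<close>)
  finally show ?thesis .
qed

lemma lfint_mult:
  fixes u v :: "'a::euclidean_space \<Rightarrow> complex"
  assumes u: "integrable lebesgue u" and v: "integrable lebesgue v"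
  shows "(\<integral>\<xi>. lfint u \<xi> * v \<xi> \<partial>lebesgue) = (\<integral>x. u x * lfint v x \<partial>lebesgue)"
proof -
  have um: "u \<in> borel_measurable lebesgue" and vm: "v \<in> borel_measurable lebesgue" using u v by auto
  obtain u' where u': "u' \<in> borel_measurable borel" "AE x in lebesgue. u x = u' x"
    using lebesgue_borel_representative[OF um] .
  obtain v' where v': "v' \<in> borel_measurable borel" "AE x in lebesgue. v x = v' x"
    using lebesgue_borel_representative[OF vm] .
  have int: "integrable lborel u'" "integrable lborel v'"
    using integrable_lebesgue_cong[OF um u'] integrable_lebesgue_cong[OF vm v'] u v by simp_all
  have leb: "w \<in> borel_measurable lebesgue" if "w \<in> borel_measurable borel" for w :: "'a \<Rightarrow> complex"
    using that by (intro measurable_completion) simp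
  have F: "fint u' \<in> borel_measurable borel" "fint v' \<in> borel_measurable borel"
    using u' v' by (auto intro: fint_measurable)
  have "(\<integral>\<xi>. lfint u \<xi> * v \<xi> \<partial>lebesgue) = (\<integral>\<xi>. fint u' \<xi> * v' \<xi> \<partial>lebesgue)"
    unfolding lfint_eq_fint[OF um u']
  proof (rule integral_cong_AE)
    show "AE \<xi> in lebesgue. fint u' \<xi> * v \<xi> = fint u' \<xi> * v' \<xi>"
      using v'(2) by eventually_elim simp
  qed (intro borel_measurable_times leb F vm v')+
  also have "\<dots> = (\<integral>\<xi>. fint u' \<xi> * v' \<xi> \<partial>lborel)"
    by (rule integral_completion) (auto intro!: borel_measurable_times F v')
  also have "\<dots> = (\<integral>x. u' x * fint v' x \<partial>lborel)"
    by (rule fint_mult[OF int])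
  also have "\<dots> = (\<integral>x. u' x * fint v' x \<partial>lebesgue)"
    by (rule integral_completion[symmetric]) (auto intro!: borel_measurable_times F u')
  also have "\<dots> = (\<integral>x. u x * lfint v x \<partial>lebesgue)"
    unfolding lfint_eq_fint[OF vm v']
  proof (rule integral_cong_AE)
    show "AE x in lebesgue. u' x * fint v' x = u x * fint v' x"
      using u'(2) by eventually_elim simp
  qed (intro borel_measurable_times leb F um u')+
  finally show ?thesis .
qed

section \<open>The multiplication formula for the L2 transform\<close>

lemma integrable_mult_of_square_integrable:
  fixes f g :: "'a \<Rightarrow> complex"
  assumes [measurable]: "f \<in> borel_measurable M" "g \<in> borel_measurable M"
    and f: "integrable M (\<lambda>x. (cmod (f x))\<^sup>2)" and g: "integrable M (\<lambda>x. (cmod (g x))\<^sup>2)"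
  shows "integrable M (\<lambda>x. f x * g x)"
proof (rule Bochner_Integration.integrable_bound[OF Bochner_Integration.integrable_add[OF f g]])
  show "AE x in M. norm (f x * g x) \<le> norm ((cmod (f x))\<^sup>2 + (cmod (g x))\<^sup>2)"
  proof (intro AE_I2)
    fix x
    have "0 \<le> cmod (f x) * cmod (g x)" by simp
    then have "cmod (f x) * cmod (g x) \<le> (cmod (f x))\<^sup>2 + (cmod (g x))\<^sup>2"
      using sum_squares_bound[of "cmod (f x)" "cmod (g x)"] by linarith
    then show "norm (f x * g x) \<le> norm ((cmod (f x))\<^sup>2 + (cmod (g x))\<^sup>2)"
      by (simp add: norm_mult)
  qed
qed measurable

lemma integrable_square_of_nn_integral:
  fixes f :: "'a \<Rightarrow> complex"
  assumes "f \<in> borel_measurable M" "(\<integral>\<^sup>+x. ennreal ((cmod (f x))\<^sup>2) \<partial>M) < \<infinity>"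
  shows "integrable M (\<lambda>x. (cmod (f x))\<^sup>2)"
  using assms by (intro integrableI_bounded) auto

text \<open>For psi truncated to a ball this is \<open>lfint_mult\<close>. As the ball grows, the
  left side converges by dominated convergence, and the right side because the truncated transforms
  converge to g in L2 while k is a fixed square integrable function.\<close>

lemma lfint_mult_fourier_L2:
  fixes k psi g :: "real^'d \<Rightarrow> complex"
  assumes k: "integrable lebesgue k" and k2: "integrable lebesgue (\<lambda>x. (cmod (k x))\<^sup>2)"
    and psi: "psi \<in> L2" and g: "fourier_L2 psi g"
  shows "(\<integral>t. lfint k t * psi t \<partial>lebesgue) = (\<integral>\<xi>. k \<xi> * g \<xi> \<partial>lebesgue)"
proof -
  have km: "k \<in> borel_measurable lebesgue" using k by auto
  have psim: "psi \<in> borel_measurable lebesgue" and psi2: "integrable lebesgue (\<lambda>t. (cmod (psi t))\<^sup>2)"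
    using psi by (auto simp: L2_def)
  have gm: "g \<in> borel_measurable lebesgue" and g2: "integrable lebesgue (\<lambda>t. (cmod (g t))\<^sup>2)"
    using g by (auto simp: fourier_L2_def L2_def)
  have Km: "lfint k \<in> borel_measurable lebesgue" by (rule lfint_measurable[OF km])
  have K2: "integrable lebesgue (\<lambda>t. (cmod (lfint k t))\<^sup>2)"
    using plancherel_lebesgue[OF k k2] nn_integral_eq_integral[OF k2]
    by (intro integrable_square_of_nn_integral Km) simp
  have Kpsi: "integrable lebesgue (\<lambda>t. lfint k t * psi t)"
    by (rule integrable_mult_of_square_integrable[OF Km psim K2 psi2])
  have kg: "integrable lebesgue (\<lambda>t. k t * g t)"
    by (rule integrable_mult_of_square_integrable[OF km gm k2 g2])
  \<comment> \<open>These are the cutoffs of \<open>fourier_L2\<close>. Being square integrable,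
    they make each truncation of psi integrable.\<close>
  define b where "b n = (\<lambda>t :: real^'d. complex_of_real (indicator (ball 0 (real n)) t))" for n
  have bm: "b n \<in> borel_measurable lebesgue" for n
  proof -
    have "(indicator (ball 0 (real n)) :: real^'d \<Rightarrow> real) \<in> borel_measurable lebesgue"
      by (intro borel_measurable_indicator sets_completionI_sets) simp
    then show ?thesis unfolding b_def by measurable
  qed
  have b_int: "integrable lebesgue (b n)" and b2: "integrable lebesgue (\<lambda>t. (cmod (b n t))\<^sup>2)" for n
  proof -
    have "emeasure lebesgue (ball (0::real^'d) (real n)) < \<infinity>"
      using emeasure_bounded_finite[OF bounded_ball, of "0::real^'d" "real n"] by simp
    then have i: "integrable lebesgue (indicator (ball (0::real^'d) (real n)) :: _ \<Rightarrow> real)"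
      by (intro integrable_real_indicator) auto
    then show "integrable lebesgue (b n)" unfolding b_def by (rule integrable_of_real)
    have "(\<lambda>t. (cmod (b n t))\<^sup>2) = indicator (ball (0::real^'d) (real n))"
      by (auto simp: b_def indicator_def fun_eq_iff)
    then show "integrable lebesgue (\<lambda>t. (cmod (b n t))\<^sup>2)" using i by simp
  qed
  have pn: "integrable lebesgue (\<lambda>t. b n t * psi t)" for n
    by (rule integrable_mult_of_square_integrable[OF bm psim b2 psi2])
  have pn2: "integrable lebesgue (\<lambda>t. (cmod (b n t * psi t))\<^sup>2)" for n
  proof (rule Bochner_Integration.integrable_bound[OF psi2])
    show "(\<lambda>t. (cmod (b n t * psi t))\<^sup>2) \<in> borel_measurable lebesgue"
      using bm[of n] psim by measurable
  qed (simp add: b_def indicator_def)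
  have eq: "(\<integral>t. lfint k t * (b n t * psi t) \<partial>lebesgue) = (\<integral>\<xi>. k \<xi> * lfint (\<lambda>t. b n t * psi t) \<xi> \<partial>lebesgue)" for n
    by (rule lfint_mult[OF k pn])
  have lim1: "(\<lambda>n. \<integral>t. lfint k t * (b n t * psi t) \<partial>lebesgue) \<longlonglongrightarrow> (\<integral>t. lfint k t * psi t \<partial>lebesgue)"
  proof (rule integral_dominated_convergence[where w = "\<lambda>t. cmod (lfint k t * psi t)"])
    show "integrable lebesgue (\<lambda>t. cmod (lfint k t * psi t))" using Kpsi by (rule integrable_norm)
    show "AE t in lebesgue. (\<lambda>n. lfint k t * (b n t * psi t)) \<longlonglongrightarrow> lfint k t * psi t"
    proof (intro AE_I2 tendsto_eventually)
      fix t :: "real^'d"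
      obtain m where m: "norm t < real m" using reals_Archimedean2 by blast
      show "\<forall>\<^sub>F n in sequentially. lfint k t * (b n t * psi t) = lfint k t * psi t"
        using eventually_ge_at_top[of m] by eventually_elim (use m in \<open>auto simp: b_def\<close>)
    qed
    show "AE t in lebesgue. norm (lfint k t * (b n t * psi t)) \<le> cmod (lfint k t * psi t)" for n
      by (intro AE_I2) (simp add: b_def indicator_def)
  qed (use Kpsi in \<open>auto intro!: borel_measurable_times Km bm psim\<close>)
  define h where "h n \<xi> = g \<xi> - lfint (\<lambda>t. b n t * psi t) \<xi>" for n \<xi>
  have hm: "h n \<in> borel_measurable lebesgue" for n
    unfolding h_def using lfint_measurable[of "\<lambda>t. b n t * psi t"] pn[of n]
    by (intro borel_measurable_diff gm) auto
  have h0: "(\<lambda>n. \<integral>\<^sup>+\<xi>. ennreal ((cmod (h n \<xi>))\<^sup>2) \<partial>lebesgue) \<longlonglongrightarrow> 0"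
  proof -
    have "integral\<^sup>L lebesgue (\<lambda>x. indicator (ball 0 (real n)) x *\<^sub>R (psi x * cis (- 2 * pi * (x \<bullet> \<xi>)))) = lfint (\<lambda>t. b n t * psi t) \<xi>" for n \<xi>
      unfolding lfint_def by (simp add: b_def scaleR_conv_of_real mult.assoc)
    then show ?thesis using g unfolding fourier_L2_def h_def by simp
  qed
  let ?k2 = "\<integral>\<^sup>+x. ennreal ((cmod (k x))\<^sup>2) \<partial>lebesgue"
  have "?k2 < top" using nn_integral_eq_integral[OF k2] by simp
  \<comment> \<open>Cauchy-Schwarz against k turns L2 convergence of the transforms into convergence
    of the pairings. It is used in squared form, which is why a square root is taken
    afterwards.\<close>
  have sq0: "(\<lambda>n. (\<integral>\<^sup>+x. ennreal (cmod (k x * h n x)) \<partial>lebesgue)\<^sup>2) \<longlonglongrightarrow> 0"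
  proof (rule tendsto_sandwich[OF _ _ tendsto_const])
    show "\<forall>\<^sub>F n in sequentially. 0 \<le> (\<integral>\<^sup>+x. ennreal (cmod (k x * h n x)) \<partial>lebesgue)\<^sup>2" by simp
    show "\<forall>\<^sub>F n in sequentially. (\<integral>\<^sup>+x. ennreal (cmod (k x * h n x)) \<partial>lebesgue)\<^sup>2
        \<le> ?k2 * (\<integral>\<^sup>+\<xi>. ennreal ((cmod (h n \<xi>))\<^sup>2) \<partial>lebesgue)"
    proof (intro always_eventually allI)
      fix n
      show "(\<integral>\<^sup>+x. ennreal (cmod (k x * h n x)) \<partial>lebesgue)\<^sup>2
        \<le> ?k2 * (\<integral>\<^sup>+\<xi>. ennreal ((cmod (h n \<xi>))\<^sup>2) \<partial>lebesgue)"
        using Cauchy_Schwarz_nn_integral[of "\<lambda>x. ennreal (cmod (k x))" lebesgue "\<lambda>x. ennreal (cmod (h n x))"] km hm[of n]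
        by (simp add: norm_mult ennreal_mult' ennreal_power)
    qed
    show "(\<lambda>n. ?k2 * (\<integral>\<^sup>+\<xi>. ennreal ((cmod (h n \<xi>))\<^sup>2) \<partial>lebesgue)) \<longlonglongrightarrow> 0"
      using ennreal_tendsto_cmult[OF \<open>?k2 < top\<close> h0] by simp
  qed
  have lim2: "(\<lambda>n. \<integral>\<xi>. k \<xi> * lfint (\<lambda>t. b n t * psi t) \<xi> \<partial>lebesgue) \<longlonglongrightarrow> (\<integral>\<xi>. k \<xi> * g \<xi> \<partial>lebesgue)"
  proof -
    let ?L = "\<lambda>n. lfint (\<lambda>t. b n t * psi t)"
    have Lm: "?L n \<in> borel_measurable lebesgue" for n
      using pn[of n] by (intro lfint_measurable) auto
    have L2: "integrable lebesgue (\<lambda>t. (cmod (?L n t))\<^sup>2)" for n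
      using plancherel_lebesgue[OF pn pn2, of n] nn_integral_eq_integral[OF pn2, of n]
      by (intro integrable_square_of_nn_integral Lm) simp
    have kL: "integrable lebesgue (\<lambda>\<xi>. k \<xi> * ?L n \<xi>)" for n
      by (rule integrable_mult_of_square_integrable[OF km Lm k2 L2])
    have diff: "k \<xi> * h n \<xi> = k \<xi> * g \<xi> - k \<xi> * ?L n \<xi>" for n \<xi>
      by (simp add: h_def algebra_simps)
    have kh: "integrable lebesgue (\<lambda>\<xi>. k \<xi> * h n \<xi>)" for n
      unfolding diff by (intro Bochner_Integration.integrable_diff kg kL)
    have "(\<lambda>n. ennreal ((cmod (\<integral>\<xi>. k \<xi> * h n \<xi> \<partial>lebesgue))\<^sup>2)) \<longlonglongrightarrow> 0"
    proof (rule tendsto_sandwich[OF _ _ tendsto_const sq0])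
      show "\<forall>\<^sub>F n in sequentially. ennreal ((cmod (\<integral>\<xi>. k \<xi> * h n \<xi> \<partial>lebesgue))\<^sup>2)
          \<le> (\<integral>\<^sup>+x. ennreal (cmod (k x * h n x)) \<partial>lebesgue)\<^sup>2"
      proof (intro always_eventually allI)
        fix n
        show "ennreal ((cmod (\<integral>\<xi>. k \<xi> * h n \<xi> \<partial>lebesgue))\<^sup>2) \<le> (\<integral>\<^sup>+x. ennreal (cmod (k x * h n x)) \<partial>lebesgue)\<^sup>2"
          using power_mono[OF integral_norm_bound_ennreal[OF kh[of n]], of 2] by (simp add: ennreal_power)
      qed
    qed simp
    then have "(\<lambda>n. (cmod (\<integral>\<xi>. k \<xi> * h n \<xi> \<partial>lebesgue))\<^sup>2) \<longlonglongrightarrow> 0"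
      by (simp add: ennreal_tendsto_0_iff)
    from tendsto_real_sqrt[OF this] have "(\<lambda>n. \<integral>\<xi>. k \<xi> * h n \<xi> \<partial>lebesgue) \<longlonglongrightarrow> 0"
      by (simp add: tendsto_norm_zero_iff)
    moreover have "(\<integral>\<xi>. k \<xi> * h n \<xi> \<partial>lebesgue) = (\<integral>\<xi>. k \<xi> * g \<xi> \<partial>lebesgue) - (\<integral>\<xi>. k \<xi> * ?L n \<xi> \<partial>lebesgue)" for n
      unfolding diff by (rule Bochner_Integration.integral_diff[OF kg kL])
    ultimately have "(\<lambda>n. (\<integral>\<xi>. k \<xi> * g \<xi> \<partial>lebesgue) - (\<integral>\<xi>. k \<xi> * ?L n \<xi> \<partial>lebesgue)) \<longlonglongrightarrow> 0"
      by simp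
    from tendsto_diff[OF tendsto_const this, of "\<integral>\<xi>. k \<xi> * g \<xi> \<partial>lebesgue"] show ?thesis by simp
  qed
  show ?thesis
    using LIMSEQ_unique[OF lim1[unfolded eq] lim2] .
qed

text \<open>Test with the set where the claim fails, cut down to a ball. There the integral of b is
  finite and may be cancelled, so a - b has integral 0 on a set where it is positive. Bounding b
  only where b < a lets the lemma serve both inequalities, with the constant on either side.\<close>

lemma AE_le_of_set_nn_integral_le:
  fixes a b :: "'a::euclidean_space \<Rightarrow> ennreal"
  assumes [measurable]: "a \<in> borel_measurable lebesgue" "b \<in> borel_measurable lebesgue"
    and le: "\<And>E. E \<in> sets lebesgue \<Longrightarrow> emeasure lebesgue E < \<infinity> \<Longrightarrow>
      (\<integral>\<^sup>+x. a x * indicator E x \<partial>lebesgue) \<le> (\<integral>\<^sup>+x. b x * indicator E x \<partial>lebesgue)"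
    and c: "c < \<infinity>" "\<And>x. b x < a x \<Longrightarrow> b x \<le> c"
  shows "AE x in lebesgue. a x \<le> b x"
proof -
  have "AE x in lebesgue. \<not> (b x < a x \<and> x \<in> ball 0 (real n))" for n
  proof -
    let ?E = "{x. b x < a x} \<inter> ball 0 (real n)"
    have "{x \<in> space lebesgue. b x < a x} \<in> sets lebesgue" by measurable
    then have E[measurable]: "?E \<in> sets lebesgue" by (intro sets.Int) auto
    have "emeasure lebesgue ?E \<le> emeasure lebesgue (ball (0::'a) (real n))"
      by (rule emeasure_mono) auto
    also have "\<dots> < \<infinity>"
      using emeasure_bounded_finite[OF bounded_ball, of "0::'a" "real n"] by simp
    finally have fin: "emeasure lebesgue ?E < \<infinity>" .
    have "(\<integral>\<^sup>+x. b x * indicator ?E x \<partial>lebesgue) \<le> (\<integral>\<^sup>+x. c * indicator ?E x \<partial>lebesgue)"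
      by (intro nn_integral_mono) (auto simp: indicator_def c(2))
    also have "\<dots> = c * emeasure lebesgue ?E" by (simp add: nn_integral_cmult_indicator)
    also have "\<dots> < \<infinity>" using fin c(1) by (simp add: ennreal_mult_less_top)
    finally have finb: "(\<integral>\<^sup>+x. b x * indicator ?E x \<partial>lebesgue) < \<infinity>" .
    have "(\<integral>\<^sup>+x. (a x - b x) * indicator ?E x \<partial>lebesgue) + (\<integral>\<^sup>+x. b x * indicator ?E x \<partial>lebesgue)
        = (\<integral>\<^sup>+x. (a x - b x) * indicator ?E x + b x * indicator ?E x \<partial>lebesgue)"
      by (rule nn_integral_add[symmetric]) measurable
    also have "\<dots> = (\<integral>\<^sup>+x. a x * indicator ?E x \<partial>lebesgue)"
      by (intro nn_integral_cong) (auto simp: indicator_def diff_add_cancel_ennreal less_imp_le)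
    also have "\<dots> \<le> (\<integral>\<^sup>+x. b x * indicator ?E x \<partial>lebesgue)"
      by (rule le[OF E fin])
    finally have "(\<integral>\<^sup>+x. (a x - b x) * indicator ?E x \<partial>lebesgue) = 0"
      using finb by (cases "\<integral>\<^sup>+x. (a x - b x) * indicator ?E x \<partial>lebesgue"; cases "\<integral>\<^sup>+x. b x * indicator ?E x \<partial>lebesgue")
        (auto simp: ennreal_plus[symmetric] top_unique simp del: ennreal_plus)
    then have "AE x in lebesgue. (a x - b x) * indicator ?E x = 0"
      by (subst (asm) nn_integral_0_iff_AE) measurable
    then show ?thesis
    proof eventually_elim
      fix x assume x: "(a x - b x) * indicator ?E x = 0"
      show "\<not> (b x < a x \<and> x \<in> ball 0 (real n))"
      proof
        assume "b x < a x \<and> x \<in> ball 0 (real n)"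
        moreover from this have "a x - b x \<noteq> 0"
          by (metis diff_add_cancel_ennreal add_0 less_imp_le less_irrefl)
        ultimately show False using x by (simp add: indicator_def)
      qed
    qed
  qed
  then have "AE x in lebesgue. \<forall>n. \<not> (b x < a x \<and> x \<in> ball 0 (real n))"
    unfolding AE_all_countable by (rule allI)
  then show ?thesis
  proof eventually_elim
    fix x :: 'a assume x: "\<forall>n. \<not> (b x < a x \<and> x \<in> ball 0 (real n))"
    obtain n where "norm x < real n" using reals_Archimedean2 by blast
    with spec[OF x, of n] show "a x \<le> b x" by (auto simp: not_less)
  qed
qed

section \<open>Test functions whose transform is an indicator\<close>

lemma integrable_indicator_complex:
  assumes "E \<in> sets M" "emeasure M E < \<infinity>"
  shows "integrable M (indicator E :: 'a \<Rightarrow> complex)"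
proof -
  have "(indicator E :: 'a \<Rightarrow> complex) = (\<lambda>x. complex_of_real (indicator E x))"
    by (auto simp: indicator_def)
  then show ?thesis
    using integrable_of_real[OF integrable_real_indicator[OF assms]] by simp
qed

text \<open>As the indicator is real, the conjugate of its transform is its inverse transform. The
  conjugate also makes the inner product with \<open>qreg A (x, j) psi\<close> the conjugate of a
  bilinear pairing, to which the multiplication formula applies. As a function of x, the voice
  transform is then, up to conjugation and a constant, the transform of the indicator of E times
  \<xi> \<mapsto> g((A^t)^j \<xi>), and Plancherel in x finishes.\<close>

lemma voice_nn_integral_eq:
  fixes A :: "real^'d^'d" and psi g :: "real^'d \<Rightarrow> complex" and E :: "(real^'d) set" and j :: int
  assumes A: "invertible A" and psi: "psi \<in> L2" and g: "fourier_L2 psi g"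
    and E: "E \<in> sets lebesgue" "emeasure lebesgue E < \<infinity>"
  shows "(\<integral>\<^sup>+x. ennreal ((cmod (L2_inner (\<lambda>t. cnj (lfint (indicator E) t)) (qreg A (x, j) psi)))\<^sup>2
             * \<bar>det A\<bar> powr (- real_of_int j)) \<partial>lebesgue)
       = (\<integral>\<^sup>+\<xi>. ennreal ((cmod (g (mat_ipow_app (transpose A) j \<xi>)))\<^sup>2) * indicator E \<xi> \<partial>lebesgue)"
proof -
  define e where "e = (indicator E :: real^'d \<Rightarrow> complex)"
  define T where "T = mpow (transpose A) j"
  define B where "B = mpow (transpose A) (- j)"
  define d where "d = \<bar>det A\<bar> powr real_of_int j"
  have tA: "invertible (transpose A)" using A by (simp add: invertible_det_nz)
  have T: "invertible T" and B: "invertible B" and Aj: "invertible (mpow A j)"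
    unfolding T_def B_def using A tA by (auto intro: invertible_mpow)
  have d0: "d > 0" using A by (simp add: d_def invertible_det_nz)
  have detT: "\<bar>det T\<bar> = d" and detA: "\<bar>det (mpow A j)\<bar> = d" and detB: "\<bar>det B\<bar> = 1 / d"
    unfolding T_def B_def using det_mpow[OF A, of j] det_mpow[OF tA, of j] det_mpow[OF tA, of "- j"]
    by (simp_all add: d_def powr_minus_divide)
  have TB: "T *v (B *v \<eta>) = \<eta>" and BT: "B *v (T *v \<eta>) = \<eta>" for \<eta>
    unfolding T_def B_def using mpow_minus[OF tA] by simp_all
  \<comment> \<open>B is the inverse of the transpose of A^j, so it cancels A^j across the inner
    product.\<close>
  have inner: "(B *v \<eta>) \<bullet> (mpow A j *v s) = \<eta> \<bullet> s" for \<eta> s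
    using transpose_mpow[OF A, of s j "B *v \<eta>"] TB[of \<eta>] by (simp add: T_def inner_commute)
  have em: "e \<in> borel_measurable lebesgue" using E by (simp add: e_def)
  have e_int: "integrable lebesgue e"
    unfolding e_def by (rule integrable_indicator_complex[OF E])
  have e_sq: "(cmod (e x))\<^sup>2 = cmod (e x)" for x by (simp add: e_def indicator_def)
  have e2: "integrable lebesgue (\<lambda>x. (cmod (e x))\<^sup>2)"
    unfolding e_sq by (rule integrable_norm[OF e_int])
  have Em: "lfint e \<in> borel_measurable lebesgue" by (rule lfint_measurable[OF em])
  have psim: "psi \<in> borel_measurable lebesgue" using psi by (simp add: L2_def)
  have gm: "g \<in> borel_measurable lebesgue" and g2: "integrable lebesgue (\<lambda>t. (cmod (g t))\<^sup>2)"
    using g by (auto simp: fourier_L2_def L2_def)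
  have cm: "(\<lambda>\<xi>. cis (r * (\<xi> \<bullet> x))) \<in> borel_measurable lebesgue" for r and x :: "real^'d"
    by (rule measurable_completion) measurable
  have comp: "(\<lambda>x. f (y + W *v x)) \<in> borel_measurable lebesgue"
    if "f \<in> borel_measurable lebesgue" "invertible W" for f :: "real^'d \<Rightarrow> complex" and y and W :: "real^'d^'d"
    by (rule measurable_compose[OF lebesgue_affine_vec_measurable[OF that(2)] that(1)])
  define u where "u \<xi> = e \<xi> * g (T *v \<xi>)" for \<xi>
  have gTm: "(\<lambda>\<xi>. g (T *v \<xi>)) \<in> borel_measurable lebesgue"
    using comp[OF gm T, of 0] by simp
  have gT2: "integrable lebesgue (\<lambda>\<xi>. (cmod (g (T *v \<xi>)))\<^sup>2)"
    using integrable_affine_vec[OF T borel_measurable_integrable[OF g2], of 0] g2 by simp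
  have u: "integrable lebesgue u"
    unfolding u_def by (rule integrable_mult_of_square_integrable[OF em gTm e2 gT2])
  have u2: "integrable lebesgue (\<lambda>\<xi>. (cmod (u \<xi>))\<^sup>2)"
  proof (rule Bochner_Integration.integrable_bound[OF gT2])
    have "u \<in> borel_measurable lebesgue" using u by auto
    then show "(\<lambda>\<xi>. (cmod (u \<xi>))\<^sup>2) \<in> borel_measurable lebesgue" by measurable
  qed (simp add: u_def e_def indicator_def)
  \<comment> \<open>\<open>k x\<close> is the function whose transform is s \<mapsto>
    \<open>lfint e (x + mpow A j *v s)\<close>, found by substituting \<xi> = B \<eta>; the factor 1
    / d is |det B|, and the shift by x appears as a modulation.\<close>
  define k where "k x \<eta> = complex_of_real (1 / d) * (e (B *v \<eta>) * cis (- 2 * pi * ((B *v \<eta>) \<bullet> x)))" for x \<eta>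
  have eBm: "(\<lambda>\<eta>. e (B *v \<eta>)) \<in> borel_measurable lebesgue"
    using comp[OF em B, of 0] by simp
  have eB: "integrable lebesgue (\<lambda>\<eta>. e (B *v \<eta>))"
    using integrable_affine_vec[OF B em, of 0] e_int by simp
  have cB: "(\<lambda>\<eta>. cis (- 2 * pi * ((B *v \<eta>) \<bullet> x))) \<in> borel_measurable lebesgue" for x
    using comp[OF cm[of "- 2 * pi" x] B, of 0] by simp
  have k: "integrable lebesgue (k x)" for x
    unfolding k_def by (intro integrable_mult_right integrable_mult_unimodular eB cB) simp
  have k2: "integrable lebesgue (\<lambda>\<eta>. (cmod (k x \<eta>))\<^sup>2)" for x
  proof -
    have "(cmod (k x \<eta>))\<^sup>2 = (1 / d)\<^sup>2 * cmod (e (B *v \<eta>))" for \<eta>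
      by (simp add: k_def norm_mult norm_divide power_mult_distrib power_divide e_sq)
    then show ?thesis using integrable_norm[OF eB] by simp
  qed
  have shift: "lfint e (x + mpow A j *v s) = lfint (k x) s" for x s
  proof -
    have m: "(\<lambda>\<xi>. e \<xi> * cis (- 2 * pi * (\<xi> \<bullet> (x + mpow A j *v s)))) \<in> borel_measurable lebesgue"
      by (intro borel_measurable_times em cm)
    have "lfint e (x + mpow A j *v s)
        = \<bar>det B\<bar> *\<^sub>R (\<integral>\<eta>. e (0 + B *v \<eta>) * cis (- 2 * pi * ((0 + B *v \<eta>) \<bullet> (x + mpow A j *v s))) \<partial>lebesgue)"
      unfolding lfint_def by (rule integral_affine_vec[OF B m])
    also have "\<dots> = (\<integral>\<eta>. k x \<eta> * cis (- 2 * pi * (\<eta> \<bullet> s)) \<partial>lebesgue)"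
      unfolding integral_scaleR_right[symmetric]
    proof (intro Bochner_Integration.integral_cong refl)
      fix \<eta>
      have "cis (- 2 * pi * ((0 + B *v \<eta>) \<bullet> (x + mpow A j *v s)))
          = cis (- 2 * pi * ((B *v \<eta>) \<bullet> x)) * cis (- 2 * pi * (\<eta> \<bullet> s))"
        by (simp add: cis_mult inner_add_right inner algebra_simps)
      then show "\<bar>det B\<bar> *\<^sub>R (e (0 + B *v \<eta>) * cis (- 2 * pi * ((0 + B *v \<eta>) \<bullet> (x + mpow A j *v s))))
          = k x \<eta> * cis (- 2 * pi * (\<eta> \<bullet> s))"
        by (simp add: k_def detB scaleR_conv_of_real)
    qed
    finally show ?thesis by (simp add: lfint_def)
  qed
  define c where "c = complex_of_real (\<bar>det A\<bar> powr (- real_of_int j / 2))"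
  have c2: "(cmod c)\<^sup>2 = 1 / d"
    by (simp add: c_def d_def power2_eq_square powr_add[symmetric] powr_minus_divide[symmetric])
  have voice: "L2_inner (\<lambda>t. cnj (lfint e t)) (qreg A (x, j) psi) = cnj (c * (complex_of_real d * lfint u x))" for x
  proof -
    let ?q = "\<lambda>t. psi (mpow A (- j) *v (t - x))"
    have qm: "?q \<in> borel_measurable lebesgue"
    proof -
      have "(\<lambda>t. psi (- (mpow A (- j) *v x) + mpow A (- j) *v t)) \<in> borel_measurable lebesgue"
        by (intro comp psim invertible_mpow A)
      then show ?thesis by (simp add: matrix_vector_mult_diff_distrib)
    qed
    have "L2_inner (\<lambda>t. cnj (lfint e t)) (qreg A (x, j) psi) = (\<integral>t. cnj (c * (lfint e t * ?q t)) \<partial>lebesgue)"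
      by (simp add: L2_inner_def qreg_def mat_ipow_app_eq c_def mult_ac)
    also have "\<dots> = cnj (c * (\<integral>t. lfint e t * ?q t \<partial>lebesgue))"
      by (simp only: Bochner_Integration.integral_cnj integral_mult_right_zero)
    also have "(\<integral>t. lfint e t * ?q t \<partial>lebesgue)
        = \<bar>det (mpow A j)\<bar> *\<^sub>R (\<integral>s. lfint e (x + mpow A j *v s) * ?q (x + mpow A j *v s) \<partial>lebesgue)"
      by (rule integral_affine_vec[OF Aj]) (intro borel_measurable_times Em qm)
    also have "\<dots> = complex_of_real d * (\<integral>s. lfint (k x) s * psi s \<partial>lebesgue)"
      by (simp add: detA shift mpow_minus[OF A] scaleR_conv_of_real)
    also have "(\<integral>s. lfint (k x) s * psi s \<partial>lebesgue) = (\<integral>\<eta>. k x \<eta> * g \<eta> \<partial>lebesgue)"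
      by (rule lfint_mult_fourier_L2[OF k k2 psi g])
    \<comment> \<open>Substituting \<eta> = T \<xi> undoes B, so that the indicator of E reappears
      undilated and the dilation falls on g alone; |det T| = d cancels the 1 / d in
      \<open>k\<close>.\<close>
    also have "\<dots> = \<bar>det T\<bar> *\<^sub>R (\<integral>\<xi>. k x (0 + T *v \<xi>) * g (0 + T *v \<xi>) \<partial>lebesgue)"
      by (rule integral_affine_vec[OF T]) (intro borel_measurable_times gm borel_measurable_integrable[OF k])
    also have "\<dots> = lfint u x"
      unfolding lfint_def integral_scaleR_right[symmetric]
      by (intro Bochner_Integration.integral_cong refl)
         (use d0 in \<open>simp add: k_def u_def BT detT scaleR_conv_of_real mult_ac\<close>)
    finally show ?thesis .
  qed
  \<comment> \<open>The normalisation gives |c|^2 = 1 / d, the substitution in t gives d^2, and the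
    Haar weight gives 1 / d: together exactly 1.\<close>
  have "(cmod (L2_inner (\<lambda>t. cnj (lfint e t)) (qreg A (x, j) psi)))\<^sup>2 * \<bar>det A\<bar> powr (- real_of_int j)
      = (cmod (lfint u x))\<^sup>2" for x
  proof -
    have "(cmod (L2_inner (\<lambda>t. cnj (lfint e t)) (qreg A (x, j) psi)))\<^sup>2 = (cmod c)\<^sup>2 * d\<^sup>2 * (cmod (lfint u x))\<^sup>2"
      unfolding voice by (simp add: norm_mult power_mult_distrib)
    moreover have "\<bar>det A\<bar> powr (- real_of_int j) = 1 / d" by (simp add: d_def powr_minus_divide)
    ultimately show ?thesis using d0 by (simp only: c2) (simp add: power2_eq_square)
  qed
  then have "(\<integral>\<^sup>+x. ennreal ((cmod (L2_inner (\<lambda>t. cnj (lfint e t)) (qreg A (x, j) psi)))\<^sup>2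
             * \<bar>det A\<bar> powr (- real_of_int j)) \<partial>lebesgue) = (\<integral>\<^sup>+x. ennreal ((cmod (lfint u x))\<^sup>2) \<partial>lebesgue)"
    by simp
  also have "\<dots> = (\<integral>\<^sup>+\<xi>. ennreal ((cmod (u \<xi>))\<^sup>2) \<partial>lebesgue)"
    by (rule plancherel_lebesgue[OF u u2])
  also have "\<dots> = (\<integral>\<^sup>+\<xi>. ennreal ((cmod (g (mat_ipow_app (transpose A) j \<xi>)))\<^sup>2) * indicator E \<xi> \<partial>lebesgue)"
    by (intro nn_integral_cong) (auto simp: u_def e_def T_def mat_ipow_app_eq indicator_def)
  finally show ?thesis unfolding e_def .
qed

text \<open>The test functions turn the frame inequality into K1 |E| and K2 |E| as bounds for the
  integral of the Calderon sum over every E of finite measure. Since E is arbitrary, the bounds pass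
  to the integrand almost everywhere.\<close>

theorem calderon_bounds:
  fixes A :: "real^'d^'d" and psi g :: "real^'d \<Rightarrow> complex" and K1 K2 :: real
  assumes A: "invertible A" and psi: "psi \<in> L2" and g: "fourier_L2 psi g" and K: "0 \<le> K1" "0 \<le> K2"
    and frame: "\<And>f. f \<in> L2 \<Longrightarrow>
        ennreal (K1 * (L2_norm f)\<^sup>2)
          \<le> (\<integral>\<^sup>+ j. (\<integral>\<^sup>+ x. ennreal ((cmod (L2_inner f (qreg A (x, j) psi)))\<^sup>2
                 * \<bar>det A\<bar> powr (- real_of_int j)) \<partial>lebesgue) \<partial>count_space UNIV)
        \<and> (\<integral>\<^sup>+ j. (\<integral>\<^sup>+ x. ennreal ((cmod (L2_inner f (qreg A (x, j) psi)))\<^sup>2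
                 * \<bar>det A\<bar> powr (- real_of_int j)) \<partial>lebesgue) \<partial>count_space UNIV)
          \<le> ennreal (K2 * (L2_norm f)\<^sup>2)"
  shows "AE \<xi> in lebesgue. ennreal K1 \<le> (\<integral>\<^sup>+ j. ennreal ((cmod (g (mat_ipow_app (transpose A) j \<xi>)))\<^sup>2) \<partial>count_space UNIV)"
    and "AE \<xi> in lebesgue. (\<integral>\<^sup>+ j. ennreal ((cmod (g (mat_ipow_app (transpose A) j \<xi>)))\<^sup>2) \<partial>count_space UNIV) \<le> ennreal K2"
proof -
  define \<Psi> where "\<Psi> \<xi> = (\<integral>\<^sup>+ j. ennreal ((cmod (g (mat_ipow_app (transpose A) j \<xi>)))\<^sup>2) \<partial>count_space UNIV)" for \<xi>
  have tA: "invertible (transpose A)" using A by (simp add: invertible_det_nz)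
  have gm: "g \<in> borel_measurable lebesgue" using g by (auto simp: fourier_L2_def L2_def)
  have gj: "(\<lambda>\<xi>. ennreal ((cmod (g (mat_ipow_app (transpose A) j \<xi>)))\<^sup>2)) \<in> borel_measurable lebesgue" for j
  proof -
    have "(\<lambda>\<xi>. g (0 + mpow (transpose A) j *v \<xi>)) \<in> borel_measurable lebesgue"
      by (rule measurable_compose[OF lebesgue_affine_vec_measurable[OF invertible_mpow[OF tA]] gm])
    then show ?thesis unfolding mat_ipow_app_eq add_0 by measurable
  qed
  \<comment> \<open>Enumerating the integers presents the sum over j as a series, for which
    measurability of the terms suffices.\<close>
  have "\<Psi> \<xi> = (\<Sum>n. ennreal ((cmod (g (mat_ipow_app (transpose A) (int_decode n) \<xi>)))\<^sup>2))" for \<xi>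
    unfolding \<Psi>_def nn_integral_count_space_nat[symmetric]
    by (rule nn_integral_bij_count_space[symmetric]) (rule bij_int_decode)
  then have \<Psi>m: "\<Psi> \<in> borel_measurable lebesgue"
    using gj by (auto simp: fun_eq_iff[symmetric] intro!: borel_measurable_suminf cong: measurable_cong)
  have E: "ennreal K1 * emeasure lebesgue E \<le> (\<integral>\<^sup>+\<xi>. \<Psi> \<xi> * indicator E \<xi> \<partial>lebesgue)"
    "(\<integral>\<^sup>+\<xi>. \<Psi> \<xi> * indicator E \<xi> \<partial>lebesgue) \<le> ennreal K2 * emeasure lebesgue E"
    if Es: "E \<in> sets lebesgue" and Ef: "emeasure lebesgue E < \<infinity>" for E
  proof -
    define e where "e = (indicator E :: real^'d \<Rightarrow> complex)"
    have em: "e \<in> borel_measurable lebesgue" using Es by (simp add: e_def)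
    have e_int: "integrable lebesgue e"
      unfolding e_def by (rule integrable_indicator_complex[OF Es Ef])
    have e_sq: "(cmod (e x))\<^sup>2 = indicator E x" for x by (simp add: e_def indicator_def)
    have e2: "integrable lebesgue (\<lambda>x. (cmod (e x))\<^sup>2)"
      unfolding e_sq using Es Ef by (intro integrable_real_indicator)
    have pl: "(\<integral>\<^sup>+\<xi>. ennreal ((cmod (lfint e \<xi>))\<^sup>2) \<partial>lebesgue) = emeasure lebesgue E"
      using plancherel_lebesgue[OF e_int e2] Es by (simp add: e_sq ennreal_indicator nn_integral_indicator)
    define f where "f t = cnj (lfint e t)" for t
    have fm: "f \<in> borel_measurable lebesgue"
      unfolding f_def using lfint_measurable[OF em] by measurable
    have f2: "integrable lebesgue (\<lambda>t. (cmod (f t))\<^sup>2)"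
      using pl Ef by (intro integrable_square_of_nn_integral fm) (simp add: f_def)
    have fL2: "f \<in> L2" using fm f2 by (simp add: L2_def)
    \<comment> \<open>By Plancherel the squared norm of the test function is the measure of E, so
      both sides of the frame inequality become quantities attached to E.\<close>
    have norm_f: "ennreal ((L2_norm f)\<^sup>2) = emeasure lebesgue E"
    proof -
      have "(L2_norm f)\<^sup>2 = (\<integral>t. (cmod (f t))\<^sup>2 \<partial>lebesgue)"
        unfolding L2_norm_def by (rule real_sqrt_pow2) simp
      then show ?thesis using nn_integral_eq_integral[OF f2] pl by (simp add: f_def)
    qed
    have "(\<integral>\<^sup>+ j. (\<integral>\<^sup>+ x. ennreal ((cmod (L2_inner f (qreg A (x, j) psi)))\<^sup>2
                 * \<bar>det A\<bar> powr (- real_of_int j)) \<partial>lebesgue) \<partial>count_space UNIV)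
      = (\<integral>\<^sup>+ j. (\<integral>\<^sup>+\<xi>. ennreal ((cmod (g (mat_ipow_app (transpose A) j \<xi>)))\<^sup>2) * indicator E \<xi> \<partial>lebesgue) \<partial>count_space UNIV)"
      unfolding f_def e_def voice_nn_integral_eq[OF A psi g Es Ef] ..
    also have "\<dots> = (\<integral>\<^sup>+\<xi>. (\<integral>\<^sup>+ j. ennreal ((cmod (g (mat_ipow_app (transpose A) j \<xi>)))\<^sup>2) * indicator E \<xi> \<partial>count_space UNIV) \<partial>lebesgue)"
      by (intro nn_integral_count_space_nn_integral[symmetric] countableI_type borel_measurable_times_ennreal gj
          borel_measurable_indicator Es)
    also have "\<dots> = (\<integral>\<^sup>+\<xi>. \<Psi> \<xi> * indicator E \<xi> \<partial>lebesgue)"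
      unfolding \<Psi>_def by (simp add: nn_integral_multc)
    finally show "ennreal K1 * emeasure lebesgue E \<le> (\<integral>\<^sup>+\<xi>. \<Psi> \<xi> * indicator E \<xi> \<partial>lebesgue)"
      "(\<integral>\<^sup>+\<xi>. \<Psi> \<xi> * indicator E \<xi> \<partial>lebesgue) \<le> ennreal K2 * emeasure lebesgue E"
      using frame[OF fL2] K by (simp_all add: ennreal_mult' norm_f)
  qed
  \<comment> \<open>In this direction \<Psi> is on the larger side and is not bounded by assumption,
    but where it falls below K1 it is at most K1, so c = K1 is admissible.\<close>
  have "AE \<xi> in lebesgue. ennreal K1 \<le> \<Psi> \<xi>"
  proof (rule AE_le_of_set_nn_integral_le[where c = "ennreal K1"])
    fix S :: "(real^'d) set" assume S: "S \<in> sets lebesgue" "emeasure lebesgue S < \<infinity>"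
    show "(\<integral>\<^sup>+\<xi>. ennreal K1 * indicator S \<xi> \<partial>lebesgue) \<le> (\<integral>\<^sup>+\<xi>. \<Psi> \<xi> * indicator S \<xi> \<partial>lebesgue)"
      unfolding nn_integral_cmult_indicator[OF S(1)] by (rule E(1)[OF S])
  qed (auto simp: \<Psi>m less_imp_le)
  then show "AE \<xi> in lebesgue. ennreal K1 \<le> (\<integral>\<^sup>+ j. ennreal ((cmod (g (mat_ipow_app (transpose A) j \<xi>)))\<^sup>2) \<partial>count_space UNIV)"
    unfolding \<Psi>_def .
  have "AE \<xi> in lebesgue. \<Psi> \<xi> \<le> ennreal K2"
  proof (rule AE_le_of_set_nn_integral_le[where c = "ennreal K2"])
    fix S :: "(real^'d) set" assume S: "S \<in> sets lebesgue" "emeasure lebesgue S < \<infinity>"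
    show "(\<integral>\<^sup>+\<xi>. \<Psi> \<xi> * indicator S \<xi> \<partial>lebesgue) \<le> (\<integral>\<^sup>+\<xi>. ennreal K2 * indicator S \<xi> \<partial>lebesgue)"
      unfolding nn_integral_cmult_indicator[OF S(1)] by (rule E(2)[OF S])
  qed (auto simp: \<Psi>m)
  then show "AE \<xi> in lebesgue. (\<integral>\<^sup>+ j. ennreal ((cmod (g (mat_ipow_app (transpose A) j \<xi>)))\<^sup>2) \<partial>count_space UNIV) \<le> ennreal K2"
    unfolding \<Psi>_def .
qed

text \<open>In the Parseval case C1 = C2 = 1 the two bounds coincide and the inequalities become
  equalities. The Fourier transform is represented by an arbitrary \<open>g\<close> with
  \<open>fourier_L2 psi g\<close>, a condition that fixes g up to a null set.\<close>

theorem mainTheorem8: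
  fixes A P :: "real^'d^'d" and psi :: "real^'d \<Rightarrow> complex" and C1 C2 :: real
  assumes "invertible A" and "invertible P"
    and "psi \<in> B_pi A"
    and "0 < C1" and "C1 \<le> C2"
    and frame: "\<forall>f \<in> L2.
        ennreal (C1 * (L2_norm f)\<^sup>2)
          \<le> (\<integral>\<^sup>+ jk. ennreal ((cmod (L2_inner f
                 (qreg A (mat_ipow_app A (fst jk) (P *v (\<chi> i. real_of_int (snd jk $ i))), fst jk) psi)))\<^sup>2)
              \<partial>count_space (UNIV :: (int \<times> (int^'d)) set))
        \<and> (\<integral>\<^sup>+ jk. ennreal ((cmod (L2_inner f
                 (qreg A (mat_ipow_app A (fst jk) (P *v (\<chi> i. real_of_int (snd jk $ i))), fst jk) psi)))\<^sup>2)
              \<partial>count_space (UNIV :: (int \<times> (int^'d)) set))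
          \<le> ennreal (C2 * (L2_norm f)\<^sup>2)"
  shows "(\<forall>f \<in> L2.
        ennreal (C1 * \<bar>det P\<bar> * (L2_norm f)\<^sup>2)
          \<le> (\<integral>\<^sup>+ j. (\<integral>\<^sup>+ x. ennreal ((cmod (L2_inner f (qreg A (x, j) psi)))\<^sup>2
                 * \<bar>det A\<bar> powr (- real_of_int j)) \<partial>lebesgue) \<partial>count_space UNIV)
        \<and> (\<integral>\<^sup>+ j. (\<integral>\<^sup>+ x. ennreal ((cmod (L2_inner f (qreg A (x, j) psi)))\<^sup>2
                 * \<bar>det A\<bar> powr (- real_of_int j)) \<partial>lebesgue) \<partial>count_space UNIV)
          \<le> ennreal (C2 * \<bar>det P\<bar> * (L2_norm f)\<^sup>2))
    \<and> (\<forall>g. fourier_L2 psi g \<longrightarrow>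
        (AE \<xi> in lebesgue.
           ennreal C1 \<le> ennreal (1 / \<bar>det P\<bar>) *
             (\<integral>\<^sup>+ j. ennreal ((cmod (g (mat_ipow_app (transpose A) j \<xi>)))\<^sup>2) \<partial>count_space UNIV)
         \<and> ennreal (1 / \<bar>det P\<bar>) *
             (\<integral>\<^sup>+ j. ennreal ((cmod (g (mat_ipow_app (transpose A) j \<xi>)))\<^sup>2) \<partial>count_space UNIV)
           \<le> ennreal C2))"
proof -
  have psi: "psi \<in> L2" using assms(3) by (simp add: B_pi_def)
  have detP: "\<bar>det P\<bar> > 0" using assms(2) by (simp add: invertible_det_nz)
  note cont = continuous_frame_bounds[OF assms(1-3) _ assms(4,5) frame]
  have "AE \<xi> in lebesgue. ennreal C1 \<le> ennreal (1 / \<bar>det P\<bar>) *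
             (\<integral>\<^sup>+ j. ennreal ((cmod (g (mat_ipow_app (transpose A) j \<xi>)))\<^sup>2) \<partial>count_space UNIV)
         \<and> ennreal (1 / \<bar>det P\<bar>) *
             (\<integral>\<^sup>+ j. ennreal ((cmod (g (mat_ipow_app (transpose A) j \<xi>)))\<^sup>2) \<partial>count_space UNIV)
           \<le> ennreal C2" if g: "fourier_L2 psi g" for g
  proof -
    have K: "0 \<le> C1 * \<bar>det P\<bar>" "0 \<le> C2 * \<bar>det P\<bar>" using assms(4,5) by simp_all
    \<comment> \<open>The Calderon bounds inherit the factor |det P| from the continuous frame;
      multiplying by its reciprocal recovers C1 and C2.\<close>
    have cancel: "ennreal (1 / \<bar>det P\<bar>) * ennreal (C * \<bar>det P\<bar>) = ennreal C" for C
      using detP by (simp add: ennreal_mult'[symmetric])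
    have "AE \<xi> in lebesgue. ennreal (C1 * \<bar>det P\<bar>)
        \<le> (\<integral>\<^sup>+ j. ennreal ((cmod (g (mat_ipow_app (transpose A) j \<xi>)))\<^sup>2) \<partial>count_space UNIV)"
      by (rule calderon_bounds(1)[OF assms(1) psi g K]) (erule cont)
    moreover have "AE \<xi> in lebesgue. (\<integral>\<^sup>+ j. ennreal ((cmod (g (mat_ipow_app (transpose A) j \<xi>)))\<^sup>2) \<partial>count_space UNIV)
        \<le> ennreal (C2 * \<bar>det P\<bar>)"
      by (rule calderon_bounds(2)[OF assms(1) psi g K]) (erule cont)
    ultimately show ?thesis
    proof eventually_elim
      case (elim \<xi>)
      from mult_left_mono[OF elim(1), of "ennreal (1 / \<bar>det P\<bar>)"] mult_left_mono[OF elim(2), of "ennreal (1 / \<bar>det P\<bar>)"]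
      show ?case by (simp only: cancel) simp
    qed
  qed
  with cont show ?thesis by blast
qed

end
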